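(* Let $\lambda$ be any cardinal number and $k$ any field of characteristic $0$. Then there exists a henselian valued field $(L,v)$ with residue field $k$ which has the following properties: a) $L$ contains a $k$-algebra $R$ which is an additive complement of its valuation ring such that $\mathrm{Quot}\, R=L$. b) At the same time, for each non-zero cardinal number $\kappa\leq\lambda$, $L$ contains a $k$-algebra $R_\kappa$ which is an additive complement of its valuation ring such that $\mathrm{trdeg}\, L|\mathrm{Quot}\, R_\kappa=\kappa$. If in addition $k$ is an archimedean ordered field and $<$ is any ordering on $L$ compatible with $v$, then $(L,<)$ admits an integer part $I$ such that $\mathrm{Quot}\, I=L$. At the same time, for each non-zero cardinal number $\kappa\leq\lambda$, $L$ admits an integer part $I_\kappa$ such that $\mathrm{trdeg}\, L|\mathrm{Quot}\, I_\kappa=\kappa$.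
   Context: Valuations are Krull valuations (arbitrary ordered abelian value groups). An additive complement of the valuation ring $\mathcal{O}$ of $L$ is an additive subgroup $A$ of $L$ with $A\cap\mathcal{O}=\{0\}$ and $A+\mathcal{O}=L$. The $k$-algebras $R$, $R_\kappa$ are not required to contain $1$. $\mathrm{Quot}\, R$ denotes the quotient field of $R$, taken inside $L$, and $\mathrm{trdeg}$ denotes transcendence degree. An ordering $<$ on a valued field $(L,v)$ is compatible with $v$ if for all $x,y\in L$, $0<x\leq y$ implies $vx\geq vy$; this holds if and only if the valuation ring of $v$ is a convex subset of $(L,<)$, and if and only if $<$ induces an ordering on the residue field $Lv$. An integer part of an ordered field $(L,<)$ is a discretely ordered subring $I$ with $1$ such that for all $a\in L$ there is $r\in I$ with $r\leq a<r+1$. *)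

theory Defs
  imports "HOL-Algebra.Algebra"
begin

unbundle cardinal_syntax

section \<open>Ordered abelian groups and ordered fields\<close>

text \<open>Orders are non-strict and given as relations on the carrier. Ordered abelian groups are
  written multiplicatively, as everywhere in HOL-Algebra.\<close>

locale ordered_abelian_group = comm_group G for G (structure) and gle +
  assumes gle_linear: "linear_order_on (carrier G) gle"
    and gle_mult: "\<lbrakk>(x, y) \<in> gle; z \<in> carrier G\<rbrakk> \<Longrightarrow> (x \<otimes> z, y \<otimes> z) \<in> gle"

locale ordered_field = field F for F (structure) and leq +
  assumes le_linear: "linear_order_on (carrier F) leq"
    and le_add: "\<lbrakk>(x, y) \<in> leq; z \<in> carrier F\<rbrakk> \<Longrightarrow> (x \<oplus> z, y \<oplus> z) \<in> leq"
    and le_mult: "\<lbrakk>(\<zero>, x) \<in> leq; (\<zero>, y) \<in> leq\<rbrakk> \<Longrightarrow> (\<zero>, x \<otimes> y) \<in> leq"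

locale archimedean_ordered_field = ordered_field F leq for F (structure) and leq +
  assumes archimedean: "x \<in> carrier F \<Longrightarrow> \<exists>n::nat. (x, [n] \<cdot> \<one>) \<in> leq"

abbreviation strict :: "'a rel \<Rightarrow> 'a rel" where
  "strict leq \<equiv> leq - Id"

section \<open>Krull valuations\<close>

text \<open>A valuation takes values in the value group extended by an element \<open>\<infinity>\<close> above the whole
  group. The values are of type \<open>'g option\<close>, with \<open>None\<close> in the role of \<open>\<infinity>\<close>.\<close>

definition val_le :: "'g rel \<Rightarrow> 'g option \<Rightarrow> 'g option \<Rightarrow> bool" where
  "val_le gle a b \<longleftrightarrow> b = None \<or> (\<exists>x y. a = Some x \<and> b = Some y \<and> (x, y) \<in> gle)"

locale valued_field = field L + Val: ordered_abelian_group G gle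
  for L (structure) and G :: "('g, 'n) monoid_scheme" and gle +
  fixes v :: "'a \<Rightarrow> 'g option"
  assumes v_infinity: "x \<in> carrier L \<Longrightarrow> v x = None \<longleftrightarrow> x = \<zero>"
    and v_onto: "v ` (carrier L - {\<zero>}) = Some ` carrier G"
    and v_mult: "\<lbrakk>x \<in> carrier L; y \<in> carrier L; v x = Some a; v y = Some b\<rbrakk>
                  \<Longrightarrow> v (x \<otimes> y) = Some (a \<otimes>\<^bsub>G\<^esub> b)"
    and v_add: "\<lbrakk>x \<in> carrier L; y \<in> carrier L\<rbrakk>
                  \<Longrightarrow> val_le gle (v x) (v (x \<oplus> y)) \<or> val_le gle (v y) (v (x \<oplus> y))"

definition val_ring :: "('a, 'm) ring_scheme \<Rightarrow> ('g, 'n) monoid_scheme \<Rightarrow> 'g rel \<Rightarrow> ('a \<Rightarrow> 'g option)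
    \<Rightarrow> 'a set" where
  "val_ring L G gle v = {x \<in> carrier L. val_le gle (Some \<one>\<^bsub>G\<^esub>) (v x)}"

definition val_ideal :: "('a, 'm) ring_scheme \<Rightarrow> ('g, 'n) monoid_scheme \<Rightarrow> 'g rel \<Rightarrow> ('a \<Rightarrow> 'g option)
    \<Rightarrow> 'a set" where
  "val_ideal L G gle v = {x \<in> val_ring L G gle v. v x \<noteq> Some \<one>\<^bsub>G\<^esub>}"

definition residue_field :: "('a, 'm) ring_scheme \<Rightarrow> ('g, 'n) monoid_scheme \<Rightarrow> 'g rel
    \<Rightarrow> ('a \<Rightarrow> 'g option) \<Rightarrow> 'a set ring" where
  "residue_field L G gle v = (L\<lparr>carrier := val_ring L G gle v\<rparr>) Quot (val_ideal L G gle v)"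

definition residue :: "('a, 'm) ring_scheme \<Rightarrow> ('g, 'n) monoid_scheme \<Rightarrow> 'g rel
    \<Rightarrow> ('a \<Rightarrow> 'g option) \<Rightarrow> 'a \<Rightarrow> 'a set" where
  "residue L G gle v x = val_ideal L G gle v +>\<^bsub>L\<lparr>carrier := val_ring L G gle v\<rparr>\<^esub> x"

text \<open>\<open>L\<close> contains \<open>k\<close> (through \<open>\<iota>\<close>), and the residue field of \<open>L\<close> is this very \<open>k\<close>: the residue map
  restricted to \<open>k\<close> is an isomorphism onto the residue field.\<close>

definition has_residue_field :: "('a, 'm) ring_scheme \<Rightarrow> ('g, 'n) monoid_scheme \<Rightarrow> 'g rel
    \<Rightarrow> ('a \<Rightarrow> 'g option) \<Rightarrow> ('k, 'r) ring_scheme \<Rightarrow> ('k \<Rightarrow> 'a) \<Rightarrow> bool" where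
  "has_residue_field L G gle v k \<iota> \<longleftrightarrow>
     \<iota> \<in> ring_hom k L \<and> \<iota> ` carrier k \<subseteq> val_ring L G gle v \<and>
     residue L G gle v \<circ> \<iota> \<in> ring_iso k (residue_field L G gle v)"

text \<open>Hensel's Lemma. The polynomial of degree at most \<open>n\<close> with coefficients \<open>c\<close>, and its formal
  derivative, are given by their values, since HOL-Algebra has no formal derivative.\<close>

definition poly_value :: "('a, 'm) ring_scheme \<Rightarrow> nat \<Rightarrow> (nat \<Rightarrow> 'a) \<Rightarrow> 'a \<Rightarrow> 'a" where
  "poly_value L n c x = (\<Oplus>\<^bsub>L\<^esub>i\<in>{0..n}. c i \<otimes>\<^bsub>L\<^esub> x [^]\<^bsub>L\<^esub> i)"

definition poly_deriv_value :: "('a, 'm) ring_scheme \<Rightarrow> nat \<Rightarrow> (nat \<Rightarrow> 'a) \<Rightarrow> 'a \<Rightarrow> 'a" where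
  "poly_deriv_value L n c x = (\<Oplus>\<^bsub>L\<^esub>i\<in>{1..n}. [i] \<cdot>\<^bsub>L\<^esub> (c i \<otimes>\<^bsub>L\<^esub> x [^]\<^bsub>L\<^esub> (i - 1)))"

definition henselian :: "('a, 'm) ring_scheme \<Rightarrow> ('g, 'n) monoid_scheme \<Rightarrow> 'g rel
    \<Rightarrow> ('a \<Rightarrow> 'g option) \<Rightarrow> bool" where
  "henselian L G gle v \<longleftrightarrow> valued_field L G gle v \<and>
     (\<forall>n c. \<forall>b \<in> val_ring L G gle v.
        (\<forall>i\<le>n. c i \<in> val_ring L G gle v) \<and>
        poly_value L n c b \<in> val_ideal L G gle v \<and>
        v (poly_deriv_value L n c b) = Some \<one>\<^bsub>G\<^esub>
        \<longrightarrow> (\<exists>a \<in> val_ring L G gle v. poly_value L n c a = \<zero>\<^bsub>L\<^esub> \<and>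
               a \<ominus>\<^bsub>L\<^esub> b \<in> val_ideal L G gle v))"

section \<open>Algebras, additive complements and quotient fields\<close>

text \<open>Sub-\<open>k\<close>-algebras of \<open>L\<close>, not required to contain \<open>\<one>\<close>. The library's \<open>subalgebra\<close> does not
  demand closure under multiplication.\<close>

definition k_algebra :: "('a, 'm) ring_scheme \<Rightarrow> ('k, 'r) ring_scheme \<Rightarrow> ('k \<Rightarrow> 'a) \<Rightarrow> 'a set \<Rightarrow> bool" where
  "k_algebra L k \<iota> R \<longleftrightarrow> additive_subgroup R L \<and>
     (\<forall>x\<in>R. \<forall>y\<in>R. x \<otimes>\<^bsub>L\<^esub> y \<in> R) \<and> (\<forall>c\<in>carrier k. \<forall>x\<in>R. \<iota> c \<otimes>\<^bsub>L\<^esub> x \<in> R)"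

definition additive_complement :: "('a, 'm) ring_scheme \<Rightarrow> 'a set \<Rightarrow> 'a set \<Rightarrow> bool" where
  "additive_complement L \<O> A \<longleftrightarrow>
     additive_subgroup A L \<and> A \<inter> \<O> = {\<zero>\<^bsub>L\<^esub>} \<and> A <+>\<^bsub>L\<^esub> \<O> = carrier L"

text \<open>The quotient field inside \<open>L\<close> of a subring \<open>R \<noteq> {\<zero>}\<close>, with or without \<open>\<one>\<close>.
  For \<open>R = {\<zero>}\<close> there are no fractions and the set is empty.\<close>

definition quot_field :: "('a, 'm) ring_scheme \<Rightarrow> 'a set \<Rightarrow> 'a set" where
  "quot_field L R = {a \<otimes>\<^bsub>L\<^esub> inv\<^bsub>L\<^esub> b | a b. a \<in> R \<and> b \<in> R \<and> b \<noteq> \<zero>\<^bsub>L\<^esub>}"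

section \<open>Transcendence degree\<close>

text \<open>\<open>B\<close> is algebraically independent over \<open>K\<close> if no non-trivial polynomial over \<open>K\<close> in finitely
  many variables vanishes at distinct elements of \<open>B\<close>. Here \<open>S\<close> is the set of elements substituted
  for the variables, \<open>M\<close> is a finite set of exponent vectors \<open>S \<Rightarrow> nat\<close> (extended by \<open>0\<close>, so that
  distinct elements of \<open>M\<close> are distinct monomials), and \<open>c\<close> gives the coefficients.\<close>

definition algebraically_independent :: "('a, 'm) ring_scheme \<Rightarrow> 'a set \<Rightarrow> 'a set \<Rightarrow> bool" where
  "algebraically_independent L K B \<longleftrightarrow> B \<subseteq> carrier L \<and>
     (\<forall>S M. \<forall>c :: ('a \<Rightarrow> nat) \<Rightarrow> 'a.
        finite S \<and> S \<subseteq> B \<and> finite M \<and> (\<forall>m\<in>M. \<forall>b. b \<notin> S \<longrightarrow> m b = 0) \<and> (\<forall>m\<in>M. c m \<in> K) \<and>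
        (\<Oplus>\<^bsub>L\<^esub>m\<in>M. c m \<otimes>\<^bsub>L\<^esub> (\<Otimes>\<^bsub>L\<^esub>b\<in>S. b [^]\<^bsub>L\<^esub> m b)) = \<zero>\<^bsub>L\<^esub>
        \<longrightarrow> (\<forall>m\<in>M. c m = \<zero>\<^bsub>L\<^esub>))"

definition transcendence_basis :: "('a, 'm) ring_scheme \<Rightarrow> 'a set \<Rightarrow> 'a set \<Rightarrow> bool" where
  "transcendence_basis L K B \<longleftrightarrow> algebraically_independent L K B \<and>
     (\<forall>x\<in>carrier L. ring.algebraic L (generate_field L (K \<union> B)) x)"

text \<open>\<open>trdeg L|K = \<kappa>\<close>, for a subfield \<open>K\<close> of \<open>L\<close> and a cardinal \<open>\<kappa>\<close>.\<close>

definition has_trdeg :: "('a, 'm) ring_scheme \<Rightarrow> 'a set \<Rightarrow> 'c rel \<Rightarrow> bool" where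
  "has_trdeg L K \<kappa> \<longleftrightarrow> subfield K L \<and> (\<exists>B. transcendence_basis L K B \<and> |B| =o \<kappa>)"

section \<open>Compatible orderings and integer parts\<close>

definition compatible :: "('a, 'm) ring_scheme \<Rightarrow> 'g rel \<Rightarrow> ('a \<Rightarrow> 'g option) \<Rightarrow> 'a rel \<Rightarrow> bool" where
  "compatible L gle v leq \<longleftrightarrow>
     (\<forall>x y. (\<zero>\<^bsub>L\<^esub>, x) \<in> strict leq \<and> (x, y) \<in> leq \<longrightarrow> val_le gle (v y) (v x))"

text \<open>The ordering which a compatible ordering of \<open>L\<close> induces on the residue field, and its being
  the given ordering \<open>kle\<close> of \<open>k\<close>. Compatibility alone does not tie the induced ordering to \<open>kle\<close>:
  a field may have an archimedean ordering and non-archimedean ones as well.\<close>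

definition residue_order :: "('a, 'm) ring_scheme \<Rightarrow> ('g, 'n) monoid_scheme \<Rightarrow> 'g rel
    \<Rightarrow> ('a \<Rightarrow> 'g option) \<Rightarrow> 'a rel \<Rightarrow> 'a set rel" where
  "residue_order L G gle v leq =
     {(residue L G gle v x, residue L G gle v y) | x y.
        x \<in> val_ring L G gle v \<and> y \<in> val_ring L G gle v \<and> (x, y) \<in> leq}"

definition induces :: "('a, 'm) ring_scheme \<Rightarrow> ('g, 'n) monoid_scheme \<Rightarrow> 'g rel
    \<Rightarrow> ('a \<Rightarrow> 'g option) \<Rightarrow> 'a rel \<Rightarrow> ('k, 'r) ring_scheme \<Rightarrow> ('k \<Rightarrow> 'a) \<Rightarrow> 'k rel \<Rightarrow> bool" where
  "induces L G gle v leq k \<iota> kle \<longleftrightarrow>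
     (\<forall>c\<in>carrier k. \<forall>d\<in>carrier k.
        (c, d) \<in> kle \<longleftrightarrow>
        (residue L G gle v (\<iota> c), residue L G gle v (\<iota> d)) \<in> residue_order L G gle v leq)"

definition integer_part :: "('a, 'm) ring_scheme \<Rightarrow> 'a rel \<Rightarrow> 'a set \<Rightarrow> bool" where
  "integer_part L leq I \<longleftrightarrow> subring I L \<and>
     (\<forall>r\<in>I. \<not> ((\<zero>\<^bsub>L\<^esub>, r) \<in> strict leq \<and> (r, \<one>\<^bsub>L\<^esub>) \<in> strict leq)) \<and>
     (\<forall>a\<in>carrier L. \<exists>r\<in>I. (r, a) \<in> leq \<and> (a, r \<oplus>\<^bsub>L\<^esub> \<one>\<^bsub>L\<^esub>) \<in> strict leq)"

text \<open>HOL cannot quantify existentially over types, so the field to be constructed and its value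
  group need fixed ambient types. Only their cardinality matters, not any operations on them: every
  field of cardinality at most \<open>max |'k| |'l| \<aleph>\<^sub>0\<close> has an isomorphic copy with carrier in
  \<open>('k, 'l) hahn\<close> if \<open>'k\<close> has at least two elements, and every group of cardinality at most
  \<open>max |'l| \<aleph>\<^sub>0\<close> has one in \<open>'l exponent\<close>.\<close>

type_synonym 'l exponent = "nat \<times> 'l \<Rightarrow> rat"
type_synonym ('k, 'l) hahn = "'l exponent \<Rightarrow> 'k"

end

theory Submission
  imports Defs "HOL-Library.Poly_Mapping"
begin

text \<open>Take independent variables with values in a lexicographically ordered free group, one
  variable \<open>x n i\<close> for each number \<open>n\<close> and each element \<open>i\<close> of the ambient type of \<open>lam\<close>, such that
  the value of a variable with larger \<open>n\<close> exceeds all multiples of the values of variables with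
  smaller \<open>n\<close> (and those with equal \<open>n\<close> are ordered in the same way along a well-order). The field
  \<open>L\<close> is the relative algebraic closure of the field generated by \<open>k\<close> and all variables in the field
  of Hahn series over \<open>k\<close>. The Hahn field is spherically complete, so contractions have fixed points
  (\<open>contraction_fixed_point\<close>). Newton's method is such a contraction, not only for the given valuation
  but also for all its coarsenings (\<open>Hensel_coarse\<close>), and \<open>L\<close> inherits the roots that it yields,
  because they are algebraic (\<open>henselian_hull\<close>).

  For an index \<open>t\<close> let \<open>K t\<close> be the relative algebraic closure of the field generated over \<open>k\<close> by the
  variables dominated by \<open>t\<close>. All its non-zero elements have values in the convex subgroup spanned by the
  values of these variables, and by Hensel's Lemma \<open>K t\<close> is a field of representatives for the
  residue field of the corresponding coarsening of \<open>L\<close> (\<open>residue_representative\<close>). Therefore the pole of an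
  element of \<open>L\<close> can be removed term by term: one subtracts \<open>c * x t ^ (- m)\<close> with \<open>c\<close> in \<open>K t\<close> and \<open>m > 0\<close>,
  which lowers the order of the pole at \<open>t\<close>, until only poles at dominated indices are left; this
  terminates because domination is well-founded (\<open>complement_approx\<close>). These terms span an algebra. It
  meets the valuation ring only in \<open>0\<close>, since terms with different \<open>t\<close> or \<open>m\<close> have different values, all
  of them negative. So it is an additive complement, and its quotient field is the union of all \<open>K t\<close>
  (\<open>quot_complement\<close>). This union is \<open>L\<close>, as an algebraic equation involves only finitely many variables.

  The freedom needed for the smaller quotient fields lies in the choice of the variables. Given a
  set \<open>J\<close> of \<open>\<kappa>\<close> elements, replace \<open>x n j\<close> by \<open>y n j = x n j - x (n + 1) j\<close> for \<open>j\<close> in \<open>J\<close>.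
  Values do not change, and \<open>x n j = y n j + ... + y (m - 1) j + x m j\<close>, where \<open>x m j\<close> has an arbitrarily large
  value. Hence the fields \<open>K t\<close> formed with the new variables still represent the residue fields of
  all coarsenings, and the construction yields an additive complement of the same valuation ring. But
  the elements \<open>x 0 j\<close> with \<open>j\<close> in \<open>J\<close> form a transcendence basis over its quotient field: they generate
  everything together with the new variables, and their independence is witnessed by the
  derivations \<open>D j\<close>, sums of the partial derivatives with respect to sufficiently many \<open>x n j\<close> with
  fixed \<open>j\<close>, which annihilate any given finite set of new variables and hence, in characteristic \<open>0\<close>, everything algebraic over them
  (\<open>partial_derivatives_independent\<close>, \<open>small_complement\<close>).

  Finally, if \<open>k\<close> is archimedean ordered, the sum of the integers and an additive complement that is
  an algebra is an integer part for every compatible ordering, with the same quotient field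
  (\<open>complement_integer_part\<close>).\<close>

section \<open>Well-ordered sets of exponents\<close>

definition well_ordered_set :: "'g::linorder set \<Rightarrow> bool" where
  "well_ordered_set A \<longleftrightarrow> (\<forall>S. S \<subseteq> A \<and> S \<noteq> {} \<longrightarrow> (\<exists>m\<in>S. \<forall>s\<in>S. m \<le> s))"

lemma well_ordered_setD:
  "well_ordered_set A \<Longrightarrow> S \<subseteq> A \<Longrightarrow> S \<noteq> {} \<Longrightarrow> \<exists>m\<in>S. \<forall>s\<in>S. m \<le> s"
  unfolding well_ordered_set_def by simp

lemma well_ordered_set_subset: "well_ordered_set A \<Longrightarrow> B \<subseteq> A \<Longrightarrow> well_ordered_set B"
  unfolding well_ordered_set_def by (meson order_trans)

lemma well_ordered_set_Un:
  assumes "well_ordered_set A" "well_ordered_set B"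
  shows "well_ordered_set (A \<union> B)"
  unfolding well_ordered_set_def
proof (intro allI impI, elim conjE)
  fix S assume S: "S \<subseteq> A \<union> B" "S \<noteq> {}"
  show "\<exists>m\<in>S. \<forall>s\<in>S. m \<le> s"
  proof (cases "S \<inter> A = {} \<or> S \<inter> B = {}")
    case True
    then have "S \<subseteq> A \<or> S \<subseteq> B" using S by auto
    then show ?thesis using assms S unfolding well_ordered_set_def by blast
  next
    case False
    obtain a where a: "a \<in> S \<inter> A" "\<forall>s\<in>S \<inter> A. a \<le> s"
      using well_ordered_setD[OF assms(1), of "S \<inter> A"] False by auto
    obtain b where b: "b \<in> S \<inter> B" "\<forall>s\<in>S \<inter> B. b \<le> s"
      using well_ordered_setD[OF assms(2), of "S \<inter> B"] False by auto
    show ?thesis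
    proof (intro bexI ballI)
      show "min a b \<in> S" using a b by (simp add: min_def)
      fix s assume "s \<in> S"
      then show "min a b \<le> s" using S a b by (auto simp: min_le_iff_disj)
    qed
  qed
qed

lemma well_ordered_set_finite: "finite A \<Longrightarrow> well_ordered_set A"
  unfolding well_ordered_set_def
  by (meson Min_in Min_le finite_subset)

lemma well_ordered_set_initial:
  assumes "\<And>a. a \<in> A \<Longrightarrow> well_ordered_set {b \<in> A. b \<le> a}"
  shows "well_ordered_set A"
  unfolding well_ordered_set_def
proof (intro allI impI, elim conjE)
  fix S assume S: "S \<subseteq> A" "S \<noteq> {}"
  then obtain a where a: "a \<in> S" by auto
  have "\<exists>m\<in>{b \<in> S. b \<le> a}. \<forall>s\<in>{b \<in> S. b \<le> a}. m \<le> s"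
    by (rule well_ordered_setD[OF assms[of a]]) (use S a in auto)
  then obtain m where m: "m \<in> S" "m \<le> a" "\<And>s. s \<in> S \<Longrightarrow> s \<le> a \<Longrightarrow> m \<le> s" by auto
  show "\<exists>m\<in>S. \<forall>s\<in>S. m \<le> s"
  proof (intro bexI ballI)
    fix s assume "s \<in> S"
    then show "m \<le> s" using m by (cases "s \<le> a") auto
  qed (use m in auto)
qed

lemma finite_if_least_greatest:
  fixes C :: "'g::linorder set"
  assumes least: "well_ordered_set C"
    and greatest: "\<And>S. S \<subseteq> C \<Longrightarrow> S \<noteq> {} \<Longrightarrow> \<exists>m\<in>S. \<forall>s\<in>S. s \<le> m"
  shows "finite C"
proof -
  have fin: "finite {d \<in> C. d \<le> c}" if "c \<in> C" for c
  proof (rule ccontr)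
    assume inf: "infinite {d \<in> C. d \<le> c}"
    let ?S = "{c \<in> C. infinite {d \<in> C. d \<le> c}}"
    have "\<exists>m\<in>?S. \<forall>s\<in>?S. m \<le> s"
      by (rule well_ordered_setD[OF least]) (use inf that in auto)
    then obtain m where m: "m \<in> ?S" "\<And>s. s \<in> ?S \<Longrightarrow> m \<le> s" by blast
    show False
    proof (cases "{d \<in> C. d < m} = {}")
      case True
      then have "{d \<in> C. d \<le> m} \<subseteq> {m}" by (auto simp: le_less)
      then show False using m(1) finite_subset by blast
    next
      case False
      have "\<exists>d\<in>{d \<in> C. d < m}. \<forall>s\<in>{d \<in> C. d < m}. s \<le> d"
        by (rule greatest) (use False in auto)
      then obtain d where d: "d \<in> C" "d < m" "\<And>s. s \<in> C \<Longrightarrow> s < m \<Longrightarrow> s \<le> d" by auto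
      have "d \<notin> ?S" using m(2)[of d] d(2) by (meson not_le)
      then have "finite {s \<in> C. s \<le> d}" using d(1) by simp
      moreover have "{s \<in> C. s \<le> m} \<subseteq> insert m {s \<in> C. s \<le> d}"
      proof
        fix s assume "s \<in> {s \<in> C. s \<le> m}"
        then show "s \<in> insert m {s \<in> C. s \<le> d}" using d(3)[of s] by (cases "s = m") auto
      qed
      ultimately show False using m(1) finite_subset[of "{s \<in> C. s \<le> m}" "insert m {s \<in> C. s \<le> d}"]
        by simp
    qed
  qed
  show ?thesis
  proof (cases "C = {}")
    case False
    then obtain m where "m \<in> C" "\<forall>s\<in>C. s \<le> m" using greatest[of C] by auto
    then have "C = {d \<in> C. d \<le> m}" by auto
    then show ?thesis using fin \<open>m \<in> C\<close> by metis
  qed simp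
qed

text \<open>This makes the product of two Hahn series well-defined: a set of first summands without a
  least element would be ill-ordered, one without a greatest element would leave second summands
  without a least one.\<close>

lemma finite_sum_representations:
  fixes A B :: "'g::linordered_ab_group_add set"
  assumes A: "well_ordered_set A" and B: "well_ordered_set B"
  shows "finite {a \<in> A. c - a \<in> B}"
proof (rule finite_if_least_greatest)
  show "well_ordered_set {a \<in> A. c - a \<in> B}"
    by (rule well_ordered_set_subset[OF A]) simp
  fix S assume S: "S \<subseteq> {a \<in> A. c - a \<in> B}" "S \<noteq> {}"
  have "\<exists>m\<in>(\<lambda>a. c - a) ` S. \<forall>s\<in>(\<lambda>a. c - a) ` S. m \<le> s"
    by (rule well_ordered_setD[OF B]) (use S in auto)
  then obtain a where "a \<in> S" and m: "\<And>s. s \<in> S \<Longrightarrow> c - a \<le> c - s" by auto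
  moreover from this have "s \<le> a" if "s \<in> S" for s using m[OF that] by simp
  ultimately show "\<exists>m\<in>S. \<forall>s\<in>S. s \<le> m" by auto
qed

text \<open>If \<open>S\<close> had no least element, one could pass from a non-empty initial segment of \<open>S\<close> to a smaller
  one by choosing an element whose second summand is least possible; all first summands that
  occur below it are smaller than its own first summand. Repeating this contradicts the
  well-ordering of the first summands.\<close>

lemma well_ordered_set_plus:
  fixes A B :: "'g::linordered_ab_group_add set"
  assumes A: "well_ordered_set A" and B: "well_ordered_set B"
  shows "well_ordered_set {a + b | a b. a \<in> A \<and> b \<in> B}"
  unfolding well_ordered_set_def
proof (intro allI impI, elim conjE, rule ccontr)
  fix S assume S: "S \<subseteq> {a + b | a b. a \<in> A \<and> b \<in> B}" "S \<noteq> {}"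
    and "\<not> (\<exists>m\<in>S. \<forall>s\<in>S. m \<le> s)"
  then have no_least: "\<exists>s'\<in>S. s' < s" if "s \<in> S" for s
    using that by (meson not_le)
  \<comment> \<open>the strict bounds in \<open>A\<close> for the first summands in some initial segment of \<open>S\<close>\<close>
  let ?bd = "{a \<in> A. \<exists>u\<in>S. \<forall>a'\<in>A. \<forall>b\<in>B. a' + b \<in> S \<and> a' + b < u \<longrightarrow> a' < a}"
  have step: "\<exists>a\<in>?bd. a + b \<in> S \<and> a + b < u" if "u \<in> S" "b \<in> B" "\<exists>a\<in>A. a + b \<in> S \<and> a + b < u"
    and least: "\<And>b'. b' \<in> B \<Longrightarrow> \<exists>a\<in>A. a + b' \<in> S \<and> a + b' < u \<Longrightarrow> b \<le> b'" for u b
  proof -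
    from that(3) obtain a where a: "a \<in> A" "a + b \<in> S" "a + b < u" by auto
    have "a' < a" if *: "a' \<in> A" "b' \<in> B" "a' + b' \<in> S" "a' + b' < a + b" for a' b'
    proof -
      have "a' + b' < u" using *(4) a(3) by (rule less_trans)
      then have "b \<le> b'" using least * by blast
      then show ?thesis using *(4) by (meson add_le_cancel_left add_mono not_le)
    qed
    then show ?thesis using a by blast
  qed
  have ex: "\<exists>a\<in>?bd. \<exists>b\<in>B. a + b \<in> S \<and> a + b < u" if u: "u \<in> S" for u
  proof -
    let ?T = "{b \<in> B. \<exists>a\<in>A. a + b \<in> S \<and> a + b < u}"
    obtain s where "s \<in> S" "s < u" using no_least[OF u] by auto
    then have "?T \<noteq> {}" using S(1) by blast
    then have "\<exists>b\<in>?T. \<forall>b'\<in>?T. b \<le> b'" by (intro well_ordered_setD[OF B]) auto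
    then obtain b where b: "b \<in> B" "\<exists>a\<in>A. a + b \<in> S \<and> a + b < u" "\<forall>b'\<in>?T. b \<le> b'" by blast
    have "\<exists>a\<in>?bd. a + b \<in> S \<and> a + b < u" by (rule step[OF u b(1,2)]) (use b(3) in simp)
    then show ?thesis using b(1) by blast
  qed
  have "?bd \<noteq> {}" using ex S(2) by fast
  then have "\<exists>a\<in>?bd. \<forall>a'\<in>?bd. a \<le> a'" by (intro well_ordered_setD[OF A]) auto
  then obtain a where a: "a \<in> ?bd" "\<forall>a'\<in>?bd. a \<le> a'" by (elim bexE) 
  then obtain u where u: "u \<in> S" "\<And>a' b. a' \<in> A \<Longrightarrow> b \<in> B \<Longrightarrow> a' + b \<in> S \<Longrightarrow> a' + b < u \<Longrightarrow> a' < a"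
    by blast
  obtain a' b where "a' \<in> ?bd" "b \<in> B" "a' + b \<in> S" "a' + b < u" using ex[OF u(1)] by blast
  then have "a \<le> a'" "a' < a" using a(2) u(2) by auto
  then show False by simp
qed

section \<open>Valued fields with values in a linearly ordered group\<close>

text \<open>The value \<open>\<infinity>\<close> of \<open>\<zero>\<close> is avoided by working with the relation \<open>ge x a\<close>, which
  reads \<open>v x \<ge> a\<close>.\<close>

locale ord_ring = cring R for R (structure) +
  fixes ord :: "'a \<Rightarrow> 'g::linordered_ab_group_add"
  assumes ord_add': "\<lbrakk>x \<in> carrier R; y \<in> carrier R; x \<noteq> \<zero>; y \<noteq> \<zero>; x \<oplus> y \<noteq> \<zero>\<rbrakk>
      \<Longrightarrow> min (ord x) (ord y) \<le> ord (x \<oplus> y)"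
    and ord_mult: "\<lbrakk>x \<in> carrier R; y \<in> carrier R; x \<noteq> \<zero>; y \<noteq> \<zero>\<rbrakk>
      \<Longrightarrow> x \<otimes> y \<noteq> \<zero> \<and> ord (x \<otimes> y) = ord x + ord y"
    and one_neq_zero: "\<one> \<noteq> \<zero>"
begin

definition ge :: "'a \<Rightarrow> 'g \<Rightarrow> bool" where "ge x a \<longleftrightarrow> x = \<zero> \<or> a \<le> ord x"
definition gt :: "'a \<Rightarrow> 'g \<Rightarrow> bool" where "gt x a \<longleftrightarrow> x = \<zero> \<or> a < ord x"

lemma ge_zero [simp]: "ge \<zero> a" and gt_zero [simp]: "gt \<zero> a"
  by (auto simp: ge_def gt_def)

lemma gt_imp_ge: "gt x a \<Longrightarrow> ge x a" by (auto simp: ge_def gt_def)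
lemma ge_mono: "ge x a \<Longrightarrow> b \<le> a \<Longrightarrow> ge x b" by (auto simp: ge_def)
lemma ge_gt_mono: "ge x a \<Longrightarrow> b < a \<Longrightarrow> gt x b" by (auto simp: ge_def gt_def)

lemma ge_add: "\<lbrakk>x \<in> carrier R; y \<in> carrier R; ge x a; ge y a\<rbrakk> \<Longrightarrow> ge (x \<oplus> y) a"
  unfolding ge_def using ord_add'[of x y] by (cases "x = \<zero>"; cases "y = \<zero>") (auto simp: min_le_iff_disj intro: order_trans)

lemma gt_add: "\<lbrakk>x \<in> carrier R; y \<in> carrier R; gt x a; gt y a\<rbrakk> \<Longrightarrow> gt (x \<oplus> y) a"
  unfolding gt_def using ord_add'[of x y] by (cases "x = \<zero>"; cases "y = \<zero>") (auto simp: min_le_iff_disj intro: less_le_trans)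

lemma ord_one [simp]: "ord \<one> = 0"
  using ord_mult[of \<one> \<one>] one_neq_zero by simp

lemma ord_minus [simp]: "x \<in> carrier R \<Longrightarrow> ord (\<ominus> x) = ord x"
proof (cases "x = \<zero>")
  case False
  assume x: "x \<in> carrier R"
  have m: "\<ominus> \<one> \<noteq> \<zero>" using one_neq_zero by (metis minus_minus minus_zero one_closed)
  have "\<ominus> \<one> \<otimes> \<ominus> \<one> = \<one>" by (simp add: l_minus)
  then have "ord (\<ominus> \<one>) + ord (\<ominus> \<one>) = 0" using ord_mult[of "\<ominus> \<one>" "\<ominus> \<one>"] m by simp
  then have "ord (\<ominus> \<one>) = 0" by simp
  moreover have "\<ominus> x = \<ominus> \<one> \<otimes> x" using x by (simp add: l_minus)
  ultimately show ?thesis using ord_mult[of "\<ominus> \<one>" x] m x False by simp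
qed simp

lemma minus_eq_zero_iff [simp]: "x \<in> carrier R \<Longrightarrow> \<ominus> x = \<zero> \<longleftrightarrow> x = \<zero>"
  by (metis minus_minus minus_zero)

lemma ge_minus [simp]: "x \<in> carrier R \<Longrightarrow> ge (\<ominus> x) a \<longleftrightarrow> ge x a"
  and gt_minus [simp]: "x \<in> carrier R \<Longrightarrow> gt (\<ominus> x) a \<longleftrightarrow> gt x a"
  by (auto simp: ge_def gt_def)

lemma ge_diff: "\<lbrakk>x \<in> carrier R; y \<in> carrier R; ge x a; ge y a\<rbrakk> \<Longrightarrow> ge (x \<ominus> y) a"
  unfolding a_minus_def by (auto intro: ge_add)

lemma ge_commute: "\<lbrakk>x \<in> carrier R; y \<in> carrier R\<rbrakk> \<Longrightarrow> ge (x \<ominus> y) a \<longleftrightarrow> ge (y \<ominus> x) a"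
  using ge_minus[of "x \<ominus> y" a] by (simp add: a_minus_def minus_add a_comm)

lemma gt_commute: "\<lbrakk>x \<in> carrier R; y \<in> carrier R\<rbrakk> \<Longrightarrow> gt (x \<ominus> y) a \<longleftrightarrow> gt (y \<ominus> x) a"
  using gt_minus[of "x \<ominus> y" a] by (simp add: a_minus_def minus_add a_comm)

lemma ge_mult: "\<lbrakk>x \<in> carrier R; y \<in> carrier R; ge x a; ge y b\<rbrakk> \<Longrightarrow> ge (x \<otimes> y) (a + b)"
  unfolding ge_def using ord_mult[of x y] add_mono[of a "ord x" b "ord y"]
  by (cases "x = \<zero>"; cases "y = \<zero>") auto

lemma gt_mult: "\<lbrakk>x \<in> carrier R; y \<in> carrier R; gt x a; ge y b\<rbrakk> \<Longrightarrow> gt (x \<otimes> y) (a + b)"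
  unfolding ge_def gt_def using ord_mult[of x y] add_less_le_mono[of a "ord x" b "ord y"]
  by (cases "x = \<zero>"; cases "y = \<zero>") auto

lemma diff_triangle:
  assumes "x \<in> carrier R" "y \<in> carrier R" "z \<in> carrier R"
  shows "x \<ominus> z = (x \<ominus> y) \<oplus> (y \<ominus> z)"
  using assms by algebra

lemma ge_trans: "\<lbrakk>x \<in> carrier R; y \<in> carrier R; z \<in> carrier R; ge (x \<ominus> y) a; ge (y \<ominus> z) a\<rbrakk>
    \<Longrightarrow> ge (x \<ominus> z) a"
  using diff_triangle[of x y z] ge_add[of "x \<ominus> y" "y \<ominus> z" a] by simp

lemma gt_trans: "\<lbrakk>x \<in> carrier R; y \<in> carrier R; z \<in> carrier R; gt (x \<ominus> y) a; gt (y \<ominus> z) a\<rbrakk>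
    \<Longrightarrow> gt (x \<ominus> z) a"
  using diff_triangle[of x y z] gt_add[of "x \<ominus> y" "y \<ominus> z" a] by simp

lemma eq_if_all_gt: "\<lbrakk>x \<in> carrier R; y \<in> carrier R; x \<noteq> y \<Longrightarrow> gt (x \<ominus> y) (ord (x \<ominus> y))\<rbrakk> \<Longrightarrow> x = y"
  unfolding gt_def by (metis less_irrefl r_right_minus_eq)

end

text \<open>Nested balls have a common point. A ball is given by a centre and a radius, and the condition
  on two balls says that they are comparable. Families instead of chains of balls are allowed,
  so that no choice of a chain is necessary in applications.\<close>

locale spherically_complete = ord_ring +
  assumes nested_balls: "\<lbrakk>P \<subseteq> carrier R \<times> UNIV;
      \<And>x a y b. (x, a) \<in> P \<Longrightarrow> (y, b) \<in> P \<Longrightarrow> ge (x \<ominus> y) (min a b)\<rbrakk>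
      \<Longrightarrow> \<exists>z\<in>carrier R. \<forall>(x, a)\<in>P. ge (z \<ominus> x) a"
begin

text \<open>Call \<open>z\<close> an approximation up to \<open>d\<close> if \<open>\<phi> z - z\<close> has value at least \<open>d\<close>. As \<open>\<phi>\<close> is
  contracting, approximations up to \<open>d\<close> are congruent modulo values \<open>\<ge> d\<close>, so all of them
  have a common limit \<open>z\<close>. It approximates as well as any of them; but \<open>\<phi> z\<close> would
  be a still better approximation unless \<open>\<phi> z = z\<close>.\<close>

lemma contraction_fixed_point:
  assumes b: "b \<in> carrier R"
    and closed: "\<And>x. x \<in> carrier R \<Longrightarrow> ge (x \<ominus> b) c \<Longrightarrow> \<phi> x \<in> carrier R \<and> ge (\<phi> x \<ominus> b) c"
    and contr: "\<And>x y. \<lbrakk>x \<in> carrier R; y \<in> carrier R; ge (x \<ominus> b) c; ge (y \<ominus> b) c; x \<noteq> y\<rbrakk>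
        \<Longrightarrow> gt (\<phi> x \<ominus> \<phi> y) (ord (x \<ominus> y))"
  obtains z where "z \<in> carrier R" "ge (z \<ominus> b) c" "\<phi> z = z"
proof -
  define P where "P = {(x, d). x \<in> carrier R \<and> ge (x \<ominus> b) c \<and> ge (\<phi> x \<ominus> x) d}"
  have contr': "ge (\<phi> x \<ominus> \<phi> y) d"
    if "x \<in> carrier R" "y \<in> carrier R" "ge (x \<ominus> b) c" "ge (y \<ominus> b) c" "ge (x \<ominus> y) d" for x y d
  proof (cases "x = y")
    case True
    then show ?thesis using closed[of y] that by (simp add: r_neg a_minus_def)
  next
    case False
    then show ?thesis
      using contr[of x y] that unfolding ge_def gt_def by (auto simp: r_right_minus_eq)
  qed
  have "\<exists>z\<in>carrier R. \<forall>(x, a)\<in>P. ge (z \<ominus> x) a"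
  proof (rule nested_balls)
    show "P \<subseteq> carrier R \<times> UNIV" unfolding P_def by auto
    fix x d y e assume xy: "(x, d) \<in> P" "(y, e) \<in> P"
    note cl = closed[of x] closed[of y]
    show "ge (x \<ominus> y) (min d e)"
    proof (rule ccontr)
      assume n: "\<not> ge (x \<ominus> y) (min d e)"
      then have ne: "x \<noteq> y" using xy unfolding P_def by (auto simp: ge_def r_right_minus_eq)
      have lt: "ord (x \<ominus> y) < min d e" using n by (auto simp: ge_def not_le)
      have *: "gt (\<phi> x \<ominus> x) (ord (x \<ominus> y))" "gt (\<phi> y \<ominus> y) (ord (x \<ominus> y))"
        using xy lt unfolding P_def by (auto intro: ge_gt_mono)
      have "gt (x \<ominus> y) (ord (x \<ominus> y))"
      proof (rule gt_trans[of _ "\<phi> x"])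
        show "gt (\<phi> x \<ominus> y) (ord (x \<ominus> y))"
          by (rule gt_trans[of _ "\<phi> y"]) (use xy cl ne * contr in \<open>auto simp: P_def\<close>)
      qed (use xy cl * in \<open>auto simp: P_def gt_commute\<close>)
      then show False using ne xy eq_if_all_gt[of x y] unfolding P_def by auto
    qed
  qed
  then obtain z where z: "z \<in> carrier R" "\<And>x d. (x, d) \<in> P \<Longrightarrow> ge (z \<ominus> x) d" by auto
  have "(b, c) \<in> P" unfolding P_def using b closed[of b] by (auto simp: a_minus_def r_neg)
  then have zb: "ge (z \<ominus> b) c" using z by auto
  note cl = closed[OF z(1) zb]
  have good: "(z, d) \<in> P" if "(x, d) \<in> P" for x d
  proof -
    have x: "x \<in> carrier R" "ge (x \<ominus> b) c" "ge (\<phi> x \<ominus> x) d" and zx: "ge (z \<ominus> x) d"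
      using that z(2) unfolding P_def by auto
    have "ge (\<phi> z \<ominus> z) d"
      by (rule ge_trans[of _ "\<phi> x"], use z x cl closed[of x] in simp_all)
        (use contr' zb zx x z cl closed[of x] ge_trans[of "\<phi> x" x z] ge_commute in auto)
    then show ?thesis using z(1) zb unfolding P_def by auto
  qed
  show ?thesis
  proof (cases "\<phi> (\<phi> z) = \<phi> z")
    case True
    then show ?thesis using that cl by blast
  next
    case False
    let ?y = "\<phi> z" and ?d = "ord (\<phi> (\<phi> z) \<ominus> \<phi> z)"
    have cl2: "\<phi> ?y \<in> carrier R" using closed[of ?y] cl by auto
    have ne: "?y \<noteq> z" using False by auto
    have "gt (\<phi> ?y \<ominus> ?y) (ord (?y \<ominus> z))" using contr[of ?y z] cl z(1) zb ne by auto
    then have "ord (?y \<ominus> z) < ?d" using False cl cl2 unfolding gt_def by (auto simp: r_right_minus_eq)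
    moreover have "(?y, ?d) \<in> P" using cl unfolding P_def by (auto simp: ge_def)
    then have "(z, ?d) \<in> P" by (rule good)
    then have "ge (?y \<ominus> z) ?d" unfolding P_def by auto
    ultimately show ?thesis using ne cl z(1) unfolding ge_def by (auto simp: r_right_minus_eq)
  qed
qed

end

section \<open>Derivations and monomials\<close>

definition (in ring) derivation :: "('a \<Rightarrow> 'a) \<Rightarrow> bool" where
  "derivation D \<longleftrightarrow> D \<in> carrier R \<rightarrow> carrier R \<and>
     (\<forall>x\<in>carrier R. \<forall>y\<in>carrier R. D (x \<oplus> y) = D x \<oplus> D y \<and> D (x \<otimes> y) = D x \<otimes> y \<oplus> x \<otimes> D y)"

text \<open>These are the properties of the field of Hahn series over \<open>k\<close> that are used later on, apart from
  spherical completeness: coefficients are embedded by \<open>\<iota>\<close>, and \<open>mon a\<close> is the monomial with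
  exponent \<open>a\<close>. They pass to the relative algebraic closure of the monomials, in contrast to a
  description by coefficients.\<close>

locale monomial_field = field R + ord_ring R ord + coef: field k
  for R :: "('a, 'r) ring_scheme" (structure) and ord :: "'a \<Rightarrow> 'g::linordered_ab_group_add"
    and k :: "('k, 'm) ring_scheme" and \<iota> :: "'k \<Rightarrow> 'a" and mon :: "'g \<Rightarrow> 'a" +
  assumes iota_hom: "\<iota> \<in> ring_hom k R"
    and ord_iota: "\<lbrakk>c \<in> carrier k; c \<noteq> \<zero>\<^bsub>k\<^esub>\<rbrakk> \<Longrightarrow> ord (\<iota> c) = 0"
    and residue_exists: "\<lbrakk>x \<in> carrier R; ge x 0\<rbrakk> \<Longrightarrow> \<exists>c\<in>carrier k. gt (x \<ominus> \<iota> c) 0"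
    and mon_nonzero: "mon a \<in> carrier R - {\<zero>}"
    and mon_add: "mon (a + b) = mon a \<otimes> mon b"
    and ord_mon: "ord (mon a) = a"
    and char_0: "(n::nat) > 0 \<Longrightarrow> [n] \<cdot>\<^bsub>k\<^esub> \<one>\<^bsub>k\<^esub> \<noteq> \<zero>\<^bsub>k\<^esub>"
    and derivation_exists: "(\<And>a b. \<chi> (a + b) = \<chi> a + \<chi> b) \<Longrightarrow>
        \<exists>\<theta>. derivation \<theta> \<and> (\<forall>c\<in>carrier k. \<theta> (\<iota> c) = \<zero>) \<and> (\<forall>a. \<theta> (mon a) = \<iota> ([(\<chi> a :: int)] \<cdot>\<^bsub>k\<^esub> \<one>\<^bsub>k\<^esub>) \<otimes> mon a)"

section \<open>Hahn series\<close>

lemma (in abelian_monoid) finsum_swap: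
  assumes "finite A" "finite B" "\<And>a b. a \<in> A \<Longrightarrow> b \<in> B \<Longrightarrow> f a b \<in> carrier G"
  shows "(\<Oplus>a\<in>A. \<Oplus>b\<in>B. f a b) = (\<Oplus>b\<in>B. \<Oplus>a\<in>A. f a b)"
  using assms(1,3)
proof (induction A)
  case empty
  then show ?case by (simp add: finsum_zero)
next
  case (insert a A)
  have "(\<Oplus>b\<in>B. \<Oplus>a\<in>insert a A. f a b) = (\<Oplus>b\<in>B. f a b \<oplus> (\<Oplus>a\<in>A. f a b))"
    by (rule finsum_cong') (use insert in \<open>auto intro!: finsum_closed\<close>)
  also have "\<dots> = (\<Oplus>b\<in>B. f a b) \<oplus> (\<Oplus>b\<in>B. \<Oplus>a\<in>A. f a b)"
    by (rule finsum_addf) (use insert in \<open>auto intro!: finsum_closed\<close>)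
  also have "\<dots> = (\<Oplus>a\<in>insert a A. \<Oplus>b\<in>B. f a b)"
    using insert by (subst finsum_insert) (auto intro!: finsum_closed)
  finally show ?case by simp
qed

text \<open>With \<open>e = 1 - x\<close>, the inverse of \<open>x\<close> is the fixed point of \<open>u \<mapsto> 1 + e u\<close>; this replaces the
  geometric series.\<close>

lemma (in spherically_complete) inverse_near_one:
  assumes x: "x \<in> carrier R" and near: "gt (\<one> \<ominus> x) 0"
  shows "\<exists>y\<in>carrier R. x \<otimes> y = \<one>"
proof -
  define e where "e = \<one> \<ominus> x"
  have e: "e \<in> carrier R" "gt e 0" using x near unfolding e_def by auto
  obtain z where z: "z \<in> carrier R" "\<one> \<oplus> e \<otimes> z = z"
  proof (rule contraction_fixed_point[of \<one> 0 "\<lambda>u. \<one> \<oplus> e \<otimes> u"])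
    fix u assume u: "u \<in> carrier R" "ge (u \<ominus> \<one>) 0"
    have "ge ((u \<ominus> \<one>) \<oplus> \<one>) 0" using u by (intro ge_add) (auto simp: ge_def)
    moreover have "(u \<ominus> \<one>) \<oplus> \<one> = u" using u(1) one_closed by algebra
    ultimately have "ge (e \<otimes> u) (0 + 0)" using e u by (intro ge_mult) (auto intro: gt_imp_ge)
    moreover have "\<one> \<oplus> e \<otimes> u \<ominus> \<one> = e \<otimes> u" using u(1) e(1) one_closed by algebra
    ultimately show "\<one> \<oplus> e \<otimes> u \<in> carrier R \<and> ge (\<one> \<oplus> e \<otimes> u \<ominus> \<one>) 0" using e u by simp
  next
    fix u v assume uv: "u \<in> carrier R" "v \<in> carrier R" "u \<noteq> v"
    have "gt (e \<otimes> (u \<ominus> v)) (0 + ord (u \<ominus> v))"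
      using uv e by (intro gt_mult) (auto simp: ge_def)
    moreover have "\<one> \<oplus> e \<otimes> u \<ominus> (\<one> \<oplus> e \<otimes> v) = e \<otimes> (u \<ominus> v)" using uv(1,2) e(1) one_closed by algebra
    ultimately show "gt (\<one> \<oplus> e \<otimes> u \<ominus> (\<one> \<oplus> e \<otimes> v)) (ord (u \<ominus> v))" by simp
  qed auto
  have "x \<otimes> z = z \<ominus> e \<otimes> z" unfolding e_def using x z(1) by algebra
  also have "\<dots> = (\<one> \<oplus> e \<otimes> z) \<ominus> e \<otimes> z" using z(2) by simp
  also have "\<dots> = \<one>" using z(1) e(1) one_closed by algebra
  finally show ?thesis using z(1) by blast
qed

text \<open>The exponents are embedded into an arbitrary type \<open>'e\<close>, so that the field has elements of type
  \<open>'e \<Rightarrow> 'k\<close>; outside of the range of the embedding all series are \<open>0\<close>.\<close>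

locale hahn_series = field k for k :: "('k, 'm) ring_scheme" (structure) +
  fixes emb :: "'g::linordered_ab_group_add \<Rightarrow> 'e"
  assumes inj_emb: "inj emb"
begin

definition mk :: "('g \<Rightarrow> 'k) \<Rightarrow> 'e \<Rightarrow> 'k" where
  "mk f = (\<lambda>e. if e \<in> range emb then f (the_inv emb e) else \<zero>)"

definition supp :: "('e \<Rightarrow> 'k) \<Rightarrow> 'g set" where
  "supp F = {a. F (emb a) \<noteq> \<zero>}"

definition conv :: "('e \<Rightarrow> 'k) \<Rightarrow> ('e \<Rightarrow> 'k) \<Rightarrow> 'g \<Rightarrow> 'k" where
  "conv F G c = (\<Oplus>a\<in>{a \<in> supp F. c - a \<in> supp G}. F (emb a) \<otimes> G (emb (c - a)))"

definition mterm :: "'k \<Rightarrow> 'g \<Rightarrow> 'e \<Rightarrow> 'k" where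
  "mterm c a = mk (\<lambda>b. if b = a then c else \<zero>)"

definition hs :: "('e \<Rightarrow> 'k) ring" where
  "hs = \<lparr>carrier = {F. (\<forall>e. F e \<in> carrier k) \<and> (\<forall>e. e \<notin> range emb \<longrightarrow> F e = \<zero>) \<and>
           well_ordered_set (supp F)},
         monoid.mult = (\<lambda>F G. mk (conv F G)), one = mterm \<one> 0, ring.zero = (\<lambda>e. \<zero>), add = (\<lambda>F G e. F e \<oplus> G e)\<rparr>"

abbreviation "H \<equiv> carrier hs"

lemma mk_emb [simp]: "mk f (emb a) = f a"
  unfolding mk_def using the_inv_f_f[OF inj_emb] by simp

lemma H_coeff: "F \<in> H \<Longrightarrow> F e \<in> carrier k"
  and H_wo: "F \<in> H \<Longrightarrow> well_ordered_set (supp F)"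
  by (auto simp: hs_def)

lemma H_eqI: "\<lbrakk>F \<in> H; G \<in> H; \<And>a. F (emb a) = G (emb a)\<rbrakk> \<Longrightarrow> F = G"
proof (rule ext)
  fix e assume "F \<in> H" "G \<in> H" and eq: "\<And>a. F (emb a) = G (emb a)"
  show "F e = G e"
  proof (cases "e \<in> range emb")
    case True
    then show ?thesis using eq by blast
  next
    case False
    then have "F e = \<zero>" "G e = \<zero>" using \<open>F \<in> H\<close> \<open>G \<in> H\<close> by (simp_all add: hs_def)
    then show ?thesis by simp
  qed
qed

lemma mk_in_H: "\<lbrakk>\<And>a. f a \<in> carrier k; well_ordered_set {a. f a \<noteq> \<zero>}\<rbrakk> \<Longrightarrow> mk f \<in> H"
proof -
  assume f: "\<And>a. f a \<in> carrier k" and wo: "well_ordered_set {a. f a \<noteq> \<zero>}"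
  have "mk f e \<in> carrier k" for e unfolding mk_def using f by simp
  moreover have "mk f e = \<zero>" if "e \<notin> range emb" for e unfolding mk_def using that by simp
  moreover have "supp (mk f) = {a. f a \<noteq> \<zero>}" unfolding supp_def by simp
  ultimately show ?thesis using wo unfolding hs_def by simp
qed

lemma mterm_emb [simp]: "mterm c a (emb b) = (if b = a then c else \<zero>)"
  unfolding mterm_def by simp

lemma mterm_in_H [simp]: "c \<in> carrier k \<Longrightarrow> mterm c a \<in> H"
  unfolding mterm_def by (rule mk_in_H) (auto intro!: well_ordered_set_finite rev_finite_subset[of "{a}"])

lemma finite_conv: "\<lbrakk>F \<in> H; G \<in> H\<rbrakk> \<Longrightarrow> finite {a \<in> supp F. c - a \<in> supp G}"
  by (intro finite_sum_representations H_wo)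

lemma conv_superset:
  assumes "F \<in> H" "G \<in> H" "finite A" "{a \<in> supp F. c - a \<in> supp G} \<subseteq> A"
  shows "conv F G c = (\<Oplus>a\<in>A. F (emb a) \<otimes> G (emb (c - a)))"
  unfolding conv_def
proof (rule add.finprod_mono_neutral_cong_left[OF assms(3,4)])
  note [simp] = H_coeff[OF assms(1)] H_coeff[OF assms(2)]
  fix a assume "a \<in> A - {a \<in> supp F. c - a \<in> supp G}"
  then have "F (emb a) = \<zero> \<or> G (emb (c - a)) = \<zero>" by (auto simp: supp_def)
  then show "F (emb a) \<otimes> G (emb (c - a)) = \<zero>" by auto
qed (auto simp: H_coeff[OF assms(1)] H_coeff[OF assms(2)])


lemma conv_superset':
  assumes "F \<in> H" "G \<in> H" "finite B" "\<And>a. a \<in> supp F \<Longrightarrow> c - a \<in> supp G \<Longrightarrow> c - a \<in> B"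
  shows "conv F G c = (\<Oplus>b\<in>B. F (emb (c - b)) \<otimes> G (emb b))"
proof -
  note [simp] = H_coeff[OF assms(1)] H_coeff[OF assms(2)]
  have "{a \<in> supp F. c - a \<in> supp G} \<subseteq> (\<lambda>b. c - b) ` B"
  proof
    fix a assume "a \<in> {a \<in> supp F. c - a \<in> supp G}"
    then have "c - a \<in> B" using assms(4) by auto
    moreover have "a = c - (c - a)" by simp
    ultimately show "a \<in> (\<lambda>b. c - b) ` B" by blast
  qed
  then have "conv F G c = (\<Oplus>a\<in>(\<lambda>b. c - b) ` B. F (emb a) \<otimes> G (emb (c - a)))"
    using assms by (intro conv_superset) auto
  also have "\<dots> = (\<Oplus>b\<in>B. F (emb (c - b)) \<otimes> G (emb (c - (c - b))))"
    by (rule add.finprod_reindex) (use assms in \<open>auto intro!: inj_onI\<close>)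
  finally show ?thesis by simp
qed

lemma conv_closed [simp]: "\<lbrakk>F \<in> H; G \<in> H\<rbrakk> \<Longrightarrow> conv F G c \<in> carrier k"
  unfolding conv_def by (intro finsum_closed) (auto simp: H_coeff[of F] H_coeff[of G])

lemma conv_nonzero: 
  assumes "F \<in> H" "G \<in> H" "conv F G c \<noteq> \<zero>"
  shows "\<exists>a\<in>supp F. c - a \<in> supp G"
proof (rule ccontr)
  assume "\<not> ?thesis"
  then have "{a \<in> supp F. c - a \<in> supp G} = {}" by auto
  then show False using assms(3) unfolding conv_def by (metis finsum_empty)
qed

lemma mult_in_H [simp]: assumes "F \<in> H" "G \<in> H" shows "mk (conv F G) \<in> H"
proof (rule mk_in_H)
  show "well_ordered_set {a. conv F G a \<noteq> \<zero>}"
  proof (rule well_ordered_set_subset[OF well_ordered_set_plus[OF H_wo[OF assms(1)] H_wo[OF assms(2)]]])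
    show "{a. conv F G a \<noteq> \<zero>} \<subseteq> {a + b |a b. a \<in> supp F \<and> b \<in> supp G}"
    proof
      fix c assume "c \<in> {a. conv F G a \<noteq> \<zero>}"
      then obtain a where "a \<in> supp F" "c - a \<in> supp G" using conv_nonzero[OF assms] by auto
      moreover have "c = a + (c - a)" by simp
      ultimately show "c \<in> {a + b |a b. a \<in> supp F \<and> b \<in> supp G}" by blast
    qed
  qed
qed (use assms in simp)

lemma supp_mult: "\<lbrakk>F \<in> H; G \<in> H; a \<in> supp (mk (conv F G))\<rbrakk> \<Longrightarrow> \<exists>b\<in>supp F. a - b \<in> supp G"
  using conv_nonzero by (simp add: supp_def)

lemma conv_commute: assumes "F \<in> H" "G \<in> H" shows "conv F G = conv G F"
proof
  note [simp] = H_coeff[OF assms(1)] H_coeff[OF assms(2)]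
  fix c
  let ?B = "{b \<in> supp G. c - b \<in> supp F}"
  have "conv F G c = (\<Oplus>b\<in>?B. F (emb (c - b)) \<otimes> G (emb b))"
    using assms finite_conv[of G F c] by (intro conv_superset') auto
  also have "\<dots> = (\<Oplus>b\<in>?B. G (emb b) \<otimes> F (emb (c - b)))"
    by (rule finsum_cong') (use assms m_comm in auto)
  finally show "conv F G c = conv G F c" unfolding conv_def .
qed

text \<open>Both sides are rectangular double sums over the finite sets \<open>U\<close> of all exponents in \<open>F\<close> and
  \<open>W\<close> of all exponents in \<open>K\<close> that occur in some representation of \<open>c\<close> as a sum of three exponents.\<close>

lemma conv_assoc:
  assumes F: "F \<in> H" and G: "G \<in> H" and K: "K \<in> H"
  shows "conv (mk (conv F G)) K c = conv F (mk (conv G K)) c"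
proof -
  note [simp] = H_coeff[OF F] H_coeff[OF G] H_coeff[OF K]
  define U where "U = {a \<in> supp F. c - a \<in> {a + b |a b. a \<in> supp G \<and> b \<in> supp K}}"
  define W where "W = {d \<in> supp K. c - d \<in> {a + b |a b. a \<in> supp F \<and> b \<in> supp G}}"
  have fin: "finite U" "finite W" unfolding U_def W_def
    by (intro finite_sum_representations well_ordered_set_plus H_wo F G K)+
  have split: "\<exists>a b. c = a + b \<and> P a \<and> Q b" if "P d" "Q (c - d)" for P Q and c d :: 'g
    using that by (metis add_diff_cancel_left' add_diff_eq)
  have "conv (mk (conv F G)) K c = (\<Oplus>d\<in>W. mk (conv F G) (emb (c - d)) \<otimes> K (emb d))"
  proof (rule conv_superset')
    fix a assume a: "a \<in> supp (mk (conv F G))" "c - a \<in> supp K"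
    then obtain b where "b \<in> supp F" "a - b \<in> supp G" using supp_mult[OF F G] by blast
    then have "a \<in> {a + b |a b. a \<in> supp F \<and> b \<in> supp G}"
      using split[of "\<lambda>x. x \<in> supp F" b "\<lambda>x. x \<in> supp G" a] by simp
    then show "c - a \<in> W" using a unfolding W_def by simp
  qed (use F G K fin in auto)
  also have "\<dots> = (\<Oplus>d\<in>W. \<Oplus>a\<in>U. F (emb a) \<otimes> G (emb (c - d - a)) \<otimes> K (emb d))"
  proof (rule finsum_cong')
    fix d assume d: "d \<in> W"
    have "conv F G (c - d) = (\<Oplus>a\<in>U. F (emb a) \<otimes> G (emb (c - d - a)))"
    proof (rule conv_superset[OF F G fin(1)], rule subsetI)
      fix a assume a: "a \<in> {a \<in> supp F. c - d - a \<in> supp G}"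
      have "c - a = (c - d - a) + d" by (simp add: algebra_simps)
      then show "a \<in> U" using a d unfolding U_def W_def by blast
    qed
    then show "mk (conv F G) (emb (c - d)) \<otimes> K (emb d) =
        (\<Oplus>a\<in>U. F (emb a) \<otimes> G (emb (c - d - a)) \<otimes> K (emb d))"
      using F G K fin by (simp add: finsum_ldistr)
  qed (use F G K fin in \<open>auto intro!: finsum_closed\<close>)
  also have "\<dots> = (\<Oplus>a\<in>U. \<Oplus>d\<in>W. F (emb a) \<otimes> G (emb (c - d - a)) \<otimes> K (emb d))"
    by (rule finsum_swap) (use F G K fin in auto)
  also have "\<dots> = (\<Oplus>a\<in>U. F (emb a) \<otimes> mk (conv G K) (emb (c - a)))"
  proof (rule finsum_cong')
    fix a assume a: "a \<in> U"
    have "conv G K (c - a) = (\<Oplus>d\<in>W. G (emb (c - a - d)) \<otimes> K (emb d))"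
    proof (rule conv_superset'[OF G K fin(2)])
      fix b assume b: "b \<in> supp G" "c - a - b \<in> supp K"
      have "c - (c - a - b) = a + b" by (simp add: algebra_simps)
      then show "c - a - b \<in> W" using a b unfolding U_def W_def by blast
    qed
    then have "F (emb a) \<otimes> mk (conv G K) (emb (c - a)) =
        (\<Oplus>d\<in>W. F (emb a) \<otimes> (G (emb (c - a - d)) \<otimes> K (emb d)))"
      using F G K fin by (simp add: finsum_rdistr)
    moreover have comm: "c - a - d = c - d - a" for d by (simp add: algebra_simps)
    have "(\<Oplus>d\<in>W. F (emb a) \<otimes> (G (emb (c - a - d)) \<otimes> K (emb d))) =
        (\<Oplus>d\<in>W. F (emb a) \<otimes> G (emb (c - d - a)) \<otimes> K (emb d))"
      by (rule finsum_cong') (auto simp: m_assoc comm)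
    ultimately show "(\<Oplus>d\<in>W. F (emb a) \<otimes> G (emb (c - d - a)) \<otimes> K (emb d)) =
        F (emb a) \<otimes> mk (conv G K) (emb (c - a))" by simp
  qed (use F G K fin in \<open>auto intro!: finsum_closed\<close>)
  also have "\<dots> = conv F (mk (conv G K)) c"
  proof (rule conv_superset[symmetric])
    show "{a \<in> supp F. c - a \<in> supp (mk (conv G K))} \<subseteq> U"
    proof
      fix a assume a: "a \<in> {a \<in> supp F. c - a \<in> supp (mk (conv G K))}"
      then obtain b where "b \<in> supp G" "c - a - b \<in> supp K" using supp_mult[OF G K] by blast
      then show "a \<in> U" using a split[of "\<lambda>x. x \<in> supp G" b "\<lambda>x. x \<in> supp K" "c - a"]
        unfolding U_def by blast
    qed
  qed (use F G K fin in auto)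
  finally show ?thesis .
qed

lemma add_in_H [simp]: assumes "F \<in> H" "G \<in> H" shows "(\<lambda>e. F e \<oplus> G e) \<in> H"
proof -
  have "supp (\<lambda>e. F e \<oplus> G e) \<subseteq> supp F \<union> supp G" unfolding supp_def by auto
  then have "well_ordered_set (supp (\<lambda>e. F e \<oplus> G e))"
    using well_ordered_set_Un H_wo assms well_ordered_set_subset by metis
  moreover have "F e \<oplus> G e \<in> carrier k" for e using assms by (intro a_closed H_coeff)
  moreover have "F e \<oplus> G e = \<zero>" if "e \<notin> range emb" for e
    using assms that unfolding hs_def by simp
  ultimately show ?thesis unfolding hs_def by simp
qed

lemma uminus_in_H: assumes "F \<in> H" shows "(\<lambda>e. \<ominus> F e) \<in> H"
proof -
  have "supp (\<lambda>e. \<ominus> F e) \<subseteq> supp F" unfolding supp_def by auto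
  then have "well_ordered_set (supp (\<lambda>e. \<ominus> F e))"
    using H_wo assms well_ordered_set_subset by metis
  moreover have "\<ominus> F e \<in> carrier k" for e using assms by (intro a_inv_closed H_coeff)
  moreover have "\<ominus> F e = \<zero>" if "e \<notin> range emb" for e
    using assms that unfolding hs_def by simp
  ultimately show ?thesis unfolding hs_def by simp
qed

lemma conv_add:
  assumes F: "F \<in> H" and G: "G \<in> H" and K: "K \<in> H"
  shows "conv (\<lambda>e. F e \<oplus> G e) K c = conv F K c \<oplus> conv G K c"
proof -
  note [simp] = H_coeff[OF F] H_coeff[OF G] H_coeff[OF K]
  have FG: "(\<lambda>e. F e \<oplus> G e) \<in> H" using F G by simp
  let ?A = "{a \<in> supp F. c - a \<in> supp K} \<union> {a \<in> supp G. c - a \<in> supp K}"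
  have A: "finite ?A" using finite_conv F G K by simp
  have "conv (\<lambda>e. F e \<oplus> G e) K c = (\<Oplus>a\<in>?A. (F (emb a) \<oplus> G (emb a)) \<otimes> K (emb (c - a)))"
    by (rule conv_superset[OF FG K A]) (use F G K in \<open>auto simp: supp_def\<close>)
  also have "\<dots> = (\<Oplus>a\<in>?A. F (emb a) \<otimes> K (emb (c - a)) \<oplus> G (emb a) \<otimes> K (emb (c - a)))"
    by (rule finsum_cong') (use F G K in \<open>auto simp: l_distr\<close>)
  also have "\<dots> = (\<Oplus>a\<in>?A. F (emb a) \<otimes> K (emb (c - a))) \<oplus> (\<Oplus>a\<in>?A. G (emb a) \<otimes> K (emb (c - a)))"
    by (rule finsum_addf) (use F G K in auto)
  also have "(\<Oplus>a\<in>?A. F (emb a) \<otimes> K (emb (c - a))) = conv F K c"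
    by (rule conv_superset[OF F K A, symmetric]) auto
  also have "(\<Oplus>a\<in>?A. G (emb a) \<otimes> K (emb (c - a))) = conv G K c"
    by (rule conv_superset[OF G K A, symmetric]) auto
  finally show ?thesis .
qed


lemma hs_simps: "x \<otimes>\<^bsub>hs\<^esub> y = mk (conv x y)" "x \<oplus>\<^bsub>hs\<^esub> y = (\<lambda>e. x e \<oplus> y e)"
    "\<zero>\<^bsub>hs\<^esub> = (\<lambda>e. \<zero>)" "\<one>\<^bsub>hs\<^esub> = mterm \<one> 0"
  by (simp_all add: hs_def)

lemma zero_in_H: "(\<lambda>e. \<zero>) \<in> H"
  unfolding hs_def by (simp add: supp_def well_ordered_set_def)

lemma conv_mterm:
  assumes F: "F \<in> H" and d: "d \<in> carrier k"
  shows "conv (mterm d b) F c = d \<otimes> F (emb (c - b))"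
proof -
  have "conv (mterm d b) F c = (\<Oplus>a\<in>{b}. mterm d b (emb a) \<otimes> F (emb (c - a)))"
    by (rule conv_superset[OF _ F]) (use d in \<open>auto simp: supp_def split: if_splits\<close>)
  also have "\<dots> = d \<otimes> F (emb (c - b))" using d H_coeff[OF F] by simp
  finally show ?thesis .
qed

lemma hs_cring: "cring hs"
proof (rule cringI)
  show "abelian_group hs"
  proof (rule abelian_groupI, unfold hs_simps)
    fix x y assume xy: "x \<in> H" "y \<in> H"
    note [simp] = H_coeff[OF xy(1)] H_coeff[OF xy(2)]
    show "(\<lambda>e. x e \<oplus> y e) \<in> H" using xy by simp
    show "(\<lambda>e. x e \<oplus> y e) = (\<lambda>e. y e \<oplus> x e)" by (simp add: a_comm)
    show "(\<lambda>e. \<zero> \<oplus> x e) = x" by simp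
    show "\<exists>y\<in>H. (\<lambda>e. y e \<oplus> x e) = (\<lambda>e. \<zero>)"
      by (rule bexI[OF _ uminus_in_H[OF xy(1)]]) (simp add: l_neg)
    fix z assume z: "z \<in> H"
    show "(\<lambda>e. (x e \<oplus> y e) \<oplus> z e) = (\<lambda>e. x e \<oplus> (y e \<oplus> z e))"
      by (simp add: a_assoc H_coeff[OF z])
  qed (rule zero_in_H)
  show "comm_monoid hs"
  proof (rule comm_monoidI, unfold hs_simps)
    fix x y assume xy: "x \<in> H" "y \<in> H"
    show "mk (conv x y) \<in> H" using xy by simp
    show "mk (conv x y) = mk (conv y x)" using conv_commute[OF xy] by simp
    show "mk (conv (mterm \<one> 0) x) = x"
      by (rule H_eqI) (use xy H_coeff[OF xy(1)] in \<open>simp_all add: conv_mterm\<close>)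
    fix z assume z: "z \<in> H"
    show "mk (conv (mk (conv x y)) z) = mk (conv x (mk (conv y z)))"
      by (rule H_eqI) (use xy z in \<open>simp_all add: conv_assoc\<close>)
  qed (rule mterm_in_H[OF one_closed])
next
  fix x y z assume xyz: "x \<in> H" "y \<in> H" "z \<in> H"
  show "(x \<oplus>\<^bsub>hs\<^esub> y) \<otimes>\<^bsub>hs\<^esub> z = x \<otimes>\<^bsub>hs\<^esub> z \<oplus>\<^bsub>hs\<^esub> y \<otimes>\<^bsub>hs\<^esub> z"
    unfolding hs_simps by (rule H_eqI) (use xyz in \<open>simp_all add: conv_add\<close>)
qed

definition lead :: "('e \<Rightarrow> 'k) \<Rightarrow> 'g" where
  "lead F = (SOME a. F (emb a) \<noteq> \<zero> \<and> (\<forall>b<a. F (emb b) = \<zero>))"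

lemma lead_eqI:
  assumes "F (emb a) \<noteq> \<zero>" "\<And>b. b < a \<Longrightarrow> F (emb b) = \<zero>"
  shows "lead F = a"
  unfolding lead_def by (rule some_equality) (use assms in \<open>auto dest: linorder_neqE\<close>)

lemma lead:
  assumes "F \<in> H" "F \<noteq> (\<lambda>e. \<zero>)"
  shows "F (emb (lead F)) \<noteq> \<zero>" and "b < lead F \<Longrightarrow> F (emb b) = \<zero>"
proof -
  have "supp F \<noteq> {}"
  proof
    assume "supp F = {}"
    then have "F = (\<lambda>e. \<zero>)" by (intro H_eqI assms zero_in_H) (auto simp: supp_def)
    then show False using assms(2) by simp
  qed
  then obtain m where m: "m \<in> supp F" "\<forall>s\<in>supp F. m \<le> s"
    using well_ordered_setD[OF H_wo[OF assms(1)] subset_refl] by blast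
  have "F (emb m) \<noteq> \<zero>" using m(1) by (simp add: supp_def)
  moreover have below: "F (emb b) = \<zero>" if "b < m" for b
  proof (rule ccontr)
    assume "F (emb b) \<noteq> \<zero>"
    then have "m \<le> b" using m(2) by (simp add: supp_def)
    then show False using that by simp
  qed
  ultimately have "lead F = m" by (rule lead_eqI)
  then show "F (emb (lead F)) \<noteq> \<zero>" and "b < lead F \<Longrightarrow> F (emb b) = \<zero>"
    using \<open>F (emb m) \<noteq> \<zero>\<close> below by simp_all
qed

lemma lead_ge:
  assumes "F \<in> H" "F \<noteq> (\<lambda>e. \<zero>)" "\<And>b. b < a \<Longrightarrow> F (emb b) = \<zero>"
  shows "a \<le> lead F"
  using lead(1)[OF assms(1,2)] assms(3) by (meson not_le)

text \<open>The least exponents of two factors give the only representation of their sum.\<close>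

lemma lead_mult:
  assumes F: "F \<in> H" "F \<noteq> (\<lambda>e. \<zero>)" and G: "G \<in> H" "G \<noteq> (\<lambda>e. \<zero>)"
  shows "conv F G (lead F + lead G) \<noteq> \<zero>" and "b < lead F + lead G \<Longrightarrow> conv F G b = \<zero>"
proof -
  have geF: "lead F \<le> a" if "a \<in> supp F" for a
    using that lead(2)[OF F, of a] unfolding supp_def by (meson mem_Collect_eq not_le)
  have geG: "lead G \<le> a" if "a \<in> supp G" for a
    using that lead(2)[OF G, of a] unfolding supp_def by (meson mem_Collect_eq not_le)
  note ge = geF geG
  let ?c = "lead F + lead G"
  have "{a \<in> supp F. ?c - a \<in> supp G} \<subseteq> {lead F}"
  proof
    fix a assume "a \<in> {a \<in> supp F. ?c - a \<in> supp G}"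
    then have "lead F \<le> a" "lead G \<le> ?c - a" using ge by auto
    then have "a = lead F" by (simp add: le_diff_eq add.commute[of _ a])
    then show "a \<in> {lead F}" by simp
  qed
  then have "conv F G ?c = (\<Oplus>a\<in>{lead F}. F (emb a) \<otimes> G (emb (?c - a)))"
    by (intro conv_superset F G) auto
  also have "\<dots> = F (emb (lead F)) \<otimes> G (emb (lead G))"
    using H_coeff[OF F(1)] H_coeff[OF G(1)] by simp
  finally show "conv F G ?c \<noteq> \<zero>"
    using lead(1)[OF F] lead(1)[OF G] H_coeff[OF F(1)] H_coeff[OF G(1)] integral_iff by simp
  show "conv F G b = \<zero>" if "b < ?c"
  proof (rule ccontr)
    assume "conv F G b \<noteq> \<zero>"
    then obtain a where a: "a \<in> supp F" "b - a \<in> supp G" using conv_nonzero[OF F(1) G(1)] by auto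
    then have "lead F + lead G \<le> a + (b - a)" using ge by (intro add_mono) auto
    then show False using that by simp
  qed
qed

sublocale hs: cring hs
  by (rule hs_cring)

lemma hs_uminus: "F \<in> H \<Longrightarrow> \<ominus>\<^bsub>hs\<^esub> F = (\<lambda>e. \<ominus> F e)"
  by (rule hs.minus_equality) (auto simp: hs_simps l_neg H_coeff uminus_in_H)

lemma hs_minus: "F \<in> H \<Longrightarrow> G \<in> H \<Longrightarrow> F \<ominus>\<^bsub>hs\<^esub> G = (\<lambda>e. F e \<ominus> G e)"
  by (simp add: a_minus_def hs_uminus hs_simps)

sublocale hs: ord_ring hs lead
proof
  fix x y assume xy: "x \<in> H" "y \<in> H" "x \<noteq> \<zero>\<^bsub>hs\<^esub>" "y \<noteq> \<zero>\<^bsub>hs\<^esub>"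
  then have nz: "x \<noteq> (\<lambda>e. \<zero>)" "y \<noteq> (\<lambda>e. \<zero>)" by (simp_all add: hs_simps)
  note m = lead_mult[OF xy(1) nz(1) xy(2) nz(2)]
  have "mk (conv x y) \<noteq> (\<lambda>e. \<zero>)" using m(1) mk_emb by metis
  moreover have "lead (mk (conv x y)) = lead x + lead y"
    by (rule lead_eqI) (use m in simp_all)
  ultimately show "x \<otimes>\<^bsub>hs\<^esub> y \<noteq> \<zero>\<^bsub>hs\<^esub> \<and> lead (x \<otimes>\<^bsub>hs\<^esub> y) = lead x + lead y"
    unfolding hs_simps by simp
  assume "x \<oplus>\<^bsub>hs\<^esub> y \<noteq> \<zero>\<^bsub>hs\<^esub>"
  then show "min (lead x) (lead y) \<le> lead (x \<oplus>\<^bsub>hs\<^esub> y)"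
    unfolding hs_simps
    by (intro lead_ge) (use xy lead(2)[OF xy(1) nz(1)] lead(2)[OF xy(2) nz(2)] in auto)
next
  have "mterm \<one> 0 (emb 0) \<noteq> \<zero>" by simp
  then show "\<one>\<^bsub>hs\<^esub> \<noteq> \<zero>\<^bsub>hs\<^esub>" unfolding hs_simps by metis
qed

lemma ge_iff: "F \<in> H \<Longrightarrow> hs.ge F a \<longleftrightarrow> (\<forall>b<a. F (emb b) = \<zero>)"
  unfolding hs.ge_def hs_simps using lead(2)[of F] lead_ge[of F a] by fastforce


lemma gt_iff: "F \<in> H \<Longrightarrow> hs.gt F a \<longleftrightarrow> (\<forall>b\<le>a. F (emb b) = \<zero>)"
proof
  assume F: "F \<in> H" and z: "\<forall>b\<le>a. F (emb b) = \<zero>"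
  show "hs.gt F a"
  proof (cases "F = (\<lambda>e. \<zero>)")
    case False
    then have "a < lead F" using lead(1)[OF F False] z by (meson not_le)
    then show ?thesis unfolding hs.gt_def by simp
  qed (simp add: hs.gt_def hs_simps)
next
  assume F: "F \<in> H" and gt: "hs.gt F a"
  show "\<forall>b\<le>a. F (emb b) = \<zero>"
  proof (cases "F = (\<lambda>e. \<zero>)")
    case False
    then have "a < lead F" using gt unfolding hs.gt_def hs_simps by simp
    then show ?thesis using lead(2)[OF F False] by (meson le_less_trans)
  qed simp
qed

sublocale hs: spherically_complete hs lead
proof
  fix P :: "(('e \<Rightarrow> 'k) \<times> 'g) set"
  assume P: "P \<subseteq> H \<times> UNIV"
    and nested: "\<And>x a y b. (x, a) \<in> P \<Longrightarrow> (y, b) \<in> P \<Longrightarrow> hs.ge (x \<ominus>\<^bsub>hs\<^esub> y) (min a b)"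
  have PH: "x \<in> H" if "(x, a) \<in> P" for x a using P that by auto
  have agree: "x (emb c) = y (emb c)" if "(x, a) \<in> P" "(y, b) \<in> P" "c < a" "c < b" for x a y b c
  proof -
    have xy: "x \<in> H" "y \<in> H" using that PH by auto
    then have "(x \<ominus>\<^bsub>hs\<^esub> y) (emb c) = \<zero>"
      using nested[OF that(1,2)] that(3,4) ge_iff[of "x \<ominus>\<^bsub>hs\<^esub> y"] by auto
    then have "x (emb c) \<ominus> y (emb c) = \<zero>" using hs_minus[OF xy] by simp
    then show ?thesis using r_right_minus_eq H_coeff[OF xy(1)] H_coeff[OF xy(2)] by blast
  qed
  define pick where "pick c = (SOME p. p \<in> P \<and> c < snd p)" for c
  define z where "z = mk (\<lambda>c. if \<exists>p\<in>P. c < snd p then fst (pick c) (emb c) else \<zero>)"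
  have pick: "pick c \<in> P \<and> c < snd (pick c)" if "\<exists>p\<in>P. c < snd p" for c
    unfolding pick_def by (rule someI_ex) (use that in blast)
  have z: "z (emb c) = x (emb c)" if "(x, a) \<in> P" "c < a" for x a c
  proof -
    have ex: "\<exists>p\<in>P. c < snd p" using that by force
    then have "z (emb c) = fst (pick c) (emb c)" unfolding z_def by simp
    also have "\<dots> = x (emb c)"
      by (rule agree[of _ "snd (pick c)" _ a]) (use pick[OF ex] that in auto)
    finally show ?thesis .
  qed
  have "z \<in> H" unfolding z_def
  proof (rule mk_in_H)
    fix c
    show "(if \<exists>p\<in>P. c < snd p then fst (pick c) (emb c) else \<zero>) \<in> carrier k"
      using pick[of c] PH[of "fst (pick c)" "snd (pick c)"] H_coeff by auto
  next
    have "well_ordered_set (supp z)"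
    proof (rule well_ordered_set_initial)
      fix c assume c: "c \<in> supp z"
      then have ex: "\<exists>p\<in>P. c < snd p" unfolding supp_def z_def by (auto split: if_splits)
      obtain x a where xa: "(x, a) \<in> P" "c < a" using ex by force
      have "{b \<in> supp z. b \<le> c} \<subseteq> supp x"
        using z[OF xa(1)] xa(2) unfolding supp_def by (auto dest: le_less_trans)
      then show "well_ordered_set {b \<in> supp z. b \<le> c}"
        using well_ordered_set_subset H_wo[OF PH[OF xa(1)]] by blast
    qed
    then show "well_ordered_set {c. (if \<exists>p\<in>P. c < snd p then fst (pick c) (emb c) else \<zero>) \<noteq> \<zero>}"
      unfolding supp_def z_def mk_emb .
  qed
  moreover have "hs.ge (z \<ominus>\<^bsub>hs\<^esub> x) a" if "(x, a) \<in> P" for x a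
  proof -
    have "x \<in> H" using PH that .
    have "(z \<ominus>\<^bsub>hs\<^esub> x) (emb b) = \<zero>" if "b < a" for b
      using z[OF \<open>(x, a) \<in> P\<close> that] H_coeff[OF \<open>x \<in> H\<close>]
      by (simp add: hs_minus[OF \<open>z \<in> H\<close> \<open>x \<in> H\<close>] a_minus_def[of k] r_neg)
    then show ?thesis using ge_iff[OF hs.minus_closed[OF \<open>z \<in> H\<close> \<open>x \<in> H\<close>]] by blast
  qed
  ultimately show "\<exists>z\<in>H. \<forall>(x, a)\<in>P. hs.ge (z \<ominus>\<^bsub>hs\<^esub> x) a" by auto
qed

text \<open>After multiplication by a suitable monomial, a series is of the form \<open>1 - e\<close> with \<open>e\<close> of positive
  value.\<close>

lemma hs_field: "field hs"
proof (rule hs.cring_fieldI2)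
  show "\<zero>\<^bsub>hs\<^esub> \<noteq> \<one>\<^bsub>hs\<^esub>" using hs.one_neq_zero by simp
  fix x assume x: "x \<in> H" "x \<noteq> \<zero>\<^bsub>hs\<^esub>"
  note lx = lead[OF x(1) x(2)[unfolded hs_simps]]
  let ?c = "x (emb (lead x))"
  have c: "inv ?c \<in> carrier k" "inv ?c \<otimes> ?c = \<one>"
    using lx(1) H_coeff[OF x(1)] field_Units by auto
  let ?m = "mterm (inv ?c) (- lead x)"
  have m: "?m \<in> H" using c by simp
  have mx: "(?m \<otimes>\<^bsub>hs\<^esub> x) (emb b) = inv ?c \<otimes> x (emb (b + lead x))" for b
    unfolding hs_simps using conv_mterm[OF x(1) c(1)] by simp
  have "hs.gt (\<one>\<^bsub>hs\<^esub> \<ominus>\<^bsub>hs\<^esub> ?m \<otimes>\<^bsub>hs\<^esub> x) 0"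
  proof (subst gt_iff)
    show "\<forall>b\<le>0. (\<one>\<^bsub>hs\<^esub> \<ominus>\<^bsub>hs\<^esub> ?m \<otimes>\<^bsub>hs\<^esub> x) (emb b) = \<zero>"
    proof (intro allI impI)
      fix b :: 'g assume b: "b \<le> 0"
      have "(\<one>\<^bsub>hs\<^esub> \<ominus>\<^bsub>hs\<^esub> ?m \<otimes>\<^bsub>hs\<^esub> x) (emb b) = (if b = 0 then \<one> else \<zero>) \<ominus> inv ?c \<otimes> x (emb (b + lead x))"
        using m x(1) by (simp add: hs_minus mx hs_simps(4))
      also have "\<dots> = \<zero>"
      proof (cases "b = 0")
        case True
        then show ?thesis using c by (simp add: a_minus_def r_neg)
      next
        case False
        then have "b + lead x < lead x" using b by simp
        then show ?thesis using lx(2) False c by (simp add: a_minus_def)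
      qed
      finally show "(\<one>\<^bsub>hs\<^esub> \<ominus>\<^bsub>hs\<^esub> ?m \<otimes>\<^bsub>hs\<^esub> x) (emb b) = \<zero>" .
    qed
  qed (use m x in simp)
  then obtain y where y: "y \<in> H" "?m \<otimes>\<^bsub>hs\<^esub> x \<otimes>\<^bsub>hs\<^esub> y = \<one>\<^bsub>hs\<^esub>"
    using hs.inverse_near_one[of "?m \<otimes>\<^bsub>hs\<^esub> x"] m x(1) by auto
  then have "x \<otimes>\<^bsub>hs\<^esub> (?m \<otimes>\<^bsub>hs\<^esub> y) = \<one>\<^bsub>hs\<^esub>" using m x(1) hs.m_assoc hs.m_comm by simp
  then show "\<exists>y\<in>H. x \<otimes>\<^bsub>hs\<^esub> y = \<one>\<^bsub>hs\<^esub>" using m y(1) by blast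
qed

lemma mterm_mult: "\<lbrakk>c \<in> carrier k; d \<in> carrier k\<rbrakk>
    \<Longrightarrow> mterm c a \<otimes>\<^bsub>hs\<^esub> mterm d b = mterm (c \<otimes> d) (a + b)"
  unfolding hs_simps by (rule H_eqI) (auto simp: conv_mterm algebra_simps)

lemma lead_mterm: "c \<noteq> \<zero> \<Longrightarrow> lead (mterm c a) = a"
  by (rule lead_eqI) auto

lemma mterm_eq_zero: "mterm c a = \<zero>\<^bsub>hs\<^esub> \<longleftrightarrow> c = \<zero>"
proof
  assume "mterm c a = \<zero>\<^bsub>hs\<^esub>"
  then have "mterm c a (emb a) = \<zero>" unfolding hs_simps by simp
  then show "c = \<zero>" by simp
next
  assume "c = \<zero>"
  then show "mterm c a = \<zero>\<^bsub>hs\<^esub>" unfolding hs_simps by (intro H_eqI zero_in_H) auto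
qed

text \<open>Multiplying the coefficient of each monomial by an additive function of its exponent
  is a derivation.\<close>

definition euler :: "('g \<Rightarrow> int) \<Rightarrow> ('e \<Rightarrow> 'k) \<Rightarrow> 'e \<Rightarrow> 'k" where
  "euler \<chi> F = mk (\<lambda>a. [\<chi> a] \<cdot> F (emb a))"

lemma euler_in_H: assumes "F \<in> H" shows "euler \<chi> F \<in> H"
  unfolding euler_def
proof (rule mk_in_H)
  have "{a. [\<chi> a] \<cdot> F (emb a) \<noteq> \<zero>} \<subseteq> supp F" unfolding supp_def by auto
  then show "well_ordered_set {a. [\<chi> a] \<cdot> F (emb a) \<noteq> \<zero>}"
    using H_wo[OF assms] well_ordered_set_subset by blast
qed (use H_coeff[OF assms] in simp)

lemma euler_derivation:
  assumes \<chi>: "\<And>a b. \<chi> (a + b) = \<chi> a + \<chi> b"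
  shows "hs.derivation (euler \<chi>)"
  unfolding hs.derivation_def
proof (intro conjI ballI)
  fix F G assume F: "F \<in> H" and G: "G \<in> H"
  note [simp] = H_coeff[OF F] H_coeff[OF G]
  show "euler \<chi> (F \<oplus>\<^bsub>hs\<^esub> G) = euler \<chi> F \<oplus>\<^bsub>hs\<^esub> euler \<chi> G"
    
  proof (rule H_eqI)
    fix a
    show "euler \<chi> (F \<oplus>\<^bsub>hs\<^esub> G) (emb a) = (euler \<chi> F \<oplus>\<^bsub>hs\<^esub> euler \<chi> G) (emb a)"
      by (simp add: hs_simps euler_def add.int_pow_distrib)
  qed (use F G euler_in_H in simp_all)
  show "euler \<chi> (F \<otimes>\<^bsub>hs\<^esub> G) = euler \<chi> F \<otimes>\<^bsub>hs\<^esub> G \<oplus>\<^bsub>hs\<^esub> F \<otimes>\<^bsub>hs\<^esub> euler \<chi> G"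
  proof (rule H_eqI)
    fix c
    let ?A = "{a \<in> supp F. c - a \<in> supp G}"
    have fin: "finite ?A" using finite_conv[OF F G] .
    have "conv (euler \<chi> F) G c = (\<Oplus>a\<in>?A. euler \<chi> F (emb a) \<otimes> G (emb (c - a)))"
      by (rule conv_superset[OF euler_in_H[OF F] G fin]) (auto simp: supp_def euler_def)
    moreover have "conv F (euler \<chi> G) c = (\<Oplus>a\<in>?A. F (emb a) \<otimes> euler \<chi> G (emb (c - a)))"
      by (rule conv_superset[OF F euler_in_H[OF G] fin]) (auto simp: supp_def euler_def)
    ultimately have "conv (euler \<chi> F) G c \<oplus> conv F (euler \<chi> G) c =
        (\<Oplus>a\<in>?A. euler \<chi> F (emb a) \<otimes> G (emb (c - a)) \<oplus> F (emb a) \<otimes> euler \<chi> G (emb (c - a)))"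
      using finsum_addf[of "\<lambda>a. euler \<chi> F (emb a) \<otimes> G (emb (c - a))" ?A
          "\<lambda>a. F (emb a) \<otimes> euler \<chi> G (emb (c - a))"] by (simp add: euler_def)
    also have "\<dots> = (\<Oplus>a\<in>?A. [\<chi> c] \<cdot> (F (emb a) \<otimes> G (emb (c - a))))"
    proof (rule finsum_cong')
      fix a
      have "\<chi> c = \<chi> a + \<chi> (c - a)" using \<chi>[of a "c - a"] by simp
      then show "euler \<chi> F (emb a) \<otimes> G (emb (c - a)) \<oplus> F (emb a) \<otimes> euler \<chi> G (emb (c - a)) =
          [\<chi> c] \<cdot> (F (emb a) \<otimes> G (emb (c - a)))"
        by (simp add: euler_def add_pow_ldistr_int add_pow_rdistr_int add.int_pow_mult)
    qed auto
    also have "\<dots> = [\<chi> c] \<cdot> conv F G c"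
      unfolding conv_def using fin
    proof induction
      case empty
      then show ?case by simp
    next
      case (insert a A)
      then show ?case by (simp add: add.int_pow_distrib)
    qed
    finally show "euler \<chi> (F \<otimes>\<^bsub>hs\<^esub> G) (emb c) =
        (euler \<chi> F \<otimes>\<^bsub>hs\<^esub> G \<oplus>\<^bsub>hs\<^esub> F \<otimes>\<^bsub>hs\<^esub> euler \<chi> G) (emb c)"
      unfolding hs_simps by (simp add: euler_def)
  qed (use F G in \<open>simp_all add: euler_in_H\<close>)
qed (use euler_in_H in auto)

lemma hs_monomial_field:
  assumes "\<And>n::nat. n > 0 \<Longrightarrow> [n] \<cdot> \<one> \<noteq> \<zero>"
  shows "monomial_field hs lead k (\<lambda>c. mterm c 0) (mterm \<one>)"
proof -
  interpret hs: field hs by (rule hs_field)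
  show ?thesis
  proof
    show "(\<lambda>c. mterm c 0) \<in> ring_hom k hs"
    proof (rule ring_hom_memI)
      fix c d assume cd: "c \<in> carrier k" "d \<in> carrier k"
      show "mterm (c \<oplus> d) 0 = mterm c 0 \<oplus>\<^bsub>hs\<^esub> mterm d 0"
        unfolding hs_simps by (rule H_eqI) (use cd in auto)
    qed (auto simp: mterm_mult hs_simps(4))
    fix x assume x: "x \<in> H" "hs.ge x 0"
    show "\<exists>c\<in>carrier k. hs.gt (x \<ominus>\<^bsub>hs\<^esub> mterm c 0) 0"
    proof (rule bexI[of _ "x (emb 0)"])
      have "(x \<ominus>\<^bsub>hs\<^esub> mterm (x (emb 0)) 0) (emb b) = \<zero>" if "b \<le> 0" for b
        using x that ge_iff[of x 0] H_coeff[OF x(1)]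
        by (auto simp: hs_minus a_minus_def[of k] r_neg order_less_le)
      then show "hs.gt (x \<ominus>\<^bsub>hs\<^esub> mterm (x (emb 0)) 0) 0"
        using x H_coeff[OF x(1)] by (subst gt_iff) auto
    qed (use H_coeff[OF x(1)] in auto)
  next
    fix \<chi> :: "'g \<Rightarrow> int" assume \<chi>: "\<And>a b. \<chi> (a + b) = \<chi> a + \<chi> b"
    have "\<chi> 0 = 0" using \<chi>[of 0 0] by simp
    then have "euler \<chi> (mterm c 0) = \<zero>\<^bsub>hs\<^esub>" if "c \<in> carrier k" for c
      unfolding hs_simps using that by (intro H_eqI euler_in_H zero_in_H) (auto simp: euler_def add_pow_int_ge)
    moreover have "euler \<chi> (mterm \<one> a) = mterm ([\<chi> a] \<cdot> \<one>) 0 \<otimes>\<^bsub>hs\<^esub> mterm \<one> a" for a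
      by (subst mterm_mult, simp, simp, rule H_eqI, rule euler_in_H) (auto simp: euler_def)
    ultimately show "\<exists>\<theta>. hs.derivation \<theta> \<and> (\<forall>c\<in>carrier k. \<theta> (mterm c 0) = \<zero>\<^bsub>hs\<^esub>) \<and>
        (\<forall>a. \<theta> (mterm \<one> a) = mterm ([\<chi> a] \<cdot> \<one>) 0 \<otimes>\<^bsub>hs\<^esub> mterm \<one> a)"
      using euler_derivation[OF \<chi>] by blast
  qed (auto simp: lead_mterm mterm_eq_zero mterm_mult assms)
qed

end

section \<open>Values of polynomials\<close>

context cring
begin

lemma poly_value_0: "c 0 \<in> carrier R \<Longrightarrow> poly_value R 0 c x = c 0"
  unfolding poly_value_def by simp

lemma poly_value_Suc:
  assumes "\<And>i. i \<le> Suc n \<Longrightarrow> c i \<in> carrier R" "x \<in> carrier R"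
  shows "poly_value R (Suc n) c x = c (Suc n) \<otimes> x [^] Suc n \<oplus> poly_value R n c x"
  unfolding poly_value_def atLeast0_atMost_Suc using assms by (subst finsum_insert) auto

lemma poly_deriv_value_0: "poly_deriv_value R 0 c x = \<zero>"
  unfolding poly_deriv_value_def by simp

lemma poly_deriv_value_Suc:
  assumes "\<And>i. i \<le> Suc n \<Longrightarrow> c i \<in> carrier R" "x \<in> carrier R"
  shows "poly_deriv_value R (Suc n) c x = [Suc n] \<cdot> (c (Suc n) \<otimes> x [^] n) \<oplus> poly_deriv_value R n c x"
proof -
  have "{1..Suc n} = insert (Suc n) {1..n}" by auto
  then show ?thesis unfolding poly_deriv_value_def using assms by (simp only:) (subst finsum_insert, auto)
qed

lemma poly_value_closed [simp]:
  "\<lbrakk>\<And>i. i \<le> n \<Longrightarrow> c i \<in> carrier R; x \<in> carrier R\<rbrakk> \<Longrightarrow> poly_value R n c x \<in> carrier R"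
  unfolding poly_value_def by (intro finsum_closed) auto

lemma poly_deriv_value_closed [simp]:
  "\<lbrakk>\<And>i. i \<le> n \<Longrightarrow> c i \<in> carrier R; x \<in> carrier R\<rbrakk> \<Longrightarrow> poly_deriv_value R n c x \<in> carrier R"
  unfolding poly_deriv_value_def by (intro finsum_closed) auto

lemma poly_value_cong:
  assumes "\<And>i. i \<le> n \<Longrightarrow> c i = d i" "\<And>i. i \<le> n \<Longrightarrow> d i \<in> carrier R" "x \<in> carrier R"
  shows "poly_value R n c x = poly_value R n d x"
  unfolding poly_value_def by (rule finsum_cong') (use assms in auto)

lemma poly_deriv_value_shift:
  assumes "\<And>i. i \<le> Suc n \<Longrightarrow> c i \<in> carrier R" "x \<in> carrier R"
  shows "poly_deriv_value R (Suc n) c x = poly_value R n (\<lambda>i. [Suc i] \<cdot> c (Suc i)) x"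
  using assms(1)
proof (induction n)
  case 0
  then show ?case using assms(2) poly_deriv_value_Suc[of 0 c x]
    by (simp add: poly_deriv_value_0 poly_value_0)
next
  case (Suc n)
  have "poly_deriv_value R (Suc (Suc n)) c x =
      [Suc (Suc n)] \<cdot> (c (Suc (Suc n)) \<otimes> x [^] Suc n) \<oplus> poly_deriv_value R (Suc n) c x"
    by (rule poly_deriv_value_Suc) (use Suc assms in auto)
  also have "\<dots> = ([Suc (Suc n)] \<cdot> c (Suc (Suc n))) \<otimes> x [^] Suc n \<oplus>
      poly_value R n (\<lambda>i. [Suc i] \<cdot> c (Suc i)) x"
    using Suc assms(2) by (simp only: add_pow_ldistr nat_pow_closed le_refl)
  also have "\<dots> = poly_value R (Suc n) (\<lambda>i. [Suc i] \<cdot> c (Suc i)) x"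
    using poly_value_Suc[of n "\<lambda>i. [Suc i] \<cdot> c (Suc i)" x] Suc.prems assms(2) by simp
  finally show ?case .
qed

lemma eval_eq_poly_value:
  assumes "set p \<subseteq> carrier R" "p \<noteq> []" "x \<in> carrier R"
  shows "eval p x = poly_value R (length p - 1) (\<lambda>i. rev p ! i) x"
  using assms(1,2)
proof (induction p)
  case (Cons a p)
  show ?case
  proof (cases "p = []")
    case True
    then show ?thesis using Cons assms by (simp add: poly_value_0)
  next
    case False
    then obtain n where n: "length p = Suc n" by (cases p) auto
    have in_p: "rev p ! i \<in> carrier R" if "i < length p" for i
      using that Cons.prems nth_mem[of i "rev p"] by auto
    have nth: "rev (a # p) ! i = (if i < length p then rev p ! i else a)" if "i \<le> length p" for i
      using that by (simp add: nth_append)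
    have "poly_value R (length (a # p) - 1) (\<lambda>i. rev (a # p) ! i) x =
        rev (a # p) ! Suc n \<otimes> x [^] Suc n \<oplus> poly_value R n (\<lambda>i. rev (a # p) ! i) x"
    proof -
      have "poly_value R (Suc n) (\<lambda>i. rev (a # p) ! i) x =
          rev (a # p) ! Suc n \<otimes> x [^] Suc n \<oplus> poly_value R n (\<lambda>i. rev (a # p) ! i) x"
        by (rule poly_value_Suc) (use Cons.prems in_p nth n assms in \<open>auto simp del: rev.simps\<close>)
      then show ?thesis using n by simp
    qed
    also have "poly_value R n (\<lambda>i. rev (a # p) ! i) x = poly_value R n (\<lambda>i. rev p ! i) x"
      by (rule poly_value_cong) (use nth n in_p assms in \<open>auto simp del: rev.simps\<close>)
    also have "\<dots> = eval p x" using Cons False n by simp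
    finally show ?thesis using nth[of "Suc n"] n by simp
  qed
qed simp

end

text \<open>Coefficient functions are closer to Hensel's Lemma and to derivatives than lists of
  coefficients.\<close>

definition (in ring) root_over :: "'a set \<Rightarrow> 'a \<Rightarrow> bool" where
  "root_over K x \<longleftrightarrow> (\<exists>n c. (\<forall>i\<le>n. c i \<in> K) \<and> c n \<noteq> \<zero> \<and> poly_value R n c x = \<zero>)"

lemma (in field) algebraic_iff_root:
  assumes K: "subfield K R" and x: "x \<in> carrier R"
  shows "algebraic K x \<longleftrightarrow> root_over K x"
proof
  assume "algebraic K x"
  then obtain p where p: "p \<in> carrier (K[X])" "p \<noteq> []" "eval p x = \<zero>"
    using algebraicE[OF subfieldE(1)[OF K] x] unfolding over_def by blast
  have set: "set p \<subseteq> K" and lead: "hd p \<noteq> \<zero>" using p unfolding univ_poly_def polynomial_def by auto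
  have K': "K \<subseteq> carrier R" using subfieldE(3)[OF K] .
  have nth: "rev p ! i \<in> K" if "i \<le> length p - 1" for i
  proof -
    have "i < length (rev p)" using that p(2) by (cases p) auto
    then show ?thesis using nth_mem[of i "rev p"] set by auto
  qed
  have "rev p ! (length p - 1) \<noteq> \<zero>" using lead p(2) by (cases p) (auto simp: nth_append)
  moreover have "poly_value R (length p - 1) (\<lambda>i. rev p ! i) x = \<zero>"
    using eval_eq_poly_value[of p x] set K' p x by auto
  ultimately show "root_over K x" unfolding root_over_def using nth by blast
next
  assume "root_over K x"
  then obtain n c where c: "\<And>i. i \<le> n \<Longrightarrow> c i \<in> K" "c n \<noteq> \<zero>" "poly_value R n c x = \<zero>"
    unfolding root_over_def by blast
  have K': "K \<subseteq> carrier R" using subfieldE(3)[OF K] .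
  let ?p = "map c (rev [0..<Suc n])"
  have set: "set ?p \<subseteq> K" using c(1) by auto
  have "polynomial K ?p" unfolding polynomial_def using set c(2) by (auto simp: hd_map)
  then have "?p \<in> carrier (K[X])" unfolding univ_poly_def by simp
  moreover have "eval ?p x = poly_value R (length ?p - 1) (\<lambda>i. rev ?p ! i) x"
    by (rule eval_eq_poly_value) (use set K' x in auto)
  moreover have "poly_value R (length ?p - 1) (\<lambda>i. rev ?p ! i) x = poly_value R n c x"
  proof -
    have "rev ?p = map c [0..<Suc n]" by (simp add: rev_map)
    then have "rev ?p ! i = c i" if "i \<le> n" for i using that by (simp del: upt_Suc)
    moreover have "length ?p - 1 = n" by simp
    ultimately show ?thesis by (simp only:) (rule poly_value_cong, use c(1) K' x in auto)
  qed
  ultimately show "algebraic K x" using algebraicI[of ?p K x] c(3) unfolding over_def by simp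
qed

text \<open>The coefficients of an algebraic relation generate a finite extension, to which the element adds
  another finite extension.\<close>

lemma (in field) algebraic_trans:
  assumes K: "subfield K R" and x: "x \<in> carrier R"
    and alg: "algebraic {y \<in> carrier R. algebraic K y} x"
  shows "algebraic K x"
proof -
  let ?A = "{y \<in> carrier R. algebraic K y}"
  have A: "subfield ?A R" using subfield_of_algebraics[OF K] unfolding over_def .
  obtain p where p: "p \<in> carrier (?A[X])" "p \<noteq> []" "eval p x = \<zero>"
    using algebraicE[OF subfieldE(1)[OF A] x] alg unfolding over_def by blast
  have set: "set p \<subseteq> ?A" using p unfolding univ_poly_def polynomial_def by auto
  let ?E = "finite_extension K p"
  have pc: "set p \<subseteq> carrier R" and pa: "\<And>y. y \<in> set p \<Longrightarrow> (algebraic over K) y"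
    using set unfolding over_def by auto
  have E: "subfield ?E R" using finite_extension_is_subfield[OF K pc pa] by blast
  have fdE: "finite_dimension K ?E" using finite_extension_finite_dimension(1)[OF K pc pa] by blast
  have "set p \<subseteq> ?E" using finite_extension_mem[OF subfieldE(1)[OF K] pc] by auto
  then have "p \<in> carrier (?E[X])" using p unfolding univ_poly_def polynomial_def by auto
  then have "(algebraic over ?E) x" using algebraicI[of p ?E x] p by blast
  then have fdx: "finite_dimension ?E (simple_extension ?E x)"
    using finite_dimension_simple_extension[OF E x] by blast
  have sr: "subring (simple_extension ?E x) R"
    using simple_extension_is_subring[OF subfieldE(1)[OF E] x] .
  have "finite_dimension K (simple_extension ?E x)"
    using telescopic_base_dim(1)[OF K E fdE fdx] .
  then show ?thesis
    using finite_dimension_imp_algebraic[OF K sr _ simple_extension_mem[OF subfieldE(1)[OF E] x]]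
    unfolding over_def by blast
qed

section \<open>Sums with coefficients in prescribed subgroups\<close>

text \<open>This covers both the ring of Laurent polynomials, where all coefficients lie in \<open>k\<close>, and the
  additive complements, where the field of coefficients depends on the term.\<close>

inductive_set (in ring) span_of :: "'i set \<Rightarrow> ('i \<Rightarrow> 'a set) \<Rightarrow> ('i \<Rightarrow> 'a) \<Rightarrow> 'a set"
  for I C u where
    zero: "\<zero> \<in> span_of I C u"
  | step: "\<lbrakk>i \<in> I; c \<in> C i; z \<in> span_of I C u\<rbrakk> \<Longrightarrow> c \<otimes> u i \<oplus> z \<in> span_of I C u"

locale graded_span = cring R for R (structure) +
  fixes I :: "'i set" and C u
  assumes coeff_subgroup: "i \<in> I \<Longrightarrow> additive_subgroup (C i) R"
    and unit_closed: "i \<in> I \<Longrightarrow> u i \<in> carrier R"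
begin

abbreviation "S \<equiv> span_of I C u"

lemma coeff_closed: "i \<in> I \<Longrightarrow> c \<in> C i \<Longrightarrow> c \<in> carrier R"
  using additive_subgroup.a_Hcarr[OF coeff_subgroup] by blast

lemma span_closed: "z \<in> S \<Longrightarrow> z \<in> carrier R"
  by (induction rule: span_of.induct) (auto simp: coeff_closed unit_closed)

lemma span_add: "y \<in> S \<Longrightarrow> z \<in> S \<Longrightarrow> y \<oplus> z \<in> S"
proof (induction rule: span_of.induct)
  case zero
  then show ?case using span_closed by simp
next
  case (step i c y)
  then have "c \<otimes> u i \<oplus> y \<oplus> z = c \<otimes> u i \<oplus> (y \<oplus> z)"
    using span_closed coeff_closed unit_closed by (intro a_assoc) auto
  then show ?case using step span_of.step by metis
qed

lemma span_term: "i \<in> I \<Longrightarrow> c \<in> C i \<Longrightarrow> c \<otimes> u i \<in> S"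
  using span_of.step[OF _ _ span_of.zero, of i I c C u] coeff_closed unit_closed by simp

lemma span_minus: "z \<in> S \<Longrightarrow> \<ominus> z \<in> S"
proof (induction rule: span_of.induct)
  case zero
  then show ?case using span_of.zero by simp
next
  case (step i c z)
  have cl: "c \<in> carrier R" "u i \<in> carrier R" "z \<in> carrier R"
    using step coeff_closed unit_closed span_closed by auto
  then have "\<ominus> (c \<otimes> u i \<oplus> z) = (\<ominus> c) \<otimes> u i \<oplus> \<ominus> z" by algebra
  moreover have "\<ominus> c \<in> C i"
    using additive_subgroup.a_inv_closed[OF coeff_subgroup] step by blast
  ultimately show ?case using step span_of.step by metis
qed

lemma span_additive_subgroup: "additive_subgroup S R"
proof (rule additive_subgroupI, rule add.subgroupI)
  show "S \<noteq> {}" using span_of.zero by auto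
qed (use span_closed span_add span_minus in auto)

lemma span_mult:
  assumes "\<And>i j c d. \<lbrakk>i \<in> I; j \<in> I; c \<in> C i; d \<in> C j\<rbrakk> \<Longrightarrow> (c \<otimes> u i) \<otimes> (d \<otimes> u j) \<in> S"
    and "y \<in> S" "z \<in> S"
  shows "y \<otimes> z \<in> S"
proof -
  have 1: "(c \<otimes> u i) \<otimes> z \<in> S" if "i \<in> I" "c \<in> C i" for c i
    using assms(3)
  proof (induction rule: span_of.induct)
    case zero
    then show ?case using that coeff_closed unit_closed span_of.zero by simp
  next
    case (step j d z)
    then have "(c \<otimes> u i) \<otimes> (d \<otimes> u j \<oplus> z) = (c \<otimes> u i) \<otimes> (d \<otimes> u j) \<oplus> (c \<otimes> u i) \<otimes> z"
      using that coeff_closed unit_closed span_closed by (intro r_distr) auto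
    then show ?case using span_add assms(1) step that by metis
  qed
  show ?thesis using assms(2)
  proof (induction rule: span_of.induct)
    case zero
    then show ?case using assms(3) span_closed span_of.zero by simp
  next
    case (step i c y)
    then have "(c \<otimes> u i \<oplus> y) \<otimes> z = (c \<otimes> u i) \<otimes> z \<oplus> y \<otimes> z"
      using assms(3) coeff_closed unit_closed span_closed by (intro l_distr) auto
    then show ?case using span_add 1 step by metis
  qed
qed

text \<open>Collecting the terms with equal index is possible because the coefficients for an index form a
  group.\<close>

lemma span_representation:
  assumes "z \<in> S"
  shows "\<exists>P c. finite P \<and> P \<subseteq> I \<and> (\<forall>i\<in>P. c i \<in> C i \<and> c i \<noteq> \<zero>) \<and> z = (\<Oplus>i\<in>P. c i \<otimes> u i)"
  using assms
proof (induction rule: span_of.induct)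
  case zero
  show ?case by (rule exI[of _ "{}"]) simp
next
  case (step j d z)
  then obtain P c where P: "finite P" "P \<subseteq> I" "\<And>i. i \<in> P \<Longrightarrow> c i \<in> C i \<and> c i \<noteq> \<zero>"
    and z: "z = (\<Oplus>i\<in>P. c i \<otimes> u i)" by blast
  have cl: "c i \<in> carrier R" "u i \<in> carrier R" if "i \<in> P" for i
    using P that coeff_closed unit_closed by blast+
  have j: "d \<in> carrier R" "u j \<in> carrier R" using step coeff_closed unit_closed by auto
  let ?c = "\<lambda>e. c(j := e)" and ?Q = "P - {j}"
  have Q: "(\<Oplus>i\<in>?Q. ?c e i \<otimes> u i) = (\<Oplus>i\<in>?Q. c i \<otimes> u i)" for e
    by (rule finsum_cong') (use cl in auto)
  have new: ?case if e: "e \<in> C j" "d \<otimes> u j \<oplus> z = e \<otimes> u j \<oplus> (\<Oplus>i\<in>?Q. c i \<otimes> u i)" for e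
  proof (cases "e = \<zero>")
    case True
    have "(\<Oplus>i\<in>?Q. c i \<otimes> u i) \<in> carrier R" using cl by (intro finsum_closed) auto
    then have "d \<otimes> u j \<oplus> z = (\<Oplus>i\<in>?Q. c i \<otimes> u i)" using e True j by simp
    then show ?thesis using P by (intro exI[of _ ?Q] exI[of _ c]) auto
  next
    case False
    have ec: "e \<in> carrier R" using coeff_closed e step by blast
    have "(\<Oplus>i\<in>insert j ?Q. ?c e i \<otimes> u i) = e \<otimes> u j \<oplus> (\<Oplus>i\<in>?Q. ?c e i \<otimes> u i)"
      using P(1) cl ec j by (subst finsum_insert) auto
    then have "d \<otimes> u j \<oplus> z = (\<Oplus>i\<in>insert j ?Q. ?c e i \<otimes> u i)" using e(2) Q by simp
    then show ?thesis using P step False e(1)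
      by (intro exI[of _ "insert j ?Q"] exI[of _ "?c e"]) auto
  qed
  show ?case
  proof (cases "j \<in> P")
    case False
    then have "?Q = P" by auto
    then show ?thesis using new[of d] step z by simp
  next
    case True
    have "z = c j \<otimes> u j \<oplus> (\<Oplus>i\<in>?Q. c i \<otimes> u i)"
    proof -
      have "z = (\<Oplus>i\<in>insert j ?Q. c i \<otimes> u i)" using z True by (simp add: insert_absorb)
      then show ?thesis using P(1) cl True by (subst (asm) finsum_insert) auto
    qed
    moreover have "(\<Oplus>i\<in>?Q. c i \<otimes> u i) \<in> carrier R" using cl by (intro finsum_closed) auto
    ultimately have "d \<otimes> u j \<oplus> z = (d \<oplus> c j) \<otimes> u j \<oplus> (\<Oplus>i\<in>?Q. c i \<otimes> u i)"
      using j cl[OF True] by (simp add: l_distr a_assoc)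
    moreover have "d \<oplus> c j \<in> C j"
      using additive_subgroup.a_closed[OF coeff_subgroup] step P(3)[OF True] by blast
    ultimately show ?thesis using new by blast
  qed
qed

end

text \<open>If the terms of a sum have pairwise distinct values, no cancellation can occur between
  the terms of least value, so that the sum inherits its value from one of them.\<close>

lemma (in ord_ring) ord_add_distinct:
  assumes "x \<in> carrier R" "y \<in> carrier R" "x \<noteq> \<zero>" "y \<noteq> \<zero>" "ord x \<noteq> ord y"
  shows "x \<oplus> y \<noteq> \<zero> \<and> ord (x \<oplus> y) = min (ord x) (ord y)"
proof -
  have 1: "a \<oplus> b \<noteq> \<zero> \<and> ord (a \<oplus> b) = ord a"
    if ab: "a \<in> carrier R" "b \<in> carrier R" "a \<noteq> \<zero>" "b \<noteq> \<zero>" "ord a < ord b" for a b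
  proof -
    have nz: "a \<oplus> b \<noteq> \<zero>"
    proof
      assume "a \<oplus> b = \<zero>"
      then have "a = \<ominus> b" using ab minus_equality by metis
      then show False using ab by simp
    qed
    have "a = (a \<oplus> b) \<oplus> \<ominus> b" using ab(1,2) by algebra
    then have "min (ord (a \<oplus> b)) (ord b) \<le> ord a"
      using ord_add'[of "a \<oplus> b" "\<ominus> b"] ab nz by auto
    moreover have "min (ord a) (ord b) \<le> ord (a \<oplus> b)" using ord_add' ab nz by blast
    ultimately show ?thesis using ab(5) nz by (auto simp: min_def split: if_splits)
  qed
  show ?thesis
  proof (cases "ord x < ord y")
    case True
    then show ?thesis using 1[of x y] assms by simp
  next
    case False
    then show ?thesis using 1[of y x] assms by (simp add: a_comm)
  qed
qed

lemma (in ord_ring) ord_finsum_distinct: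
  assumes "finite P" "P \<noteq> {}" "\<And>i. i \<in> P \<Longrightarrow> f i \<in> carrier R - {\<zero>}" "inj_on (\<lambda>i. ord (f i)) P"
  shows "finsum R f P \<noteq> \<zero> \<and> (\<exists>i\<in>P. ord (finsum R f P) = ord (f i)) \<and>
    (\<forall>i\<in>P. ord (finsum R f P) \<le> ord (f i))"
  using assms
proof (induction P rule: finite_ne_induct)
  case (singleton i)
  then show ?case by simp
next
  case (insert i P)
  have "finsum R f P \<noteq> \<zero> \<and> (\<exists>i\<in>P. ord (finsum R f P) = ord (f i)) \<and>
      (\<forall>i\<in>P. ord (finsum R f P) \<le> ord (f i))"
    by (rule insert.IH) (use insert.prems in \<open>auto simp: inj_on_def\<close>)
  then obtain j where j: "finsum R f P \<noteq> \<zero>" "j \<in> P" "ord (finsum R f P) = ord (f j)"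
    and le: "\<forall>i\<in>P. ord (finsum R f P) \<le> ord (f i)" by (elim conjE bexE)
  have "ord (f i) \<noteq> ord (f j)" using insert.prems(2) insert.hyps j(2) by (auto simp: inj_on_def)
  moreover have "finsum R f P \<in> carrier R" using insert.prems by (intro finsum_closed) auto
  moreover have "finsum R f (insert i P) = f i \<oplus> finsum R f P"
    using insert by (intro finsum_insert) auto
  ultimately have "finsum R f (insert i P) \<noteq> \<zero> \<and>
      ord (finsum R f (insert i P)) = min (ord (f i)) (ord (finsum R f P))"
    using ord_add_distinct[of "f i" "finsum R f P"] j insert.prems by auto
  then show ?case using j le by (auto simp: min_def)
qed

section \<open>Fractions\<close>

text \<open>For a subring without \<open>1\<close>, an element \<open>x\<close> is the fraction \<open>x s / s\<close>.\<close>

lemma (in field) quot_field_subfield: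
  assumes S: "S \<subseteq> carrier R" "s \<in> S" "s \<noteq> \<zero>"
    and cl: "\<And>x y. x \<in> S \<Longrightarrow> y \<in> S \<Longrightarrow> x \<oplus> y \<in> S \<and> x \<otimes> y \<in> S" "\<And>x. x \<in> S \<Longrightarrow> \<ominus> x \<in> S"
  shows "subfield (quot_field R S) R" and "S \<subseteq> quot_field R S"
proof -
  have in_c: "x \<in> carrier R" if "x \<in> S" for x using S that by auto
  have inv: "inv b \<in> carrier R" "b \<otimes> inv b = \<one>" "inv b \<noteq> \<zero>" if "b \<in> S" "b \<noteq> \<zero>" for b
    using that in_c field_Units by (auto, metis Units_r_inv_ex Diff_iff Units_r_inv empty_iff field_Units insert_iff one_not_zero r_null)
  have invl: "inv b \<otimes> b = \<one>" if "b \<in> S" "b \<noteq> \<zero>" for b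
    using that in_c field_Units by auto
  show sub: "S \<subseteq> quot_field R S"
  proof
    fix x assume x: "x \<in> S"
    have "x = (x \<otimes> s) \<otimes> inv s" using x S(2) in_c inv[OF S(2,3)] by (simp add: m_assoc)
    then show "x \<in> quot_field R S" unfolding quot_field_def using cl(1)[OF x S(2)] S(2,3) by blast
  qed
  have frac: "\<exists>a\<in>S. \<exists>b\<in>S. b \<noteq> \<zero> \<and> x = a \<otimes> inv b" if "x \<in> quot_field R S" for x
    using that unfolding quot_field_def by blast
  have fracI: "x \<in> quot_field R S" if "a \<in> S" "b \<in> S" "b \<noteq> \<zero>" "x \<in> carrier R" "x \<otimes> b = a" for x a b
  proof -
    have "x = a \<otimes> inv b" using that inv[of b] in_c by (auto simp: m_assoc)
    then show ?thesis unfolding quot_field_def using that by blast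
  qed
  show "subfield (quot_field R S) R"
  proof (rule subfieldI'[OF subringI])
    show qc: "quot_field R S \<subseteq> carrier R"
      unfolding quot_field_def using in_c inv by auto
    show "\<one> \<in> quot_field R S" by (rule fracI[of s s]) (use S in_c in auto)
    fix x assume x: "x \<in> quot_field R S"
    then obtain a b where ab: "a \<in> S" "b \<in> S" "b \<noteq> \<zero>" "x = a \<otimes> inv b" using frac by blast
    note [simp] = in_c[OF ab(1)] in_c[OF ab(2)] inv(1)[OF ab(2,3)]
    have xb: "x \<in> carrier R" "x \<otimes> b = a" using ab inv[OF ab(2,3)] invl[OF ab(2,3)] by (auto simp: m_assoc)
    show "\<ominus> x \<in> quot_field R S"
      by (rule fracI[of "\<ominus> a" b]) (use ab xb cl(2) in \<open>auto simp: l_minus\<close>)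
    fix y assume y: "y \<in> quot_field R S"
    then obtain c d where cd: "c \<in> S" "d \<in> S" "d \<noteq> \<zero>" "y = c \<otimes> inv d" using frac by blast
    note [simp] = in_c[OF cd(1)] in_c[OF cd(2)] inv(1)[OF cd(2,3)]
    have yd: "y \<in> carrier R" "y \<otimes> d = c" using cd inv[OF cd(2,3)] invl[OF cd(2,3)] by (auto simp: m_assoc)
    have bd: "b \<otimes> d \<noteq> \<zero>" "b \<otimes> d \<in> S" using ab cd cl(1) integral_iff by auto
    have e1: "(x \<oplus> y) \<otimes> (b \<otimes> d) = (x \<otimes> b) \<otimes> d \<oplus> (y \<otimes> d) \<otimes> b"
      and e2: "(x \<otimes> y) \<otimes> (b \<otimes> d) = (x \<otimes> b) \<otimes> (y \<otimes> d)"
      using xb(1) yd(1) in_c[OF ab(2)] in_c[OF cd(2)] by algebra+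
    show "x \<otimes> y \<in> quot_field R S"
      by (rule fracI[OF _ bd(2,1), of "a \<otimes> c"]) (use ab cd cl(1) e2 xb yd in auto)
    show "x \<oplus> y \<in> quot_field R S"
      by (rule fracI[OF _ bd(2,1), of "a \<otimes> d \<oplus> c \<otimes> b"]) (use ab cd cl(1) e1 xb yd in auto)
  next
    fix x assume x: "x \<in> quot_field R S - {\<zero>}"
    then obtain a b where ab: "a \<in> S" "b \<in> S" "b \<noteq> \<zero>" "x = a \<otimes> inv b" using frac by blast
    note [simp] = in_c[OF ab(1)] in_c[OF ab(2)] inv(1)[OF ab(2,3)]
    have a: "a \<noteq> \<zero>" using x ab by auto
    have xb: "x \<in> carrier R" "x \<otimes> b = a" using ab inv[OF ab(2,3)] invl[OF ab(2,3)] by (auto simp: m_assoc)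
    have ix: "inv x \<in> carrier R" "inv x \<otimes> x = \<one>" using x xb(1) field_Units by auto
    have "(inv x \<otimes> x) \<otimes> b = inv x \<otimes> (x \<otimes> b)"
      by (rule m_assoc) (use xb ix in auto)
    then have "inv x \<otimes> a = b" using xb(2) ix by simp
    then show "inv x \<in> quot_field R S" by (intro fracI[of b a]) (use ab a ix in auto)
  qed
qed

lemma (in field) quot_field_incl:
  assumes "subfield K R" "S \<subseteq> K"
  shows "quot_field R S \<subseteq> K"
proof
  fix x assume "x \<in> quot_field R S"
  then obtain a b where ab: "a \<in> K" "b \<in> K" "b \<noteq> \<zero>" "x = a \<otimes> inv b"
    using assms(2) unfolding quot_field_def by blast
  then show "x \<in> K" using subfield_m_inv(1)[OF assms(1), of b] subringE(6)[OF subfieldE(1)[OF assms(1)]]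
    by auto
qed

section \<open>Coarsenings and Hensel's Lemma\<close>

text \<open>A subgroup \<open>D\<close> of the value group defines a coarser valuation, with valuation ring
  \<open>coarse_ring D\<close> and maximal ideal \<open>coarse_ideal D\<close>; the given valuation is the case \<open>D = {0}\<close>.\<close>

context ord_ring
begin

definition coarse_ring :: "'g set \<Rightarrow> 'a set" where
  "coarse_ring D = {x \<in> carrier R. x = \<zero> \<or> (\<exists>d\<in>D. d \<le> ord x)}"

definition coarse_ideal :: "'g set \<Rightarrow> 'a set" where
  "coarse_ideal D = {x \<in> carrier R. x = \<zero> \<or> (\<forall>d\<in>D. d < ord x)}"

end

locale coarsening = field R + ord_ring R ord
  for R :: "('a, 'r) ring_scheme" (structure) and ord :: "'a \<Rightarrow> 'g::linordered_ab_group_add" +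
  fixes D :: "'g set"
  assumes D_zero: "0 \<in> D" and D_diff: "\<lbrakk>a \<in> D; b \<in> D\<rbrakk> \<Longrightarrow> a - b \<in> D"
begin

abbreviation "\<O> \<equiv> coarse_ring D"
abbreviation "\<M> \<equiv> coarse_ideal D"

lemma D_uminus: "a \<in> D \<Longrightarrow> - a \<in> D" using D_diff[OF D_zero, of a] by simp
lemma D_plus: "a \<in> D \<Longrightarrow> b \<in> D \<Longrightarrow> a + b \<in> D" using D_diff[of a "- b"] D_uminus by simp

lemma O_closed: "x \<in> \<O> \<Longrightarrow> x \<in> carrier R" and M_closed: "x \<in> \<M> \<Longrightarrow> x \<in> carrier R"
  by (auto simp: coarse_ring_def coarse_ideal_def)

lemma M_imp_O: "x \<in> \<M> \<Longrightarrow> x \<in> \<O>"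
  using D_zero by (force simp: coarse_ring_def coarse_ideal_def)

lemma M_gt_zero: "x \<in> \<M> \<Longrightarrow> gt x 0"
  using D_zero by (auto simp: coarse_ideal_def gt_def)

lemma ge_imp_O: "x \<in> carrier R \<Longrightarrow> ge x 0 \<Longrightarrow> x \<in> \<O>"
  using D_zero by (auto simp: coarse_ring_def ge_def)

lemma zero_M: "\<zero> \<in> \<M>" by (simp add: coarse_ideal_def)
lemma zero_O: "\<zero> \<in> \<O>" by (simp add: coarse_ring_def)
lemma one_O: "\<one> \<in> \<O>" by (rule ge_imp_O) (auto simp: ge_def)
lemma one_not_M: "\<one> \<notin> \<M>" using M_gt_zero[of \<one>] one_neq_zero by (auto simp: gt_def)

lemma M_minus: "x \<in> \<M> \<Longrightarrow> \<ominus> x \<in> \<M>"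
  by (auto simp: coarse_ideal_def)

lemma O_add:
  assumes "x \<in> \<O>" "y \<in> \<O>" shows "x \<oplus> y \<in> \<O>"
proof (cases "x = \<zero> \<or> y = \<zero> \<or> x \<oplus> y = \<zero>")
  case True
  then show ?thesis using assms O_closed[OF assms(1)] O_closed[OF assms(2)] zero_O by auto
next
  case False
  then obtain a b where "a \<in> D" "a \<le> ord x" "b \<in> D" "b \<le> ord y"
    using assms by (auto simp: coarse_ring_def)
  then have d: "min a b \<in> D" "min a b \<le> min (ord x) (ord y)" by (auto simp: min_def)
  moreover have "min (ord x) (ord y) \<le> ord (x \<oplus> y)"
    using ord_add'[of x y] False O_closed[OF assms(1)] O_closed[OF assms(2)] by blast
  ultimately have "min a b \<le> ord (x \<oplus> y)" by (rule_tac order_trans)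
  then show ?thesis using d(1) O_closed[OF assms(1)] O_closed[OF assms(2)] by (auto simp: coarse_ring_def)
qed

lemma M_add:
  assumes "x \<in> \<M>" "y \<in> \<M>" shows "x \<oplus> y \<in> \<M>"
proof (cases "x = \<zero> \<or> y = \<zero> \<or> x \<oplus> y = \<zero>")
  case True
  then show ?thesis using assms M_closed[OF assms(1)] M_closed[OF assms(2)] zero_M by auto
next
  case False
  then have "min (ord x) (ord y) \<le> ord (x \<oplus> y)" using ord_add' M_closed[OF assms(1)] M_closed[OF assms(2)] by auto
  moreover have "d < min (ord x) (ord y)" if "d \<in> D" for d
    using that assms False by (auto simp: coarse_ideal_def)
  ultimately have "d < ord (x \<oplus> y)" if "d \<in> D" for d using that less_le_trans by blast
  then show ?thesis using M_closed[OF assms(1)] M_closed[OF assms(2)] by (auto simp: coarse_ideal_def)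
qed

lemma O_mult:
  assumes "x \<in> \<O>" "y \<in> \<O>" shows "x \<otimes> y \<in> \<O>"
proof (cases "x = \<zero> \<or> y = \<zero>")
  case True
  then show ?thesis using assms O_closed[OF assms(1)] O_closed[OF assms(2)] zero_O by auto
next
  case False
  then obtain a b where "a \<in> D" "a \<le> ord x" "b \<in> D" "b \<le> ord y"
    using assms by (auto simp: coarse_ring_def)
  then have "a + b \<in> D" "a + b \<le> ord x + ord y" using D_plus by (auto intro: add_mono)
  then show ?thesis using ord_mult[of x y] False O_closed[OF assms(1)] O_closed[OF assms(2)] by (auto simp: coarse_ring_def)
qed

lemma M_mult:
  assumes "x \<in> \<M>" "y \<in> \<O>" shows "x \<otimes> y \<in> \<M>"
proof (cases "x = \<zero> \<or> y = \<zero>")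
  case True
  then show ?thesis using M_closed[OF assms(1)] O_closed[OF assms(2)] zero_M by auto
next
  case False
  then obtain b where b: "b \<in> D" "b \<le> ord y" using assms by (auto simp: coarse_ring_def)
  have "d < ord x + ord y" if "d \<in> D" for d
  proof -
    have "d - b < ord x" using assms(1) False D_diff[OF that b(1)] by (auto simp: coarse_ideal_def)
    then have "d - b + b < ord x + ord y" using b(2) by (rule add_less_le_mono)
    then show ?thesis by simp
  qed
  then show ?thesis using ord_mult[of x y] False O_closed[OF assms(2)] M_closed[OF assms(1)] by (auto simp: coarse_ideal_def)
qed

lemma M_mult': "x \<in> \<O> \<Longrightarrow> y \<in> \<M> \<Longrightarrow> x \<otimes> y \<in> \<M>"
  using M_mult[of y x] O_closed M_closed m_comm by metis

lemma unit_inv: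
  assumes "x \<in> \<O>" "x \<notin> \<M>"
  shows "x \<noteq> \<zero>" "inv x \<in> \<O>" "inv x \<notin> \<M>" "x \<otimes> inv x = \<one>"
proof -
  show nz: "x \<noteq> \<zero>" using assms zero_M by auto
  have x: "x \<in> carrier R" using O_closed[OF assms(1)] .
  then have i: "inv x \<in> carrier R" "x \<otimes> inv x = \<one>" using nz field_Units by auto
  then show "x \<otimes> inv x = \<one>" by simp
  have inz: "inv x \<noteq> \<zero>" using i x one_neq_zero by auto
  have "ord x + ord (inv x) = 0" using ord_mult[of x "inv x"] i x nz inz by simp
  then have o: "ord (inv x) = - ord x" by (simp add: eq_neg_iff_add_eq_0 add.commute)
  obtain d where d: "d \<in> D" "ord x \<le> d" using assms by (auto simp: coarse_ring_def coarse_ideal_def not_less)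
  then have "- d \<in> D" "- d \<le> ord (inv x)" using D_uminus o by auto
  then show "inv x \<in> \<O>" using i by (auto simp: coarse_ring_def)
  show "inv x \<notin> \<M>"
  proof
    assume "inv x \<in> \<M>"
    then have "inv x \<otimes> x \<in> \<M>" using M_mult assms by blast
    then show False using i x one_not_M by (simp add: m_comm)
  qed
qed

lemma not_M_mult: "\<lbrakk>x \<in> \<O>; x \<notin> \<M>; y \<in> \<O>; y \<notin> \<M>\<rbrakk> \<Longrightarrow> x \<otimes> y \<notin> \<M>"
proof
  assume a: "x \<in> \<O>" "x \<notin> \<M>" "y \<in> \<O>" "y \<notin> \<M>" "x \<otimes> y \<in> \<M>"
  then have "inv x \<otimes> (x \<otimes> y) \<in> \<M>" using M_mult' unit_inv by blast
  moreover have "inv x \<otimes> (x \<otimes> y) = (x \<otimes> inv x) \<otimes> y"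
    using O_closed[OF a(1)] O_closed[OF a(3)] O_closed[OF unit_inv(2)[OF a(1,2)]] by algebra
  ultimately show False using a unit_inv(4)[OF a(1,2)] O_closed by simp
qed

lemma O_pow: "x \<in> \<O> \<Longrightarrow> x [^] (n::nat) \<in> \<O>"
  by (induction n) (auto simp: one_O O_mult)

lemma O_nat: "x \<in> \<O> \<Longrightarrow> [(n::nat)] \<cdot> x \<in> \<O>"
  by (induction n) (auto simp: zero_O O_add)

lemma O_poly_deriv_value: "\<lbrakk>\<And>i. i \<le> n \<Longrightarrow> c i \<in> \<O>; x \<in> \<O>\<rbrakk> \<Longrightarrow> poly_deriv_value R n c x \<in> \<O>"
  by (induction n) (auto simp: poly_deriv_value_0 poly_deriv_value_Suc zero_O O_closed O_add O_mult O_pow O_nat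
      simp del: nat_pow_Suc add.nat_pow_Suc)

text \<open>For \<open>z\<close> and \<open>y\<close> congruent to \<open>b\<close>, difference quotients are congruent to the derivative at \<open>b\<close>.\<close>

lemma power_expansion:
  assumes b: "b \<in> \<O>" and z: "z \<in> carrier R" "z \<ominus> b \<in> \<M>" and y: "y \<in> carrier R" "y \<ominus> b \<in> \<M>"
  shows "\<exists>m\<in>\<M>. z [^] Suc n \<ominus> y [^] Suc n = (z \<ominus> y) \<otimes> ([Suc n] \<cdot> (b [^] n) \<oplus> m)"
proof -
  have bc: "b \<in> carrier R" using b O_closed by blast
  have eq: "x = b \<oplus> (x \<ominus> b)" if "x \<in> carrier R" for x using that bc by algebra
  have zO: "z \<in> \<O>" and yO: "y \<in> \<O>" using eq[of z] eq[of y] z y O_add b M_imp_O by metis+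
  have pow: "\<exists>m\<in>\<M>. y [^] n = b [^] n \<oplus> m" for n :: nat
  proof (induction n)
    case 0
    then show ?case using zero_M by (intro bexI[of _ \<zero>]) auto
  next
    case (Suc n)
    then obtain m where m: "m \<in> \<M>" "y [^] n = b [^] n \<oplus> m" by blast
    let ?d = "y \<ominus> b"
    have cl: "b [^] n \<in> carrier R" "m \<in> carrier R" using bc m M_closed by auto
    have "y [^] Suc n = (b [^] n \<oplus> m) \<otimes> y" using m by simp
    also have "\<dots> = b [^] n \<otimes> b \<oplus> (b [^] n \<otimes> ?d \<oplus> m \<otimes> y)" using cl bc y(1) by algebra
    finally show ?case using m y M_add M_mult M_mult' O_pow[OF b] yO by (intro bexI[of _ "b [^] n \<otimes> ?d \<oplus> m \<otimes> y"]) auto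
  qed
  show ?thesis
  proof (induction n)
    case 0
    then show ?case using zero_M z y by (intro bexI[of _ \<zero>]) auto
  next
    case (Suc n)
    then obtain m where m: "m \<in> \<M>" "z [^] Suc n \<ominus> y [^] Suc n = (z \<ominus> y) \<otimes> ([Suc n] \<cdot> (b [^] n) \<oplus> m)" by blast
    obtain m' where m': "m' \<in> \<M>" "y [^] Suc n = b [^] Suc n \<oplus> m'" using pow by blast
    define u v w where "u = z [^] Suc n" and "v = y [^] Suc n" and "w = [Suc n] \<cdot> (b [^] n)"
    define m'' where "m'' = w \<otimes> (z \<ominus> b) \<oplus> (m \<otimes> z \<oplus> m')"
    have cl: "u \<in> carrier R" "v \<in> carrier R" "w \<in> carrier R" "m \<in> carrier R" "m' \<in> carrier R"
      "b [^] Suc n \<in> carrier R"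
      using z y bc m m' M_closed unfolding u_def v_def w_def by auto
    have w: "w \<otimes> b \<oplus> b [^] Suc n = [Suc (Suc n)] \<cdot> (b [^] Suc n)"
      unfolding w_def using bc by (simp add: add_pow_ldistr l_distr)
    have "z [^] Suc (Suc n) \<ominus> y [^] Suc (Suc n) = u \<otimes> z \<ominus> v \<otimes> y" unfolding u_def v_def by simp
    also have "\<dots> = (u \<ominus> v) \<otimes> z \<oplus> (z \<ominus> y) \<otimes> v" using cl z(1) y(1) by algebra
    also have "\<dots> = ((z \<ominus> y) \<otimes> (w \<oplus> m)) \<otimes> z \<oplus> (z \<ominus> y) \<otimes> (b [^] Suc n \<oplus> m')"
      using m(2) m'(2) unfolding u_def v_def w_def by simp
    also have "\<dots> = (z \<ominus> y) \<otimes> ((w \<otimes> b \<oplus> b [^] Suc n) \<oplus> m'')"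
      unfolding m''_def using cl z(1) y(1) bc by algebra
    finally have "z [^] Suc (Suc n) \<ominus> y [^] Suc (Suc n) = (z \<ominus> y) \<otimes> ([Suc (Suc n)] \<cdot> (b [^] Suc n) \<oplus> m'')"
      using w by simp
    moreover have "m'' \<in> \<M>" unfolding m''_def w_def
      using m m' z zO b by (intro M_add M_mult M_mult' O_nat O_pow)
    ultimately show ?case by blast
  qed
qed

lemma poly_expansion:
  assumes c: "\<And>i. i \<le> n \<Longrightarrow> c i \<in> \<O>"
    and b: "b \<in> \<O>" and z: "z \<in> carrier R" "z \<ominus> b \<in> \<M>" and y: "y \<in> carrier R" "y \<ominus> b \<in> \<M>"
  shows "\<exists>m\<in>\<M>. poly_value R n c z \<ominus> poly_value R n c y = (z \<ominus> y) \<otimes> (poly_deriv_value R n c b \<oplus> m)"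
  using c
proof (induction n)
  case 0
  then show ?case using zero_M z y O_closed
    by (intro bexI[of _ \<zero>]) (auto simp: poly_value_0 poly_deriv_value_0 a_minus_def r_neg)
next
  case (Suc n)
  then obtain m where m: "m \<in> \<M>"
      "poly_value R n c z \<ominus> poly_value R n c y = (z \<ominus> y) \<otimes> (poly_deriv_value R n c b \<oplus> m)" by auto
  obtain m' where m': "m' \<in> \<M>" "z [^] Suc n \<ominus> y [^] Suc n = (z \<ominus> y) \<otimes> ([Suc n] \<cdot> (b [^] n) \<oplus> m')"
    using power_expansion[OF b z y] by blast
  have cc: "c i \<in> carrier R" if "i \<le> Suc n" for i using that Suc.prems O_closed by auto
  have bc: "b \<in> carrier R" using b O_closed by auto
  define C u v w p q r where defs: "C = c (Suc n)" "u = z [^] Suc n" "v = y [^] Suc n"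
    "w = [Suc n] \<cdot> (b [^] n)" "p = poly_value R n c z" "q = poly_value R n c y" "r = poly_deriv_value R n c b"
  have cl: "C \<in> carrier R" "u \<in> carrier R" "v \<in> carrier R" "w \<in> carrier R" "p \<in> carrier R" "q \<in> carrier R"
    "r \<in> carrier R" "m \<in> carrier R" "m' \<in> carrier R"
    unfolding defs using cc z y bc m m' M_closed by auto
  have "poly_value R (Suc n) c z \<ominus> poly_value R (Suc n) c y = (C \<otimes> u \<oplus> p) \<ominus> (C \<otimes> v \<oplus> q)"
    using cc z y by (simp add: poly_value_Suc defs del: nat_pow_Suc)
  also have "\<dots> = C \<otimes> (u \<ominus> v) \<oplus> (p \<ominus> q)" using cl by algebra
  also have "\<dots> = C \<otimes> ((z \<ominus> y) \<otimes> (w \<oplus> m')) \<oplus> (z \<ominus> y) \<otimes> (r \<oplus> m)"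
    using m(2) m'(2) by (simp add: defs del: nat_pow_Suc add.nat_pow_Suc)
  also have "\<dots> = (z \<ominus> y) \<otimes> ((C \<otimes> w \<oplus> r) \<oplus> (C \<otimes> m' \<oplus> m))" using cl z(1) y(1) by algebra
  also have "C \<otimes> w = [Suc n] \<cdot> (C \<otimes> b [^] n)"
    unfolding defs using cc bc by (simp add: add_pow_rdistr del: add.nat_pow_Suc)
  also have "[Suc n] \<cdot> (C \<otimes> b [^] n) \<oplus> r = poly_deriv_value R (Suc n) c b"
    unfolding defs using cc bc by (intro poly_deriv_value_Suc[symmetric]) auto
  finally show ?case using M_add M_mult' m m' Suc.prems unfolding defs by blast
qed

end

text \<open>Newton's map \<open>z - p z / p' b\<close> is a contraction of a ball around \<open>b\<close>.\<close>

lemma (in spherically_complete) Hensel_coarse: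
  assumes "coarsening R ord D"
    and c: "\<And>i. i \<le> n \<Longrightarrow> c i \<in> coarse_ring D" and b: "b \<in> coarse_ring D"
    and small: "poly_value R n c b \<in> coarse_ideal D"
    and unit: "poly_deriv_value R n c b \<notin> coarse_ideal D"
  shows "\<exists>a\<in>carrier R. poly_value R n c a = \<zero> \<and> a \<ominus> b \<in> coarse_ideal D"
proof -
  interpret coarsening R ord D by fact
  define q where "q = poly_deriv_value R n c b"
  have bc: "b \<in> carrier R" and cc: "\<And>i. i \<le> n \<Longrightarrow> c i \<in> carrier R" using b c O_closed by auto
  have q: "q \<in> \<O>" "q \<notin> \<M>" unfolding q_def using O_poly_deriv_value[OF c b] unit by simp_all
  note iq = unit_inv[OF q]
  have qc: "q \<in> carrier R" "inv q \<in> carrier R" using O_closed[OF q(1)] O_closed[OF iq(2)] by simp_all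
  let ?p = "poly_value R n c"
  have pc: "?p z \<in> carrier R" if "z \<in> carrier R" for z using that cc by auto
  show ?thesis
  proof (cases "?p b = \<zero>")
    case True
    then show ?thesis using bc zero_M by (intro bexI[of _ b]) (auto simp: a_minus_def r_neg)
  next
    case False
    define e where "e = inv q \<otimes> ?p b"
    have eM: "e \<in> \<M>" unfolding e_def by (rule M_mult'[OF iq(2) small])
    have ec: "e \<in> carrier R" by (rule M_closed[OF eM])
    have "q \<otimes> e = ?p b" unfolding e_def using qc pc[OF bc] iq(4) by (simp add: m_assoc[symmetric])
    then have "e \<noteq> \<zero>" using False qc by auto
    then have eD: "\<forall>d\<in>D. d < ord e" using eM by (auto simp: coarse_ideal_def)
    have ball: "x \<in> \<M>" if "x \<in> carrier R" "ge x (ord e)" for x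
      using that eD by (auto simp: coarse_ideal_def ge_def intro: less_le_trans)
    let ?\<phi> = "\<lambda>z. z \<ominus> inv q \<otimes> ?p z"
    have contr: "gt (?\<phi> z \<ominus> ?\<phi> y) (ord (z \<ominus> y))"
      if zy: "z \<in> carrier R" "y \<in> carrier R" "ge (z \<ominus> b) (ord e)" "ge (y \<ominus> b) (ord e)" for z y
    proof -
      obtain m where m: "m \<in> \<M>" "?p z \<ominus> ?p y = (z \<ominus> y) \<otimes> (q \<oplus> m)"
        using poly_expansion[of n c b z y] c b zy ball[of "z \<ominus> b"] ball[of "y \<ominus> b"] bc
        unfolding q_def by auto
      have mc: "m \<in> carrier R" by (rule M_closed[OF m(1)])
      have "?\<phi> z \<ominus> ?\<phi> y = (z \<ominus> y) \<ominus> inv q \<otimes> (?p z \<ominus> ?p y)"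
        using zy(1,2) qc pc[OF zy(1)] pc[OF zy(2)] by algebra
      also have "\<dots> = (z \<ominus> y) \<ominus> (z \<ominus> y) \<otimes> (q \<otimes> inv q) \<ominus> (z \<ominus> y) \<otimes> (inv q \<otimes> m)"
        unfolding m(2) using zy(1,2) qc mc by algebra
      also have "\<dots> = \<ominus> ((inv q \<otimes> m) \<otimes> (z \<ominus> y))"
        unfolding iq(4) using zy(1,2) qc mc by algebra
      finally have eq: "?\<phi> z \<ominus> ?\<phi> y = \<ominus> ((inv q \<otimes> m) \<otimes> (z \<ominus> y))" .
      have "gt (inv q \<otimes> m) 0" by (rule M_gt_zero[OF M_mult'[OF iq(2) m(1)]])
      then have "gt ((inv q \<otimes> m) \<otimes> (z \<ominus> y)) (0 + ord (z \<ominus> y))"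
        using zy qc mc by (intro gt_mult) (auto simp: ge_def)
      then show ?thesis unfolding eq using zy qc mc by simp
    qed
    obtain a where a: "a \<in> carrier R" "ge (a \<ominus> b) (ord e)" "?\<phi> a = a"
    proof (rule contraction_fixed_point[of b "ord e" ?\<phi>])
      fix z assume z: "z \<in> carrier R" "ge (z \<ominus> b) (ord e)"
      have 1: "ge (?\<phi> z \<ominus> ?\<phi> b) (ord e)"
      proof (cases "z = b")
        case True
        then show ?thesis using qc pc bc by (simp add: a_minus_def r_neg)
      next
        case False
        then have "z \<ominus> b \<noteq> \<zero>" using z bc by simp
        then have "ord e \<le> ord (z \<ominus> b)" using z(2) by (simp add: ge_def)
        moreover have "gt (?\<phi> z \<ominus> ?\<phi> b) (ord (z \<ominus> b))"
          using contr[of z b] z bc by (simp add: a_minus_def r_neg)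
        ultimately show ?thesis using gt_imp_ge ge_mono by blast
      qed
      have "?\<phi> b \<ominus> b = \<ominus> e" unfolding e_def using bc qc pc[OF bc] by algebra
      then have 2: "ge (?\<phi> b \<ominus> b) (ord e)" using ec by (simp add: ge_def)
      show "?\<phi> z \<in> carrier R \<and> ge (?\<phi> z \<ominus> b) (ord e)"
        using ge_trans[OF _ _ _ 1 2] z bc qc pc by simp
    qed (use contr bc in auto)
    have "inv q \<otimes> ?p a = a \<ominus> ?\<phi> a" using a(1) qc pc[OF a(1)] by algebra
    then have "inv q \<otimes> ?p a = \<zero>" using a by (simp add: a_minus_def r_neg)
    moreover have "inv q \<noteq> \<zero>" using iq(4) qc(1) one_neq_zero by auto
    ultimately have "?p a = \<zero>" using integral_iff[OF qc(2) pc[OF a(1)]] by simp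
    then show ?thesis using a ball[of "a \<ominus> b"] bc by auto
  qed
qed

section \<open>Simple roots and derivations\<close>

context field
begin

lemma poly_value_trim:
  assumes "\<And>i. i \<le> n \<Longrightarrow> c i \<in> carrier R" "x \<in> carrier R" "i \<le> n" "c i \<noteq> \<zero>"
  shows "\<exists>m\<le>n. c m \<noteq> \<zero> \<and> poly_value R m c x = poly_value R n c x"
  using assms(1,3)
proof (induction n)
  case 0
  then show ?case using assms(4) by auto
next
  case (Suc n)
  show ?case
  proof (cases "c (Suc n) = \<zero>")
    case True
    have "poly_value R (Suc n) c x = c (Suc n) \<otimes> x [^] Suc n \<oplus> poly_value R n c x"
      by (rule poly_value_Suc) (use Suc.prems assms(2) in auto)
    also have "\<dots> = poly_value R n c x" using True Suc.prems assms(2) by (simp del: nat_pow_Suc)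
    finally have "poly_value R (Suc n) c x = poly_value R n c x" .
    moreover have "i \<le> n" using Suc.prems(2) True assms(4) by (cases "i = Suc n") auto
    ultimately show ?thesis using Suc by (metis le_SucI)
  next
    case False
    then show ?thesis by blast
  qed
qed

text \<open>A polynomial of least degree with value in \<open>Z\<close> is taken. Its derivative is non-zero, as the
  characteristic is \<open>0\<close>, and has smaller degree, so its value lies outside of \<open>Z\<close>.\<close>

lemma simple_root_exists:
  assumes char: "\<And>n x. (n::nat) > 0 \<Longrightarrow> x \<in> carrier R \<Longrightarrow> x \<noteq> \<zero> \<Longrightarrow> [n] \<cdot> x \<noteq> \<zero>"
    and K: "subfield K R" and x: "x \<in> carrier R" and Z: "K \<inter> Z \<subseteq> {\<zero>}"
    and rel: "\<And>i. i \<le> m \<Longrightarrow> d i \<in> K" "d m \<noteq> \<zero>" "poly_value R m d x \<in> Z"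
  shows "\<exists>n c. (\<forall>i\<le>n. c i \<in> K) \<and> c n \<noteq> \<zero> \<and> poly_value R n c x \<in> Z \<and> poly_deriv_value R n c x \<notin> Z"
proof -
  define Q where "Q n = (\<exists>c. (\<forall>i\<le>n. c i \<in> K) \<and> c n \<noteq> \<zero> \<and> poly_value R n c x \<in> Z)" for n
  have KR: "K \<subseteq> carrier R" using subfieldE(3)[OF K] .
  have "Q m" unfolding Q_def using rel by blast
  then have ex: "\<exists>n. Q n" by blast
  define n where "n = (LEAST n. Q n)"
  have "Q n" unfolding n_def using ex by (rule LeastI_ex)
  then obtain c where c: "\<And>i. i \<le> n \<Longrightarrow> c i \<in> K" "c n \<noteq> \<zero>" "poly_value R n c x \<in> Z"
    unfolding Q_def by blast
  have "n \<noteq> 0"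
  proof
    assume "n = 0"
    then have "c 0 \<in> K \<inter> Z" using c poly_value_0[of c x] KR by auto
    then show False using Z c(2) \<open>n = 0\<close> by auto
  qed
  then obtain l where l: "n = Suc l" by (cases n) auto
  have nat_K: "[i] \<cdot> y \<in> K" if "y \<in> K" for y and i :: nat
    using that subringE(2,7)[OF subfieldE(1)[OF K]] by (induction i) auto
  have "poly_deriv_value R n c x \<notin> Z"
  proof
    assume "poly_deriv_value R n c x \<in> Z"
    moreover have "\<And>i. i \<le> Suc l \<Longrightarrow> c i \<in> carrier R" using c(1) KR l by auto
    ultimately have "poly_value R l (\<lambda>i. [Suc i] \<cdot> c (Suc i)) x \<in> Z"
      using poly_deriv_value_shift[of l c x] x unfolding l by (simp only:)
    moreover have "[Suc l] \<cdot> c (Suc l) \<noteq> \<zero>" using c KR l by (intro char) auto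
    moreover have "[Suc i] \<cdot> c (Suc i) \<in> K" if "i \<le> l" for i using nat_K[OF c(1), of "Suc i"] l that by (simp del: add.nat_pow_Suc)
    ultimately have "Q l" unfolding Q_def by (intro exI[of _ "\<lambda>i. [Suc i] \<cdot> c (Suc i)"]) simp
    then have "n \<le> l" unfolding n_def by (rule Least_le)
    then show False using l by simp
  qed
  then show ?thesis using c by blast
qed

context
  fixes D assumes D: "derivation D"
begin

lemma der_closed: "x \<in> carrier R \<Longrightarrow> D x \<in> carrier R"
  and der_add: "x \<in> carrier R \<Longrightarrow> y \<in> carrier R \<Longrightarrow> D (x \<oplus> y) = D x \<oplus> D y"
  and der_mult: "x \<in> carrier R \<Longrightarrow> y \<in> carrier R \<Longrightarrow> D (x \<otimes> y) = D x \<otimes> y \<oplus> x \<otimes> D y"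
  using D by (auto simp: derivation_def)

lemma der_zero: "D \<zero> = \<zero>"
  using der_add[of \<zero> \<zero>] der_closed[of \<zero>] by simp

lemma der_one: "D \<one> = \<zero>"
  using der_mult[of \<one> \<one>] der_closed[of \<one>] by simp

lemma der_minus: "x \<in> carrier R \<Longrightarrow> D (\<ominus> x) = \<ominus> D x"
  using der_add[of x "\<ominus> x"] der_zero der_closed by (metis a_inv_closed minus_equality r_neg a_comm)

lemma der_pow: "x \<in> carrier R \<Longrightarrow> D (x [^] Suc n) = [Suc n] \<cdot> (x [^] n) \<otimes> D x"
proof (induction n)
  case 0
  then show ?case using der_mult[of \<one> x] der_one der_closed by simp
next
  case (Suc n)
  define w where "w = [Suc n] \<cdot> (x [^] n)"
  have w: "w \<in> carrier R" "w \<otimes> x = [Suc n] \<cdot> (x [^] Suc n)"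
    unfolding w_def using Suc by (auto simp: add_pow_ldistr simp del: add.nat_pow_Suc)
  have "D (x [^] Suc (Suc n)) = D (x [^] Suc n) \<otimes> x \<oplus> x [^] Suc n \<otimes> D x"
    using der_mult[of "x [^] Suc n" x] Suc.prems by simp
  also have "\<dots> = (w \<otimes> x \<oplus> x [^] Suc n) \<otimes> D x"
  proof -
    have "x [^] Suc n \<in> carrier R" using Suc.prems by simp
    then show ?thesis
      unfolding Suc.IH[OF Suc.prems] w_def[symmetric] using w(1) Suc.prems der_closed[OF Suc.prems]
      by algebra
  qed
  also have "w \<otimes> x \<oplus> x [^] Suc n = [Suc (Suc n)] \<cdot> (x [^] Suc n)" unfolding w(2) by simp
  finally show ?case .
qed

lemma der_poly_value:
  assumes "\<And>i. i \<le> n \<Longrightarrow> c i \<in> carrier R" "x \<in> carrier R"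
  shows "D (poly_value R n c x) = poly_value R n (\<lambda>i. D (c i)) x \<oplus> poly_deriv_value R n c x \<otimes> D x"
  using assms(1)
proof (induction n)
  case 0
  then show ?case using assms(2) der_closed by (simp add: poly_value_0 poly_deriv_value_0)
next
  case (Suc n)
  define p q r C u w where defs: "p = poly_value R n (\<lambda>i. D (c i)) x" "q = poly_deriv_value R n c x"
    "r = poly_value R n c x" "C = c (Suc n)" "u = x [^] Suc n" "w = [Suc n] \<cdot> (x [^] n)"
  have cl: "p \<in> carrier R" "q \<in> carrier R" "r \<in> carrier R" "C \<in> carrier R" "u \<in> carrier R" "w \<in> carrier R"
    "D C \<in> carrier R" "D x \<in> carrier R"
    unfolding defs using Suc.prems assms(2) der_closed by auto
  have IH: "D r = p \<oplus> q \<otimes> D x" unfolding defs using Suc by auto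
  have "D (poly_value R (Suc n) c x) = D (C \<otimes> u \<oplus> r)"
    using Suc.prems assms(2) by (subst poly_value_Suc) (auto simp: defs)
  also have "\<dots> = (D C \<otimes> u \<oplus> C \<otimes> D u) \<oplus> D r" using der_add[of "C \<otimes> u" r] der_mult[of C u] cl by simp
  also have "D u = w \<otimes> D x" unfolding defs using der_pow[OF assms(2)] .
  also have "(D C \<otimes> u \<oplus> C \<otimes> (w \<otimes> D x)) \<oplus> D r = (D C \<otimes> u \<oplus> p) \<oplus> (C \<otimes> w \<oplus> q) \<otimes> D x"
    unfolding IH using cl by algebra
  also have "C \<otimes> w = [Suc n] \<cdot> (C \<otimes> x [^] n)" unfolding defs
    using Suc.prems assms(2) by (simp add: add_pow_rdistr del: add.nat_pow_Suc)
  also have "[Suc n] \<cdot> (C \<otimes> x [^] n) \<oplus> q = poly_deriv_value R (Suc n) c x" unfolding defs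
    using Suc.prems assms(2) by (subst poly_deriv_value_Suc) auto
  also have "D C \<otimes> u \<oplus> p = poly_value R (Suc n) (\<lambda>i. D (c i)) x" unfolding defs
    using Suc.prems assms(2) der_closed by (subst poly_value_Suc) auto
  finally show ?case .
qed

lemma der_quotient_zero:
  assumes "a \<in> carrier R" "b \<in> carrier R" "b \<noteq> \<zero>" "D a = \<zero>" "D b = \<zero>"
  shows "D (a \<otimes> inv b) = \<zero>"
proof -
  have i: "inv b \<in> carrier R" "inv b \<otimes> b = \<one>" using assms field_Units by auto
  have "D (inv b) \<otimes> b = D (inv b \<otimes> b)" using der_mult[of "inv b" b] i assms der_closed by simp
  then have "D (inv b) \<otimes> b = \<zero>" using i der_one by simp
  then have "D (inv b) = \<zero>" using integral_iff i assms der_closed by blast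
  then show ?thesis using der_mult[of a "inv b"] i assms by simp
qed

lemma poly_value_all_zero:
  assumes "\<And>i. i \<le> n \<Longrightarrow> c i = \<zero>" "x \<in> carrier R"
  shows "poly_value R n c x = \<zero>"
  unfolding poly_value_def by (rule add.finprod_one_eqI) (use assms in auto)

text \<open>Differentiating an equation \<open>p x = 0\<close> with annihilated coefficients gives \<open>p' x * D x = 0\<close>, where
  \<open>p\<close> can be chosen such that \<open>x\<close> is a simple root.\<close>

lemma der_algebraic_zero:
  assumes char: "\<And>n x. (n::nat) > 0 \<Longrightarrow> x \<in> carrier R \<Longrightarrow> x \<noteq> \<zero> \<Longrightarrow> [n] \<cdot> x \<noteq> \<zero>"
    and K: "subfield K R" and DK: "\<And>y. y \<in> K \<Longrightarrow> D y = \<zero>"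
    and x: "x \<in> carrier R" "algebraic K x"
  shows "D x = \<zero>"
proof -
  obtain n c where c: "\<And>i. i \<le> n \<Longrightarrow> c i \<in> K" "poly_value R n c x \<in> {\<zero>}" "poly_deriv_value R n c x \<notin> {\<zero>}"
  proof -
    obtain m d where "\<forall>i\<le>m. d i \<in> K" "d m \<noteq> \<zero>" "poly_value R m d x = \<zero>"
      using algebraic_iff_root[OF K x(1)] x(2) unfolding root_over_def by blast
    then show ?thesis using simple_root_exists[OF char K x(1), of "{\<zero>}" m d] that by blast
  qed
  have KR: "K \<subseteq> carrier R" using subfieldE(3)[OF K] .
  have cc: "\<And>i. i \<le> n \<Longrightarrow> c i \<in> carrier R" using c(1) KR by auto
  have "poly_value R n (\<lambda>i. D (c i)) x = \<zero>" using DK c(1) x(1) by (intro poly_value_all_zero) auto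
  then have "poly_deriv_value R n c x \<otimes> D x = \<zero>"
    using der_poly_value[of n c x, OF cc x(1)] c(2) x(1) der_zero der_closed[OF x(1)] cc by auto
  then show ?thesis
    using integral_iff[of "poly_deriv_value R n c x" "D x"] c(3) cc x(1) der_closed by auto
qed

text \<open>Differentiating \<open>p x = 0\<close> expresses \<open>D x\<close> as a quotient of elements of \<open>L\<close>.\<close>

lemma der_algebraic_closed:
  assumes char: "\<And>n x. (n::nat) > 0 \<Longrightarrow> x \<in> carrier R \<Longrightarrow> x \<noteq> \<zero> \<Longrightarrow> [n] \<cdot> x \<noteq> \<zero>"
    and K: "subfield K R" and DK: "\<And>y. y \<in> K \<Longrightarrow> D y \<in> K"
    and L: "subfield L R" "K \<subseteq> L" and x: "x \<in> L" "algebraic K x"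
  shows "D x \<in> L"
proof -
  have LR: "L \<subseteq> carrier R" using subfieldE(3)[OF L(1)] .
  have xc: "x \<in> carrier R" using x LR by auto
  obtain n c where c: "\<And>i. i \<le> n \<Longrightarrow> c i \<in> K" "poly_value R n c x \<in> {\<zero>}" "poly_deriv_value R n c x \<notin> {\<zero>}"
  proof -
    obtain m d where "\<forall>i\<le>m. d i \<in> K" "d m \<noteq> \<zero>" "poly_value R m d x = \<zero>"
      using algebraic_iff_root[OF K xc] x(2) unfolding root_over_def by blast
    then show ?thesis using simple_root_exists[OF char K xc, of "{\<zero>}" m d] that by blast
  qed
  have cc: "c i \<in> carrier R" "c i \<in> L" "D (c i) \<in> L" if "i \<le> n" for i using c(1)[OF that] DK L(2) LR by auto
  note sr = subringE[OF subfieldE(1)[OF L(1)]]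
  have pow: "x [^] (i::nat) \<in> L" for i using x(1) sr by (induction i) auto
  have natL: "[i] \<cdot> y \<in> L" if "y \<in> L" for y and i :: nat using that sr by (induction i) auto
  have pv: "(\<forall>i\<le>n. d i \<in> L) \<Longrightarrow> poly_value R n d x \<in> L" for n d
  proof (induction n)
    case 0
    then show ?case using poly_value_0[of d x] LR by auto
  next
    case (Suc n)
    have "poly_value R (Suc n) d x = d (Suc n) \<otimes> x [^] Suc n \<oplus> poly_value R n d x"
      by (rule poly_value_Suc) (use Suc.prems LR xc in auto)
    then show ?case using Suc by (simp only:) (intro sr(6,7) pow, auto)
  qed
  have dv: "(\<forall>i\<le>n. d i \<in> L) \<Longrightarrow> poly_deriv_value R n d x \<in> L" for n d
  proof (induction n)
    case 0
    then show ?case using poly_deriv_value_0 sr(2) by auto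
  next
    case (Suc n)
    have "poly_deriv_value R (Suc n) d x = [Suc n] \<cdot> (d (Suc n) \<otimes> x [^] n) \<oplus> poly_deriv_value R n d x"
      by (rule poly_deriv_value_Suc) (use Suc.prems LR xc in auto)
    then show ?case using Suc by (simp only:) (intro sr(6,7) natL pow, auto)
  qed
  define p q where "p = poly_value R n (\<lambda>i. D (c i)) x" and "q = poly_deriv_value R n c x"
  have pq: "p \<in> L" "q \<in> L" "q \<noteq> \<zero>" unfolding p_def q_def using pv dv cc c(3) by auto
  then have pqc: "p \<in> carrier R" "q \<in> carrier R" using LR by auto
  have "p \<oplus> q \<otimes> D x = \<zero>"
    unfolding p_def q_def using der_poly_value[of n c x] cc xc c(2) der_zero by auto
  then have "q \<otimes> D x = \<ominus> p" using pqc der_closed[OF xc] by (metis minus_equality minus_minus a_inv_closed m_closed a_comm)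
  then have "q \<otimes> D x \<in> L" using pq sr(5) by simp
  then show ?thesis using subfield_m_inv_simprule[OF L(1), of q "D x"] pq der_closed[OF xc] by simp
qed

end

end

section \<open>Passing to a subfield\<close>

context field
begin

context
  fixes K assumes K: "subfield K R"
begin

abbreviation "RK \<equiv> R\<lparr>carrier := K\<rparr>"

lemma sub_field: "field RK" using subfield_iff(2)[OF K] .

lemma sub_incl: "x \<in> K \<Longrightarrow> x \<in> carrier R" using subfieldE(3)[OF K] by auto

lemma sub_a_inv: "x \<in> K \<Longrightarrow> \<ominus>\<^bsub>RK\<^esub> x = \<ominus> x"
proof -
  assume x: "x \<in> K"
  interpret S: field RK by (rule sub_field)
  have mx: "\<ominus> x \<in> K" using subringE(5)[OF subfieldE(1)[OF K]] x .
  have "\<ominus> x \<oplus> x = \<zero>" using sub_incl[OF x] by (simp add: l_neg)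
  then show ?thesis using S.minus_equality[of "\<ominus> x" x] x mx by simp
qed

lemma sub_minus: "x \<in> K \<Longrightarrow> y \<in> K \<Longrightarrow> x \<ominus>\<^bsub>RK\<^esub> y = x \<ominus> y"
  by (simp add: a_minus_def sub_a_inv)

lemma sub_m_inv: "x \<in> K \<Longrightarrow> x \<noteq> \<zero> \<Longrightarrow> inv\<^bsub>RK\<^esub> x = inv x"
proof -
  assume x: "x \<in> K" "x \<noteq> \<zero>"
  interpret S: field RK by (rule sub_field)
  have i: "inv x \<in> K" "x \<otimes> inv x = \<one>" using subfield_m_inv[OF K, of x] x by auto
  show ?thesis using S.comm_inv_char[of x "inv x"] x i by simp
qed

lemma sub_nat_pow: "x [^]\<^bsub>RK\<^esub> (n::nat) = x [^] n"
  by (induction n) auto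

lemma sub_add_pow: "[(n::nat)] \<cdot>\<^bsub>RK\<^esub> x = [n] \<cdot> x"
  by (simp add: add_pow_def nat_pow_def)

lemma sub_finsum: "f \<in> A \<rightarrow> K \<Longrightarrow> finsum RK f A = finsum R f A"
proof (induction A rule: infinite_finite_induct)
  interpret S: field RK by (rule sub_field)
  case (insert a A)
  then show ?case using sub_incl by (subst S.finsum_insert, auto) (subst finsum_insert, auto)
next
  interpret S: field RK by (rule sub_field)
  case empty
  show ?case using S.finsum_empty finsum_empty by simp
next
  interpret S: field RK by (rule sub_field)
  case (infinite A)
  then show ?case using S.finsum_infinite finsum_infinite by simp
qed

lemma sub_pow_closed: "x \<in> K \<Longrightarrow> x [^] (n::nat) \<in> K"
  using subringE(3,6)[OF subfieldE(1)[OF K]] by (induction n) auto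

lemma sub_nat_mult_closed: "x \<in> K \<Longrightarrow> [(n::nat)] \<cdot> x \<in> K"
  using subringE(2,7)[OF subfieldE(1)[OF K]] by (induction n) auto

lemma sub_poly_value:
  assumes "\<And>i. i \<le> n \<Longrightarrow> c i \<in> K" "x \<in> K"
  shows "poly_value RK n c x = poly_value R n c x"
    and "poly_deriv_value RK n c x = poly_deriv_value R n c x"
proof -
  have m: "c i \<otimes> x [^] (j::nat) \<in> K" if "i \<le> n" for i j
    using assms that sub_pow_closed subringE(6)[OF subfieldE(1)[OF K]] by auto
  show "poly_value RK n c x = poly_value R n c x"
    unfolding poly_value_def sub_nat_pow using m by (simp, intro sub_finsum) auto
  show "poly_deriv_value RK n c x = poly_deriv_value R n c x"
    unfolding poly_deriv_value_def sub_nat_pow sub_add_pow using m sub_nat_mult_closed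
    by (simp, intro sub_finsum) auto
qed

lemma sub_quot_field: "S \<subseteq> K \<Longrightarrow> quot_field RK S = quot_field R S"
  unfolding quot_field_def using sub_m_inv by (auto, metis subsetD, metis subsetD)

lemma sub_span_of: "ring.span_of RK I C u = span_of I C u"
proof -
  interpret S: field RK by (rule sub_field)
  show ?thesis
  proof (intro equalityI subsetI)
    fix z assume "z \<in> S.span_of I C u"
    then show "z \<in> span_of I C u"
      by (induction rule: S.span_of.induct) (auto intro: span_of.intros)
  next
    fix z assume "z \<in> span_of I C u"
    then show "z \<in> S.span_of I C u"
    proof (induction rule: span_of.induct)
      case zero
      then show ?case using S.span_of.zero by simp
    next
      case (step i c z)
      then show ?case using S.span_of.step[of i I c C z u] by simp
    qed
  qed
qed

end

end

section \<open>Algebraic extensions of fields generated by monomials\<close>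

context coarsening
begin

text \<open>An algebraic extension of a field of units and \<open>\<zero>\<close> consists of units and \<open>\<zero>\<close>:
  otherwise it would contain some \<open>x\<close> with \<open>inv x \<in> \<M>\<close>, and a polynomial relation for \<open>x\<close>, divided
  by the highest power of \<open>x\<close>, would express its leading coefficient by elements of \<open>\<M>\<close>.\<close>

lemma algebraic_over_units:
  assumes N: "subfield N R" "N \<subseteq> \<O>" "N \<inter> \<M> \<subseteq> {\<zero>}" and x: "x \<in> carrier R" "algebraic N x"
  shows "x \<in> \<O>"
proof (rule ccontr)
  assume nO: "x \<notin> \<O>"
  have NR: "N \<subseteq> carrier R" using subfieldE(3)[OF N(1)] .
  have nz: "x \<noteq> \<zero>" using nO zero_O by auto
  define u where "u = inv x"
  have u: "u \<in> carrier R" "x \<otimes> u = \<one>" using nz x(1) field_Units unfolding u_def by auto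
  have unz: "u \<noteq> \<zero>" using u x(1) one_neq_zero by auto
  have "ord x + ord u = 0" using ord_mult[of x u] u x(1) nz unz by simp
  then have o: "ord u = - ord x" by (simp add: eq_neg_iff_add_eq_0 add.commute)
  have "d < ord u" if "d \<in> D" for d
  proof -
    have "\<not> - d \<le> ord x" using nO x(1) D_uminus[OF that] by (auto simp: coarse_ring_def)
    then show ?thesis using o by (simp add: not_le minus_less_iff less_minus_iff)
  qed
  then have uM: "u \<in> \<M>" using u(1) by (simp add: coarse_ideal_def)
  obtain n c where c: "\<And>i. i \<le> n \<Longrightarrow> c i \<in> N" "c n \<noteq> \<zero>" "poly_value R n c x = \<zero>"
    using algebraic_iff_root[OF N(1) x(1)] x(2) unfolding root_over_def by blast
  have step: "\<exists>m\<in>\<M>. poly_value R l c x \<otimes> u [^] l = c l \<oplus> m" if "l \<le> n" for l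
    using that
  proof (induction l)
    case 0
    then show ?case using poly_value_0[of c x] c(1)[of 0] NR zero_M by (intro bexI[of _ \<zero>]) auto
  next
    case (Suc l)
    then obtain m where m: "m \<in> \<M>" "poly_value R l c x \<otimes> u [^] l = c l \<oplus> m" by auto
    have cc: "\<And>i. i \<le> Suc l \<Longrightarrow> c i \<in> carrier R" using c(1) NR Suc.prems by auto
    define p C V U where defs: "p = poly_value R l c x" "C = c (Suc l)" "V = x [^] Suc l" "U = u [^] l"
    have cl: "p \<in> carrier R" "C \<in> carrier R" "V \<in> carrier R" "U \<in> carrier R"
      unfolding defs using cc x(1) u by auto
    have XU: "V \<otimes> (U \<otimes> u) = \<one>" unfolding defs
      using nat_pow_distrib[of x u "Suc l"] u x(1) by simp
    have "poly_value R (Suc l) c x \<otimes> u [^] Suc l = (C \<otimes> V \<oplus> p) \<otimes> (U \<otimes> u)"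
      using poly_value_Suc[OF cc x(1)] unfolding defs by simp
    also have "\<dots> = C \<otimes> (V \<otimes> (U \<otimes> u)) \<oplus> (p \<otimes> U) \<otimes> u" using cl u(1) by algebra
    also have "\<dots> = C \<oplus> (c l \<oplus> m) \<otimes> u" using XU m(2) cl unfolding defs by simp
    finally have "poly_value R (Suc l) c x \<otimes> u [^] Suc l = c (Suc l) \<oplus> (c l \<oplus> m) \<otimes> u"
      unfolding defs .
    moreover have "(c l \<oplus> m) \<otimes> u \<in> \<M>"
      by (rule M_mult'[OF O_add[OF subsetD[OF N(2) c(1)] M_imp_O[OF m(1)]] uM]) (use Suc.prems in simp)
    ultimately show ?case by blast
  qed
  then obtain m where m: "m \<in> \<M>" "poly_value R n c x \<otimes> u [^] n = c n \<oplus> m" by blast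
  then have "c n \<oplus> m = \<zero>" using c(3) u by simp
  then have "c n = \<ominus> m" using m M_closed c(1) NR minus_equality by (metis le_refl subsetD)
  then have "c n \<in> \<M>" using M_minus m by simp
  then show False using c(1)[of n] c(2) N(3) by auto
qed

end

text \<open>Choosing a cross section other than \<open>mon\<close> amounts to a change of variables.\<close>

definition (in monomial_field) cross_section :: "('g \<Rightarrow> 'a) \<Rightarrow> bool" where
  "cross_section Y \<longleftrightarrow> (\<forall>a. Y a \<in> carrier R - {\<zero>} \<and> ord (Y a) = a) \<and> (\<forall>a b. Y (a + b) = Y a \<otimes> Y b)"

context monomial_field
begin

lemma mon_cross_section: "cross_section mon"
  unfolding cross_section_def using mon_nonzero ord_mon mon_add by auto

sublocale iota: ring_hom_ring k R \<iota>
  by (rule ring_hom_ringI2) (auto intro: iota_hom coef.ring_axioms ring_axioms)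

lemma iota_closed [simp]: "c \<in> carrier k \<Longrightarrow> \<iota> c \<in> carrier R"
  by simp

lemma iota_nonzero: "c \<in> carrier k \<Longrightarrow> c \<noteq> \<zero>\<^bsub>k\<^esub> \<Longrightarrow> \<iota> c \<noteq> \<zero>"
proof
  assume c: "c \<in> carrier k" "c \<noteq> \<zero>\<^bsub>k\<^esub>" "\<iota> c = \<zero>"
  then have "c \<otimes>\<^bsub>k\<^esub> inv\<^bsub>k\<^esub> c = \<one>\<^bsub>k\<^esub>" "inv\<^bsub>k\<^esub> c \<in> carrier k" using coef.field_Units by auto
  then have "\<iota> c \<otimes> \<iota> (inv\<^bsub>k\<^esub> c) = \<one>" using c by (metis iota.hom_mult iota.hom_one)
  then show False using c \<open>inv\<^bsub>k\<^esub> c \<in> carrier k\<close> one_neq_zero by simp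
qed

lemma iota_eq_zero: "c \<in> carrier k \<Longrightarrow> \<iota> c = \<zero> \<longleftrightarrow> c = \<zero>\<^bsub>k\<^esub>"
  using iota_nonzero by auto

lemma nat_mult_nonzero:
  assumes "(n::nat) > 0" "x \<in> carrier R" "x \<noteq> \<zero>"
  shows "[n] \<cdot> x \<noteq> \<zero>"
proof -
  have "\<iota> ([n] \<cdot>\<^bsub>k\<^esub> \<one>\<^bsub>k\<^esub>) = [n] \<cdot> \<one>" by (induction n) auto
  then have "[n] \<cdot> \<one> \<noteq> \<zero>" using iota_nonzero[of "[n] \<cdot>\<^bsub>k\<^esub> \<one>\<^bsub>k\<^esub>"] char_0[OF assms(1)] by simp
  moreover have "[n] \<cdot> x = [n] \<cdot> \<one> \<otimes> x" using assms add_pow_ldistr[of \<one> x n] by simp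
  ultimately show ?thesis using assms integral_iff by simp
qed

text \<open>For the group \<open>D\<close> spanned by the values of some variables, the following are the ring of Laurent
  polynomials in these variables, the field of rational functions, and its relative algebraic
  closure.\<close>

definition monomial_ring :: "('g \<Rightarrow> 'a) \<Rightarrow> 'g set \<Rightarrow> 'a set" where
  "monomial_ring Y D = span_of D (\<lambda>_. \<iota> ` carrier k) Y"

definition fraction_field :: "('g \<Rightarrow> 'a) \<Rightarrow> 'g set \<Rightarrow> 'a set" where
  "fraction_field Y D = quot_field R (monomial_ring Y D)"

definition algebraic_hull :: "('g \<Rightarrow> 'a) \<Rightarrow> 'g set \<Rightarrow> 'a set" where
  "algebraic_hull Y D = {x \<in> carrier R. algebraic (fraction_field Y D) x}"

lemma image_subgroup: "additive_subgroup (\<iota> ` carrier k) R"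
proof (rule additive_subgroupI, rule add.subgroupI)
  show "\<iota> ` carrier k \<noteq> {}" using coef.one_closed by auto
  show "\<ominus> a \<in> \<iota> ` carrier k" if a: "a \<in> \<iota> ` carrier k" for a
  proof -
    from a obtain c where "c \<in> carrier k" "a = \<iota> c" by auto
    then have "\<ominus> a = \<iota> (\<ominus>\<^bsub>k\<^esub> c)" "\<ominus>\<^bsub>k\<^esub> c \<in> carrier k" by auto
    then show ?thesis by blast
  qed
  show "a \<oplus> b \<in> \<iota> ` carrier k" if ab: "a \<in> \<iota> ` carrier k" "b \<in> \<iota> ` carrier k" for a b
  proof -
    from ab obtain c d where "c \<in> carrier k" "a = \<iota> c" "d \<in> carrier k" "b = \<iota> d" by auto
    then have "a \<oplus> b = \<iota> (c \<oplus>\<^bsub>k\<^esub> d)" "c \<oplus>\<^bsub>k\<^esub> d \<in> carrier k" by auto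
    then show ?thesis by blast
  qed
qed auto

end

locale coarse_section = monomial_field R ord k \<iota> mon + coarsening R ord D
  for R :: "('a, 'r) ring_scheme" (structure) and ord :: "'a \<Rightarrow> 'g::linordered_ab_group_add"
    and k :: "('k, 'm) ring_scheme" and \<iota> :: "'k \<Rightarrow> 'a" and mon and D +
  fixes Y assumes Y: "cross_section Y"
begin

abbreviation "A \<equiv> monomial_ring Y D"
abbreviation "F \<equiv> fraction_field Y D"
abbreviation "K \<equiv> algebraic_hull Y D"

lemma Y_closed: "Y a \<in> carrier R" and Y_nonzero: "Y a \<noteq> \<zero>" and ord_Y: "ord (Y a) = a"
  and Y_add: "Y (a + b) = Y a \<otimes> Y b"
  using Y unfolding cross_section_def by auto

lemma Y_zero: "Y 0 = \<one>"
proof -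
  have "Y 0 \<otimes> Y 0 = Y 0 \<otimes> \<one>" using Y_add[of 0 0, symmetric] Y_closed[of 0] by simp
  then show ?thesis using m_lcancel[OF Y_nonzero Y_closed Y_closed one_closed] by simp
qed

sublocale graded_span R D "\<lambda>_. \<iota> ` carrier k" Y
  by (rule graded_span.intro[OF is_cring], unfold graded_span_axioms_def)
    (use image_subgroup Y_closed in simp)

lemma A_closed: "z \<in> A \<Longrightarrow> z \<in> carrier R"
  unfolding monomial_ring_def by (rule span_closed)

lemma A_add: "y \<in> A \<Longrightarrow> z \<in> A \<Longrightarrow> y \<oplus> z \<in> A"
  unfolding monomial_ring_def by (rule span_add)

lemma A_minus: "z \<in> A \<Longrightarrow> \<ominus> z \<in> A"
  unfolding monomial_ring_def by (rule span_minus)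

lemma A_term: "c \<in> carrier k \<Longrightarrow> a \<in> D \<Longrightarrow> \<iota> c \<otimes> Y a \<in> A"
  unfolding monomial_ring_def by (rule span_term) auto

lemma A_mult: "y \<in> A \<Longrightarrow> z \<in> A \<Longrightarrow> y \<otimes> z \<in> A"
  unfolding monomial_ring_def
proof (rule span_mult)
  fix a b c d assume ab: "a \<in> D" "b \<in> D" and "c \<in> \<iota> ` carrier k" "d \<in> \<iota> ` carrier k"
  then obtain p q where pq: "p \<in> carrier k" "q \<in> carrier k" "c = \<iota> p" "d = \<iota> q" by auto
  have "(c \<otimes> Y a) \<otimes> (d \<otimes> Y b) = (c \<otimes> d) \<otimes> (Y a \<otimes> Y b)"
    using pq Y_closed[of a] Y_closed[of b] iota_closed by algebra
  also have "\<dots> = \<iota> (p \<otimes>\<^bsub>k\<^esub> q) \<otimes> Y (a + b)" using pq Y_add by simp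
  also have "\<dots> \<in> S" using pq by (intro span_term D_plus ab imageI coef.m_closed)
  finally show "(c \<otimes> Y a) \<otimes> (d \<otimes> Y b) \<in> S" .
qed

lemma A_iota: "c \<in> carrier k \<Longrightarrow> \<iota> c \<in> A"
  using A_term[OF _ D_zero, of c] Y_zero by simp

lemma A_Y: "a \<in> D \<Longrightarrow> Y a \<in> A"
  using A_term[of "\<one>\<^bsub>k\<^esub>" a] Y_closed by simp

lemma A_representation:
  assumes "z \<in> A"
  shows "\<exists>P c. finite P \<and> P \<subseteq> D \<and> (\<forall>a\<in>P. c a \<in> carrier k - {\<zero>\<^bsub>k\<^esub>}) \<and> z = (\<Oplus>a\<in>P. \<iota> (c a) \<otimes> Y a)"
proof -
  obtain P c where P: "finite P" "P \<subseteq> D" "\<forall>a\<in>P. c a \<in> \<iota> ` carrier k \<and> c a \<noteq> \<zero>"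
      "z = (\<Oplus>a\<in>P. c a \<otimes> Y a)"
    using span_representation assms unfolding monomial_ring_def by metis
  have "\<forall>a\<in>P. \<exists>d\<in>carrier k - {\<zero>\<^bsub>k\<^esub>}. c a = \<iota> d"
  proof
    fix a assume "a \<in> P"
    then have ca: "c a \<in> \<iota> ` carrier k" "c a \<noteq> \<zero>" using P(3) by auto
    then obtain d where d: "d \<in> carrier k" "c a = \<iota> d" by (elim imageE)
    moreover have "d \<noteq> \<zero>\<^bsub>k\<^esub>" using d ca(2) iota.hom_zero by auto
    ultimately show "\<exists>d\<in>carrier k - {\<zero>\<^bsub>k\<^esub>}. c a = \<iota> d" by (intro bexI[of _ d]) simp_all
  qed
  then have "\<exists>d. \<forall>a\<in>P. d a \<in> carrier k - {\<zero>\<^bsub>k\<^esub>} \<and> c a = \<iota> (d a)"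
    unfolding bex_simps Bex_def by (intro bchoice) simp
  then obtain d where d: "\<forall>a\<in>P. d a \<in> carrier k - {\<zero>\<^bsub>k\<^esub>} \<and> c a = \<iota> (d a)" by (elim exE)
  have "z = (\<Oplus>a\<in>P. \<iota> (d a) \<otimes> Y a)"
    unfolding P(4) by (rule finsum_cong') (use d Y_closed in auto)
  then show ?thesis using P(1,2) d by blast
qed

lemma ord_term: "c \<in> carrier k - {\<zero>\<^bsub>k\<^esub>} \<Longrightarrow> \<iota> c \<otimes> Y a \<in> carrier R - {\<zero>} \<and> ord (\<iota> c \<otimes> Y a) = a"
  using ord_mult[of "\<iota> c" "Y a"] ord_iota iota_nonzero Y_closed Y_nonzero ord_Y by auto

text \<open>The monomials of a Laurent polynomial have different values.\<close>

lemma ord_A: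
  assumes "z \<in> A" "z \<noteq> \<zero>" shows "ord z \<in> D"
proof -
  obtain P c where P: "finite P" "P \<subseteq> D" "\<forall>a\<in>P. c a \<in> carrier k - {\<zero>\<^bsub>k\<^esub>}"
      "z = (\<Oplus>a\<in>P. \<iota> (c a) \<otimes> Y a)"
    using A_representation[OF assms(1)] by blast
  have t: "\<iota> (c a) \<otimes> Y a \<in> carrier R - {\<zero>} \<and> ord (\<iota> (c a) \<otimes> Y a) = a" if "a \<in> P" for a
    using ord_term P(3) that by blast
  have "P \<noteq> {}" using P(4) assms(2) by auto
  then have "\<exists>a\<in>P. ord z = ord (\<iota> (c a) \<otimes> Y a)"
    unfolding P(4) using ord_finsum_distinct[of P "\<lambda>a. \<iota> (c a) \<otimes> Y a"] P(1) t
    by (auto simp: inj_on_def)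
  then show ?thesis using t P(2) by auto
qed

lemma F_subfield: "subfield F R" and A_subset_F: "A \<subseteq> F"
proof -
  have "\<one> \<in> A" using A_Y[OF D_zero] Y_zero by simp
  then show "subfield F R" "A \<subseteq> F" unfolding fraction_field_def
    using quot_field_subfield[of A \<one>] A_closed A_add A_mult A_minus one_neq_zero by auto
qed

lemma F_units: "F \<subseteq> \<O>" and F_inter_M: "F \<inter> \<M> \<subseteq> {\<zero>}"
proof -
  have A: "z \<in> \<O> \<and> z \<notin> \<M>" if "z \<in> A" "z \<noteq> \<zero>" for z
    using ord_A[OF that] A_closed[OF that(1)] that(2) by (auto simp: coarse_ring_def coarse_ideal_def)
  have "x \<in> \<O> \<and> (x \<in> \<M> \<longrightarrow> x = \<zero>)" if "x \<in> F" for x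
  proof -
    obtain a b where ab: "a \<in> A" "b \<in> A" "b \<noteq> \<zero>" "x = a \<otimes> inv b"
      using \<open>x \<in> F\<close> unfolding fraction_field_def quot_field_def by blast
    note b = A[OF ab(2,3)]
    note ib = unit_inv[OF b[THEN conjunct1] b[THEN conjunct2]]
    show ?thesis
    proof (cases "a = \<zero>")
      case True
      then show ?thesis using ab(4) O_closed[OF ib(2)] zero_O by simp
    next
      case False
      then show ?thesis
        using A[OF ab(1)] ib O_mult[of a "inv b"] not_M_mult[of a "inv b"] ab(4) by blast
    qed
  qed
  then show "F \<subseteq> \<O>" "F \<inter> \<M> \<subseteq> {\<zero>}" by auto
qed

lemma K_subfield: "subfield K R"
  unfolding algebraic_hull_def using subfield_of_algebraics[OF F_subfield] unfolding over_def .

lemma F_subset_K: "F \<subseteq> K"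
  unfolding algebraic_hull_def using algebraic_self[OF subfieldE(1)[OF F_subfield]] subfieldE(3)[OF F_subfield]
  unfolding over_def by auto

lemma K_subset_O: "K \<subseteq> \<O>"
  unfolding algebraic_hull_def using algebraic_over_units[OF F_subfield F_units F_inter_M] by auto

lemma K_inter_M: "K \<inter> \<M> \<subseteq> {\<zero>}"
proof
  fix x assume x: "x \<in> K \<inter> \<M>"
  show "x \<in> {\<zero>}"
  proof (rule ccontr)
    assume "x \<notin> {\<zero>}"
    then have i: "inv x \<in> K" "x \<otimes> inv x = \<one>" using subfield_m_inv[OF K_subfield, of x] x by auto
    then have "x \<otimes> inv x \<in> \<M>" using M_mult x K_subset_O by blast
    then show False using i one_not_M by simp
  qed
qed

lemma K_ord: assumes "x \<in> K" "x \<noteq> \<zero>" shows "\<exists>d\<in>D. d \<le> ord x" "\<exists>d\<in>D. ord x \<le> d"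
proof -
  have "x \<in> \<O>" "x \<notin> \<M>" using assms K_subset_O K_inter_M by auto
  then show "\<exists>d\<in>D. d \<le> ord x" "\<exists>d\<in>D. ord x \<le> d"
    using assms(2) by (auto simp: coarse_ring_def coarse_ideal_def not_less)
qed

lemma K_algebraic_closed: "x \<in> carrier R \<Longrightarrow> algebraic K x \<Longrightarrow> x \<in> K"
  using algebraic_trans[OF F_subfield] unfolding algebraic_hull_def by simp

lemma K_iota: "c \<in> carrier k \<Longrightarrow> \<iota> c \<in> K" and K_Y: "a \<in> D \<Longrightarrow> Y a \<in> K"
  using A_iota A_Y A_subset_F F_subset_K by auto

end

context monomial_field
begin

lemma monomial_ring_mono: "D \<subseteq> D' \<Longrightarrow> monomial_ring Y D \<subseteq> monomial_ring Y D'"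
proof
  fix z assume D: "D \<subseteq> D'" and "z \<in> monomial_ring Y D"
  then have "z \<in> span_of D (\<lambda>_. \<iota> ` carrier k) Y" unfolding monomial_ring_def by simp
  then show "z \<in> monomial_ring Y D'" unfolding monomial_ring_def
    by (induction rule: span_of.induct) (use D in \<open>auto intro: span_of.intros\<close>)
qed

lemma fraction_field_mono: "D \<subseteq> D' \<Longrightarrow> fraction_field Y D \<subseteq> fraction_field Y D'"
  unfolding fraction_field_def quot_field_def using monomial_ring_mono by blast

lemma algebraic_hull_mono: "D \<subseteq> D' \<Longrightarrow> algebraic_hull Y D \<subseteq> algebraic_hull Y D'"
  unfolding algebraic_hull_def using algebraic_mono[OF fraction_field_mono] unfolding over_def by auto

end

section \<open>The relative algebraic closure of the monomials\<close>

locale henselian_monomial_field = monomial_field R ord k \<iota> mon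
  for R :: "('a, 'r) ring_scheme" (structure) and ord :: "'a \<Rightarrow> 'g::linordered_ab_group_add"
    and k :: "('k, 'm) ring_scheme" and \<iota> :: "'k \<Rightarrow> 'a" and mon +
  assumes Hensel: "\<lbrakk>coarsening R ord D; \<And>i. i \<le> n \<Longrightarrow> c i \<in> coarse_ring D; b \<in> coarse_ring D;
      poly_value R n c b \<in> coarse_ideal D; poly_deriv_value R n c b \<notin> coarse_ideal D\<rbrakk>
      \<Longrightarrow> \<exists>a\<in>carrier R. poly_value R n c a = \<zero> \<and> a \<ominus> b \<in> coarse_ideal D"
    and algebraic_over_monomials:
      "x \<in> carrier R \<Longrightarrow> algebraic (fraction_field mon UNIV) x"

text \<open>Roots of polynomials over a relatively algebraically closed subfield lie in this subfield, so
  Hensel's Lemma is inherited. So are derivations mapping the monomials to multiples of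
  themselves, since they map Laurent polynomials to Laurent polynomials.\<close>

lemma (in monomial_field) henselian_hull:
  assumes sc: "spherically_complete R ord"
  shows "henselian_monomial_field (R\<lparr>carrier := algebraic_hull mon UNIV\<rparr>) ord k \<iota> mon"
proof -
  interpret coarse_section R ord k \<iota> mon UNIV mon
    by unfold_locales (auto simp: mon_cross_section)
  define L where "L = K"
  have L: "subfield L R" unfolding L_def by (rule K_subfield)
  let ?L = "R\<lparr>carrier := L\<rparr>"
  note incl = sub_incl[OF L]
  interpret L: field ?L by (rule sub_field[OF L])
  interpret L: ord_ring ?L ord
    by unfold_locales (use ord_add' ord_mult incl one_neq_zero in auto)
  have ge_iff: "L.ge x a \<longleftrightarrow> ge x a" and gt_iff: "L.gt x a \<longleftrightarrow> gt x a" for x a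
    unfolding L.ge_def ge_def L.gt_def gt_def by auto
  have hom: "\<iota> \<in> ring_hom k ?L"
    using iota_hom K_iota unfolding ring_hom_def L_def by auto
  have minus: "x \<ominus>\<^bsub>?L\<^esub> y = x \<ominus> y" if "x \<in> L" "y \<in> L" for x y using sub_minus[OF L that] .
  interpret L: monomial_field ?L ord k \<iota> mon
  proof
    show "\<iota> \<in> ring_hom k ?L" by (rule hom)
    show "mon a \<in> carrier ?L - {\<zero>\<^bsub>?L\<^esub>}" for a using K_Y[of a] Y_nonzero[of a] unfolding L_def by auto
    show "mon (a + b) = mon a \<otimes>\<^bsub>?L\<^esub> mon b" for a b using mon_add by simp
    show "\<exists>c\<in>carrier k. L.gt (x \<ominus>\<^bsub>?L\<^esub> \<iota> c) 0" if x: "x \<in> carrier ?L" "L.ge x 0" for x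
    proof -
      obtain c where c: "c \<in> carrier k" "gt (x \<ominus> \<iota> c) 0"
        using residue_exists[of x] x incl ge_iff by auto
      have "x \<ominus>\<^bsub>?L\<^esub> \<iota> c = x \<ominus> \<iota> c"
        using x(1) K_iota[OF c(1)] by (intro minus) (auto simp: L_def)
      then show ?thesis using c gt_iff by (intro bexI[of _ c]) auto
    qed
    fix \<chi> :: "'g \<Rightarrow> int" assume \<chi>: "\<And>a b. \<chi> (a + b) = \<chi> a + \<chi> b"
    obtain D where D: "derivation D" "\<And>c. c \<in> carrier k \<Longrightarrow> D (\<iota> c) = \<zero>"
        "\<And>a. D (mon a) = \<iota> ([\<chi> a] \<cdot>\<^bsub>k\<^esub> \<one>\<^bsub>k\<^esub>) \<otimes> mon a"
      using derivation_exists[OF \<chi>] by blast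
    have DA: "D z \<in> A" if "z \<in> A" for z
      using that unfolding monomial_ring_def
    proof (induction rule: span_of.induct)
      case zero
      then show ?case using der_zero[OF D(1)] span_of.zero by simp
    next
      case (step a c z)
      obtain d where d: "d \<in> carrier k" "c = \<iota> d" using step(2) by auto
      define e where "e = [\<chi> a] \<cdot>\<^bsub>k\<^esub> \<one>\<^bsub>k\<^esub>"
      have e: "e \<in> carrier k" unfolding e_def by simp
      have zc: "z \<in> carrier R" using span_closed step(3) .
      have "D (c \<otimes> mon a \<oplus> z) = D (c \<otimes> mon a) \<oplus> D z"
        using der_add[OF D(1), of "c \<otimes> mon a" z] d zc Y_closed by simp
      also have "D (c \<otimes> mon a) = c \<otimes> (\<iota> e \<otimes> mon a)"
        using der_mult[OF D(1), of c "mon a"] D(2,3) d Y_closed e unfolding e_def by simp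
      also have "\<dots> = \<iota> (d \<otimes>\<^bsub>k\<^esub> e) \<otimes> mon a" using d e Y_closed by (simp add: m_assoc)
      finally have "D (c \<otimes> mon a \<oplus> z) = \<iota> (d \<otimes>\<^bsub>k\<^esub> e) \<otimes> mon a \<oplus> D z" .
      moreover have "\<iota> (d \<otimes>\<^bsub>k\<^esub> e) \<in> \<iota> ` carrier k" using d e by (intro imageI) simp
      ultimately show ?case using span_of.step[OF UNIV_I] step.IH by metis
    qed
    have DF: "D x \<in> F" if "x \<in> F" for x
    proof -
      obtain a b where ab: "a \<in> A" "b \<in> A" "b \<noteq> \<zero>" "x = a \<otimes> inv b"
        using \<open>x \<in> F\<close> unfolding fraction_field_def quot_field_def by blast
      have cl: "a \<in> carrier R" "b \<in> carrier R" using ab A_closed by auto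
      have F: "a \<in> F" "b \<in> F" "D a \<in> F" "D b \<in> F" using ab DA A_subset_F by auto
      have xc: "x \<in> carrier R" using \<open>x \<in> F\<close> subfieldE(3)[OF F_subfield] by auto
      have "x \<otimes> b = a" using ab cl field_Units by (simp add: m_assoc)
      then have "D x \<otimes> b \<oplus> x \<otimes> D b = D a" using der_mult[OF D(1) xc cl(2)] by simp
      moreover have "D x \<otimes> b = (D x \<otimes> b \<oplus> x \<otimes> D b) \<ominus> x \<otimes> D b"
        using xc cl der_closed[OF D(1) xc] der_closed[OF D(1) cl(2)] by algebra
      ultimately have "b \<otimes> D x = D a \<ominus> x \<otimes> D b"
        using cl der_closed[OF D(1) xc] m_comm by simp
      moreover have "D a \<ominus> x \<otimes> D b \<in> F" unfolding a_minus_def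
        using subringE(5-7)[OF subfieldE(1)[OF F_subfield]] F \<open>x \<in> F\<close> by auto
      ultimately show ?thesis
        using subfield_m_inv_simprule[OF F_subfield, of b "D x"] F ab(3) der_closed[OF D(1) xc] by simp
    qed
    have DL: "D x \<in> L" if "x \<in> L" for x
      unfolding L_def
      by (rule der_algebraic_closed[OF D(1) nat_mult_nonzero F_subfield DF K_subfield F_subset_K])
        (use that in \<open>auto simp: L_def algebraic_hull_def\<close>)
    have "L.derivation D" unfolding L.derivation_def
      using DL der_add[OF D(1)] der_mult[OF D(1)] incl by auto
    then show "\<exists>\<theta>. L.derivation \<theta> \<and> (\<forall>c\<in>carrier k. \<theta> (\<iota> c) = \<zero>\<^bsub>?L\<^esub>) \<and>
        (\<forall>a. \<theta> (mon a) = \<iota> ([\<chi> a] \<cdot>\<^bsub>k\<^esub> \<one>\<^bsub>k\<^esub>) \<otimes>\<^bsub>?L\<^esub> mon a)"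
      using D(2,3) by auto
  qed (use ord_iota ord_mon char_0 in auto)
  have fracL: "L.fraction_field mon UNIV = F"
  proof -
    have "L.monomial_ring mon UNIV = A"
      unfolding L.monomial_ring_def monomial_ring_def by (rule sub_span_of[OF L])
    then show ?thesis unfolding L.fraction_field_def fraction_field_def
      using sub_quot_field[OF L, of A] A_subset_F F_subset_K unfolding L_def by simp
  qed
  have cr: "L.coarse_ring D \<subseteq> coarse_ring D" and ci: "x \<in> L \<Longrightarrow> x \<in> L.coarse_ideal D \<longleftrightarrow> x \<in> coarse_ideal D"
    for D x
    unfolding L.coarse_ring_def coarse_ring_def L.coarse_ideal_def coarse_ideal_def using incl by auto
  have crL: "x \<in> L" if "x \<in> L.coarse_ring D" for D x using that unfolding L.coarse_ring_def by simp
  have "henselian_monomial_field ?L ord k \<iota> mon"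
  proof
    fix x assume "x \<in> carrier ?L"
    then have "algebraic F x" unfolding L_def algebraic_hull_def by simp
    then show "L.algebraic (L.fraction_field mon UNIV) x"
      unfolding fracL using algebraic_consistent[OF subfieldE(1)[OF L]] unfolding over_def by metis
  next
    fix D n c b
    assume D: "coarsening ?L ord D" and c: "\<And>i. i \<le> n \<Longrightarrow> c i \<in> L.coarse_ring D"
      and b: "b \<in> L.coarse_ring D"
      and p: "poly_value ?L n c b \<in> L.coarse_ideal D" "poly_deriv_value ?L n c b \<notin> L.coarse_ideal D"
    have D': "coarsening R ord D"
      using coarsening.D_zero[OF D] coarsening.D_diff[OF D] by unfold_locales
    have cL: "\<And>i. i \<le> n \<Longrightarrow> c i \<in> L" and bL: "b \<in> L" using c b crL by auto
    note pv = sub_poly_value[OF L cL bL]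
    have pL: "poly_value R n c b \<in> L" "poly_deriv_value R n c b \<in> L"
      using L.poly_value_closed[of n c b] L.poly_deriv_value_closed[of n c b] cL bL pv by auto
    have p1: "poly_value R n c b \<in> coarse_ideal D" using p(1) ci[OF pL(1)] pv by simp
    have unit: "poly_deriv_value R n c b \<notin> coarse_ideal D" using p(2) ci[OF pL(2)] pv by simp
    obtain a where a: "a \<in> carrier R" "poly_value R n c a = \<zero>" "a \<ominus> b \<in> coarse_ideal D"
      using spherically_complete.Hensel_coarse[OF sc D' subsetD[OF cr c] subsetD[OF cr b] p1 unit]
      by auto
    have "\<exists>i\<le>n. c i \<noteq> \<zero>"
    proof (rule ccontr)
      assume "\<not> ?thesis"
      then have "poly_deriv_value R n c b = \<zero>" unfolding poly_deriv_value_def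
        using incl[OF bL] by (intro add.finprod_one_eqI) auto
      then show False using unit coarsening.zero_M[OF D'] by simp
    qed
    then obtain i where "i \<le> n" "c i \<noteq> \<zero>" by blast
    then obtain m where m: "m \<le> n" "c m \<noteq> \<zero>" "poly_value R m c a = \<zero>"
      using poly_value_trim[of n c a i] cL incl a(1,2) by auto
    have "root_over L a" unfolding root_over_def using m cL by (intro exI[of _ m] exI[of _ c]) auto
    then have aL: "a \<in> L" using algebraic_iff_root[OF L a(1)] K_algebraic_closed[OF a(1)] unfolding L_def by simp
    have "poly_value ?L n c a = \<zero>\<^bsub>?L\<^esub>" using sub_poly_value(1)[OF L cL aL] a(2) by simp
    moreover have "a \<ominus>\<^bsub>?L\<^esub> b \<in> L.coarse_ideal D"
      using a(3) ci[of "a \<ominus> b" D] minus[OF aL bL] L.minus_closed[of a b] aL bL by simp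
    ultimately show "\<exists>a\<in>carrier ?L. poly_value ?L n c a = \<zero>\<^bsub>?L\<^esub> \<and> a \<ominus>\<^bsub>?L\<^esub> b \<in> L.coarse_ideal D"
      using aL by auto
  qed
  then show ?thesis unfolding L_def .
qed

section \<open>The lexicographic value group\<close>

abbreviation "coord \<equiv> Poly_Mapping.lookup"

text \<open>\<open>multiple t c\<close> is \<open>c\<close> times the generator with index \<open>t\<close>.\<close>

abbreviation "multiple \<equiv> Poly_Mapping.single"

text \<open>Exponents are compared at the least index at which they differ. Hence smaller indices dominate, and \<open>below t\<close> is the convex subgroup of all exponents
  that are infinitely small compared to the generator \<open>gen t\<close>.\<close>

lemma poly_mapping_less:
  fixes a b :: "'i::linorder \<Rightarrow>\<^sub>0 'b::{zero, linorder}"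
  shows "a < b \<longleftrightarrow> (\<exists>t. coord a t < coord b t \<and> (\<forall>s<t. coord a s = coord b s))"
  by transfer (simp add: less_fun_def)

definition below :: "'i::linorder \<Rightarrow> ('i \<Rightarrow>\<^sub>0 int) set" where
  "below t = {a. \<forall>s\<le>t. coord a s = 0}"

abbreviation gen :: "'i \<Rightarrow> ('i \<Rightarrow>\<^sub>0 int)" where "gen t \<equiv> multiple t 1"

lemma below_zero: "0 \<in> below t" and below_diff: "a \<in> below t \<Longrightarrow> b \<in> below t \<Longrightarrow> a - b \<in> below t"
  by (auto simp: below_def lookup_minus)

lemma below_add: "a \<in> below t \<Longrightarrow> b \<in> below t \<Longrightarrow> a + b \<in> below t"
  by (auto simp: below_def lookup_add)

lemma below_uminus: "a \<in> below t \<Longrightarrow> - a \<in> below t"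
  by (auto simp: below_def)

lemma single_below: "t < s \<Longrightarrow> multiple s c \<in> below t"
  by (auto simp: below_def lookup_single when_def)

lemma below_mono: "s \<le> t \<Longrightarrow> below t \<subseteq> below s"
  by (auto simp: below_def)

lemma leading_index:
  assumes "a \<noteq> (0 :: 'i::linorder \<Rightarrow>\<^sub>0 int)"
  obtains t where "coord a t \<noteq> 0" "\<And>s. s < t \<Longrightarrow> coord a s = 0"
proof -
  have fin: "finite (Poly_Mapping.keys a)" and ne: "Poly_Mapping.keys a \<noteq> {}" using assms by auto
  have "coord a (Min (Poly_Mapping.keys a)) \<noteq> 0"
    using Min_in[OF fin ne] by (simp add: in_keys_iff)
  moreover have "coord a s = 0" if "s < Min (Poly_Mapping.keys a)" for s
    using that Min_le[OF fin, of s] by (meson in_keys_iff not_le)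
  ultimately show ?thesis using that by blast
qed

lemma leading_pos:
  assumes "\<And>s. s < t \<Longrightarrow> coord a s = 0" "coord a t > (0::int)"
  shows "a > 0"
  unfolding poly_mapping_less by (rule exI[of _ t]) (use assms in auto)

lemma leading_neg:
  assumes "\<And>s. s < t \<Longrightarrow> coord a s = 0" "coord a t < (0::int)"
  shows "a < 0"
  unfolding poly_mapping_less by (rule exI[of _ t]) (use assms in auto)

text \<open>Subtracting an element of \<open>below t\<close> does not change the coordinates that decide about the sign.\<close>

lemma below_less:
  assumes d: "d \<in> below t" and a: "\<And>r. r < s \<Longrightarrow> coord a r = 0" "coord a s > 0" and s: "s \<le> t"
  shows "d < a"
proof -
  have "coord (a - d) r = 0" if "r < s" for r using that a d s by (auto simp: lookup_minus below_def)
  moreover have "coord (a - d) s > 0" using a(2) d s by (auto simp: lookup_minus below_def)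
  ultimately have "a - d > 0" by (rule leading_pos)
  then show ?thesis by simp
qed

lemma below_less_gen: "d \<in> below t \<Longrightarrow> d < gen t"
  by (rule below_less[of d t t]) (auto simp: lookup_single when_def)

lemma below_convex:
  assumes "d \<in> below t" "d' \<in> below t" "d \<le> a" "a \<le> d'"
  shows "a \<in> below t"
proof (cases "a = 0")
  case False
  then obtain s where s: "coord a s \<noteq> 0" "\<And>r. r < s \<Longrightarrow> coord a r = 0" using leading_index by blast
  have "t < s"
  proof (rule ccontr)
    assume "\<not> t < s"
    then have st: "s \<le> t" by simp
    show False
    proof (cases "coord a s > 0")
      case True
      then show False using below_less[OF assms(2) s(2) True st] assms(4) by simp
    next
      case False
      then have "coord (- a) s > 0" "\<And>r. r < s \<Longrightarrow> coord (- a) r = 0" using s by auto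
      then have "- d < - a" using below_less[OF below_uminus[OF assms(1)], of s "- a"] st by blast
      then show False using assms(3) by simp
    qed
  qed
  then show ?thesis using s(2) by (auto simp: below_def)
qed (simp add: below_zero)

text \<open>Coordinates are integers, so \<open>gen t\<close> is a least element above \<open>below t\<close>, up to elements of \<open>below t\<close>.
  This is why a pole whose order has been lowered has lost at least one full power of the variable.\<close>

lemma above_below_discrete:
  assumes "\<And>d. d \<in> below t \<Longrightarrow> d < a"
  shows "\<exists>d\<in>below t. d \<le> a - gen t"
proof -
  have pos: "0 < a" using assms[OF below_zero] .
  then obtain s where s: "coord a s \<noteq> 0" "\<And>r. r < s \<Longrightarrow> coord a r = 0"
    using leading_index[of a] by auto
  have sp: "coord a s > 0"
  proof (rule ccontr)
    assume "\<not> coord a s > 0"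
    then have "a < 0" using s by (intro leading_neg[of s]) auto
    then show False using pos by simp
  qed
  have st: "s \<le> t"
  proof (rule ccontr)
    assume "\<not> s \<le> t"
    then have "a \<in> below t" using s(2) by (auto simp: below_def)
    then show False using assms by blast
  qed
  show ?thesis
  proof (cases "s = t \<and> coord a t = 1")
    case True
    then have "a - gen t \<in> below t"
      using s(2) by (auto simp: below_def lookup_minus lookup_single when_def order_le_less)
    then show ?thesis by blast
  next
    case False
    have "0 < a - gen t"
    proof (rule leading_pos)
      show "coord (a - gen t) r = 0" if "r < s" for r
        using that s(2) st by (auto simp: lookup_minus lookup_single when_def)
      show "coord (a - gen t) s > 0"
        using sp st False by (auto simp: lookup_minus lookup_single when_def)
    qed
    then show ?thesis using below_zero by (intro bexI[of _ 0]) auto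
  qed
qed

text \<open>The index \<open>t\<close> and the number \<open>m\<close> are the place and the order of the dominant pole of an element of
  value \<open>a\<close>.\<close>

lemma negative_decomposition:
  assumes "a < (0 :: 'i::linorder \<Rightarrow>\<^sub>0 int)"
  obtains t m where "(m::nat) > 0" "a + multiple t (int m) \<in> below t" "coord a t \<noteq> 0"
proof -
  obtain t where t: "coord a t \<noteq> 0" "\<And>r. r < t \<Longrightarrow> coord a r = 0"
    using leading_index[of a] assms by auto
  have "coord a t < 0"
  proof (rule ccontr)
    assume "\<not> coord a t < 0"
    then have "a > 0" using t by (intro leading_pos[of t]) auto
    then show False using assms by simp
  qed
  then have "nat (- coord a t) > 0"
    "a + multiple t (int (nat (- coord a t))) \<in> below t"
    using t by (auto simp: below_def lookup_add lookup_single when_def order_le_less)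
  then show ?thesis using that t(1) by blast
qed

lemma value_group_induct:
  assumes gen: "\<And>t. t \<in> Poly_Mapping.keys a \<Longrightarrow> P (gen t)" and zero: "P 0"
    and add: "\<And>a b. P a \<Longrightarrow> P b \<Longrightarrow> P (a + b)" and uminus: "\<And>a. P a \<Longrightarrow> P (- a)"
  shows "P (a :: 'i \<Rightarrow>\<^sub>0 int)"
proof -
  have nat: "P (multiple t (int n))" if "P (gen t)" for t n
  proof (induction n)
    case (Suc n)
    have "multiple t (int (Suc n)) = gen t + multiple t (int n)"
      by (simp add: single_add[symmetric])
    then show ?case using add[OF that Suc] by simp
  qed (simp add: zero)
  have int: "P (multiple t c)" if "P (gen t)" for t c
  proof (cases "c \<ge> 0")
    case True
    then show ?thesis using nat[OF that, of "nat c"] by simp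
  next
    case False
    then have "multiple t c = - multiple t (int (nat (- c)))"
      by (simp add: single_uminus[symmetric])
    then show ?thesis using uminus[OF nat[OF that, of "nat (- c)"]] by simp
  qed
  have sum: "finite T \<Longrightarrow> (\<And>t. t \<in> T \<Longrightarrow> P (gen t)) \<Longrightarrow>
      P (\<Sum>t\<in>T. multiple t (coord a t))" for T
    by (induction T rule: finite_induct) (auto intro: zero add int)
  have "a = (\<Sum>t\<in>Poly_Mapping.keys a. multiple t (coord a t))"
  proof (rule poly_mapping_eqI)
    fix s
    show "coord a s = coord (\<Sum>t\<in>Poly_Mapping.keys a. multiple t (coord a t)) s"
      by (auto simp: lookup_sum lookup_single when_def in_keys_iff)
  qed
  then show ?thesis using sum[of "Poly_Mapping.keys a"] gen by simp
qed

section \<open>Additive complements\<close>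

locale ladder_field = henselian_monomial_field R ord k \<iota> mon
  for R :: "('a, 'r) ring_scheme" (structure) and ord :: "'a \<Rightarrow> ('i::linorder \<Rightarrow>\<^sub>0 int)"
    and k :: "('k, 'm) ring_scheme" and \<iota> :: "'k \<Rightarrow> 'a" and mon +
  assumes wf_index: "wf {(s :: 'i, t). t < s}" and unbounded: "\<exists>s. s < (t :: 'i)"

text \<open>The second assumption says that the original variables dominated by \<open>t\<close> have the same residues,
  with respect to the coarsening given by \<open>below t\<close>, as elements of the field obtained from the changed variables.
  It is what is needed to pass from residues algebraic over the former to residues algebraic over
  the latter.\<close>

locale ladder = ladder_field R ord k \<iota> mon
  for R :: "('a, 'r) ring_scheme" (structure) and ord :: "'a \<Rightarrow> ('i::linorder \<Rightarrow>\<^sub>0 int)"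
    and k :: "('k, 'm) ring_scheme" and \<iota> :: "'k \<Rightarrow> 'a" and mon +
  fixes Y assumes Y: "cross_section Y"
    and mon_approx: "t < s \<Longrightarrow> \<exists>c\<in>algebraic_hull Y (below t). mon (gen s) \<ominus> c \<in> coarse_ideal (below t)"
begin

abbreviation "KK t \<equiv> algebraic_hull Y (below t)"

lemma coarsening_below: "coarsening R ord (below t)"
  by unfold_locales (auto simp: below_zero below_diff)

lemma section_below: "coarse_section R ord k \<iota> mon (below t) Y"
  by (intro coarse_section.intro coarsening_below coarse_section_axioms.intro Y monomial_field_axioms)

lemma section_mon: "coarse_section R ord k \<iota> mon (below t) mon"
  by (intro coarse_section.intro coarsening_below coarse_section_axioms.intro mon_cross_section
      monomial_field_axioms)

lemma section_mon_UNIV: "coarse_section R ord k \<iota> mon UNIV mon"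
  by unfold_locales (auto simp: mon_cross_section)

text \<open>The residues of the elements of \<open>approx t\<close> are those that are represented in \<open>KK t\<close>. They turn out
  to be all residues; the first step is to show that they form a field containing the residues of
  all rational functions in the original variables.\<close>

definition approx :: "'i \<Rightarrow> 'a set" where
  "approx t = {z \<in> coarse_ring (below t). \<exists>c\<in>KK t. z \<ominus> c \<in> coarse_ideal (below t)}"

context
  fixes t :: 'i
begin

interpretation T: coarse_section R ord k \<iota> mon "below t" Y by (rule section_below)

private lemma Kc: "c \<in> KK t \<Longrightarrow> c \<in> carrier R" and KO: "c \<in> KK t \<Longrightarrow> c \<in> T.\<O>"
  using subfieldE(3)[OF T.K_subfield] T.K_subset_O by auto

private lemmas Ksr = subringE[OF subfieldE(1)[OF T.K_subfield]]

lemma K_approx: "c \<in> KK t \<Longrightarrow> c \<in> approx t"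
  unfolding approx_def using KO T.zero_M Kc by (auto intro!: bexI[of _ c] simp: a_minus_def r_neg)

lemma M_approx: "z \<in> T.\<M> \<Longrightarrow> z \<in> approx t"
  unfolding approx_def using T.M_imp_O T.M_closed Ksr(2)
  by (auto intro!: bexI[of _ \<zero>] simp: a_minus_def)

lemma approx_add: assumes "y \<in> approx t" "z \<in> approx t" shows "y \<oplus> z \<in> approx t"
proof -
  obtain c d where cd: "c \<in> KK t" "y \<ominus> c \<in> T.\<M>" "d \<in> KK t" "z \<ominus> d \<in> T.\<M>" "y \<in> T.\<O>" "z \<in> T.\<O>"
    using assms unfolding approx_def by auto
  have "(y \<oplus> z) \<ominus> (c \<oplus> d) = (y \<ominus> c) \<oplus> (z \<ominus> d)"
    using Kc[OF cd(1)] Kc[OF cd(3)] T.O_closed[OF cd(5)] T.O_closed[OF cd(6)] by algebra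
  then have "(y \<oplus> z) \<ominus> (c \<oplus> d) \<in> T.\<M>" using T.M_add cd by simp
  then show ?thesis unfolding approx_def using T.O_add cd Ksr(7) by blast
qed

lemma approx_mult: assumes "y \<in> approx t" "z \<in> approx t" shows "y \<otimes> z \<in> approx t"
proof -
  obtain c d where cd: "c \<in> KK t" "y \<ominus> c \<in> T.\<M>" "d \<in> KK t" "z \<ominus> d \<in> T.\<M>" "y \<in> T.\<O>" "z \<in> T.\<O>"
    using assms unfolding approx_def by auto
  have "(y \<otimes> z) \<ominus> (c \<otimes> d) = (y \<ominus> c) \<otimes> z \<oplus> c \<otimes> (z \<ominus> d)"
    using Kc[OF cd(1)] Kc[OF cd(3)] T.O_closed[OF cd(5)] T.O_closed[OF cd(6)] by algebra
  then have "(y \<otimes> z) \<ominus> (c \<otimes> d) \<in> T.\<M>"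
    using T.M_add[OF T.M_mult[OF cd(2,6)] T.M_mult'[OF KO[OF cd(1)] cd(4)]] by simp
  then show ?thesis unfolding approx_def using T.O_mult cd Ksr(6) by blast
qed

lemma approx_inv: assumes "z \<in> approx t" "z \<notin> T.\<M>" shows "inv z \<in> approx t"
proof -
  obtain c where c: "c \<in> KK t" "z \<ominus> c \<in> T.\<M>" and z: "z \<in> T.\<O>"
    using assms(1) unfolding approx_def by auto
  note zc = T.O_closed[OF z] and cc = Kc[OF c(1)]
  note iz = T.unit_inv[OF z assms(2)]
  have "z = (z \<ominus> c) \<oplus> c" using zc cc by algebra
  then have "c \<noteq> \<zero>" using assms(2) c(2) T.M_closed[OF c(2)] by auto
  then have ic: "inv c \<in> KK t" "c \<otimes> inv c = \<one>" using subfield_m_inv[OF T.K_subfield, of c] c(1) by auto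
  have "inv z \<ominus> inv c = \<ominus> ((z \<ominus> c) \<otimes> (inv z \<otimes> inv c))"
  proof -
    have "(z \<ominus> c) \<otimes> (inv z \<otimes> inv c) = (z \<otimes> inv z) \<otimes> inv c \<ominus> (c \<otimes> inv c) \<otimes> inv z"
      using zc cc T.O_closed[OF iz(2)] Kc[OF ic(1)] by algebra
    also have "\<dots> = inv c \<ominus> inv z" using iz(4) ic(2) T.O_closed[OF iz(2)] Kc[OF ic(1)] by simp
    finally show ?thesis using T.O_closed[OF iz(2)] Kc[OF ic(1)] by (simp add: a_minus_def minus_add a_comm)
  qed
  then have "inv z \<ominus> inv c \<in> T.\<M>"
    using T.M_minus[OF T.M_mult[OF c(2) T.O_mult[OF iz(2) KO[OF ic(1)]]]] by simp
  then show ?thesis unfolding approx_def using iz(2) ic(1) by blast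
qed

lemma mon_approx_below: assumes "a \<in> below t" shows "mon a \<in> approx t"
proof -
  interpret X: coarse_section R ord k \<iota> mon "below t" mon by (rule section_mon)
  have inO: "mon a \<in> T.\<O>" "mon a \<notin> T.\<M>" if "a \<in> below t" for a
    using that X.Y_closed[of a] X.ord_Y[of a] X.Y_nonzero[of a]
    by (auto simp: coarse_ring_def coarse_ideal_def)
  have "a \<in> below t \<and> mon a \<in> approx t"
  proof (rule value_group_induct)
    fix s assume s: "s \<in> Poly_Mapping.keys a"
    have ts: "t < s"
    proof (rule ccontr)
      assume "\<not> t < s"
      then have "coord a s = 0" using assms unfolding below_def by simp
      then show False using s by (simp add: in_keys_iff)
    qed
    then show "gen s \<in> below t \<and> mon (gen s) \<in> approx t"
      using mon_approx[OF ts] inO single_below[OF ts, of 1] unfolding approx_def by blast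
  next
    show "0 \<in> below t \<and> mon 0 \<in> approx t" using below_zero X.Y_zero K_approx Ksr(3) by simp
    show "a + b \<in> below t \<and> mon (a + b) \<in> approx t"
      if "a \<in> below t \<and> mon a \<in> approx t" "b \<in> below t \<and> mon b \<in> approx t" for a b
      using below_add[of a t b] approx_mult[of "mon a" "mon b"] that X.Y_add[of a b] by presburger
    fix a assume a: "a \<in> below t \<and> mon a \<in> approx t"
    have "mon a \<otimes> mon (- a) = \<one>" using X.Y_add[of a "- a"] X.Y_zero by simp
    then have "mon (- a) = inv (mon a)"
      using X.Y_closed by (intro comm_inv_char[symmetric]) auto
    then show "- a \<in> below t \<and> mon (- a) \<in> approx t"
      using a approx_inv inO(2) by (simp add: below_uminus)
  qed
  then show ?thesis by simp
qed

text \<open>The terms of a Laurent polynomial in the coarse valuation ring lie in this ring, as its value is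
  the least value of a term. Each term either is infinitely small or involves only variables
  dominated by \<open>t\<close>.\<close>

lemma monomials_approx:
  assumes "z \<in> monomial_ring mon UNIV" "z \<in> T.\<O>"
  shows "z \<in> approx t"
proof (cases "z = \<zero>")
  case True
  then show ?thesis using K_approx Ksr(2) by simp
next
  case False
  interpret X: coarse_section R ord k \<iota> mon UNIV mon by (rule section_mon_UNIV)
  obtain d where d: "d \<in> below t" "d \<le> ord z" using assms(2) False by (auto simp: coarse_ring_def)
  obtain P c where P: "finite P" "\<forall>a\<in>P. c a \<in> carrier k - {\<zero>\<^bsub>k\<^esub>}"
      "z = (\<Oplus>a\<in>P. \<iota> (c a) \<otimes> mon a)"
    using X.A_representation[OF assms(1)] by blast
  have tm: "\<iota> (c a) \<otimes> mon a \<in> carrier R - {\<zero>} \<and> ord (\<iota> (c a) \<otimes> mon a) = a" if "a \<in> P" for a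
    using X.ord_term P(2) that by blast
  have "P \<noteq> {}" using P(3) False by auto
  then have le: "ord z \<le> a" if "a \<in> P" for a
    using ord_finsum_distinct[of P "\<lambda>a. \<iota> (c a) \<otimes> mon a"] P tm that by (auto simp: inj_on_def)
  have terms: "\<iota> (c a) \<otimes> mon a \<in> approx t" if "a \<in> P" for a
  proof (cases "a \<in> below t")
    case True
    then show ?thesis using approx_mult[OF K_approx mon_approx_below] T.K_iota P(2) that by blast
  next
    case False
    have "e < a" if "e \<in> below t" for e
    proof (rule ccontr)
      assume "\<not> e < a"
      then have "a \<in> below t" using below_convex[OF d(1) \<open>e \<in> below t\<close>] d(2) le[OF \<open>a \<in> P\<close>] by auto
      then show False using False by simp
    qed
    then have "\<iota> (c a) \<otimes> mon a \<in> T.\<M>" using tm[OF that] by (auto simp: coarse_ideal_def)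
    then show ?thesis by (rule M_approx)
  qed
  have "(\<Oplus>a\<in>Q. \<iota> (c a) \<otimes> mon a) \<in> approx t" if "finite Q" "Q \<subseteq> P" for Q
    using that
  proof (induction Q rule: finite_induct)
    case empty
    then show ?case using K_approx Ksr(2) by simp
  next
    case (insert a Q)
    then have "(\<Oplus>a\<in>insert a Q. \<iota> (c a) \<otimes> mon a) = \<iota> (c a) \<otimes> mon a \<oplus> (\<Oplus>a\<in>Q. \<iota> (c a) \<otimes> mon a)"
      using tm by (intro finsum_insert) auto
    then show ?case using insert terms approx_add by auto
  qed
  then show ?thesis using P(1,3) by blast
qed

text \<open>Dividing numerator and denominator by the dominant monomial of the denominator makes the
  latter a unit.\<close>

lemma fractions_approx:
  assumes "x \<in> fraction_field mon UNIV" "x \<in> T.\<O>"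
  shows "x \<in> approx t"
proof -
  interpret X: coarse_section R ord k \<iota> mon UNIV mon by (rule section_mon_UNIV)
  obtain a b where ab: "a \<in> X.A" "b \<in> X.A" "b \<noteq> \<zero>" "x = a \<otimes> inv b"
    using assms(1) unfolding fraction_field_def quot_field_def by blast
  define u where "u = mon (- ord b)"
  have u: "u \<in> X.A" "u \<noteq> \<zero>" "ord u = - ord b" unfolding u_def
    using X.A_Y X.Y_nonzero X.ord_Y by auto
  have cl: "a \<in> carrier R" "b \<in> carrier R" "u \<in> carrier R" "inv b \<in> carrier R" "b \<otimes> inv b = \<one>" "x \<in> carrier R"
    using ab u X.A_closed field_Units T.O_closed[OF assms(2)] by auto
  define b' where "b' = b \<otimes> u"
  have "ord b' = 0" "b' \<noteq> \<zero>" unfolding b'_def using ord_mult[of b u] cl ab u by auto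
  then have b': "b' \<in> T.\<O>" "b' \<notin> T.\<M>" unfolding b'_def using cl below_zero
    by (auto simp: coarse_ring_def coarse_ideal_def)
  note ib = T.unit_inv[OF b']
  have ba: "b' \<in> approx t" by (rule monomials_approx[OF _ b'(1)]) (use X.A_mult ab u b'_def in auto)
  have "x \<otimes> b' = a \<otimes> u"
  proof -
    have "x \<otimes> b' = a \<otimes> u \<otimes> (b \<otimes> inv b)" unfolding b'_def ab(4) using cl(1-4) by algebra
    then show ?thesis using cl by simp
  qed
  then have "x \<otimes> b' \<in> X.A" using X.A_mult ab u by simp
  then have xa: "x \<otimes> b' \<in> approx t" using T.O_mult[OF assms(2) b'(1)] by (rule monomials_approx)
  have "x = x \<otimes> b' \<otimes> inv b'" using cl ib T.O_closed[OF b'(1)] T.O_closed[OF ib(2)] by (simp add: m_assoc)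
  then show ?thesis using approx_mult[OF xa approx_inv[OF ba b'(2)]] by simp
qed

lemma poly_value_congruent:
  assumes "\<And>i. i \<le> n \<Longrightarrow> c i \<in> T.\<O>" "\<And>i. i \<le> n \<Longrightarrow> d i \<in> T.\<O>" "\<And>i. i \<le> n \<Longrightarrow> c i \<ominus> d i \<in> T.\<M>" "x \<in> T.\<O>"
  shows "poly_value R n c x \<ominus> poly_value R n d x \<in> T.\<M>"
  using assms(1-3)
proof (induction n)
  case 0
  then show ?case using T.O_closed by (simp add: poly_value_0)
next
  case (Suc n)
  have cc: "\<And>i. i \<le> Suc n \<Longrightarrow> c i \<in> carrier R" "\<And>i. i \<le> Suc n \<Longrightarrow> d i \<in> carrier R"
    using T.O_closed[OF Suc.prems(1)] T.O_closed[OF Suc.prems(2)] by auto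
  have xc: "x \<in> carrier R" using T.O_closed[OF assms(4)] .
  define p q a b u where defs: "p = poly_value R n c x" "q = poly_value R n d x" "a = c (Suc n)"
    "b = d (Suc n)" "u = x [^] Suc n"
  have cl: "p \<in> carrier R" "q \<in> carrier R" "a \<in> carrier R" "b \<in> carrier R" "u \<in> carrier R"
    unfolding defs using cc xc by auto
  have "poly_value R (Suc n) c x \<ominus> poly_value R (Suc n) d x = (a \<otimes> u \<oplus> p) \<ominus> (b \<otimes> u \<oplus> q)"
    unfolding defs using poly_value_Suc[OF cc(1) xc] poly_value_Suc[OF cc(2) xc] by simp
  also have "\<dots> = (a \<ominus> b) \<otimes> u \<oplus> (p \<ominus> q)" using cl by algebra
  also have "\<dots> \<in> T.\<M>"
    unfolding defs using Suc by (intro T.M_add T.M_mult T.O_pow assms(4)) auto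
  finally show ?case .
qed

text \<open>\<open>KK t\<close> is a field of representatives for the residue field of \<open>coarse_ring (below t)\<close>: each
  residue is algebraic over the residues of \<open>KK t\<close>, hence a simple root of a polynomial over
  \<open>KK t\<close>; Hensel's Lemma lifts it to a root, and \<open>KK t\<close> contains all such roots.\<close>

lemma residue_representative:
  assumes a: "a \<in> T.\<O>"
  shows "\<exists>c\<in>KK t. a \<ominus> c \<in> T.\<M>"
proof -
  interpret X: coarse_section R ord k \<iota> mon UNIV mon by (rule section_mon_UNIV)
  have ac: "a \<in> carrier R" using T.O_closed[OF a] .
  note FR = subfieldE(3)[OF X.F_subfield]
  obtain n f where f: "\<And>i. i \<le> n \<Longrightarrow> f i \<in> X.F" "f n \<noteq> \<zero>" "poly_value R n f a = \<zero>"
    using algebraic_over_monomials[OF ac] algebraic_iff_root[OF X.F_subfield ac]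
    unfolding root_over_def by blast
  have fc: "\<And>i. i \<le> n \<Longrightarrow> f i \<in> carrier R" using f(1) FR by auto
  \<comment> \<open>dividing by a coefficient of least value yields a relation whose reduction is not trivial\<close>
  obtain j where j: "j \<le> n" "f j \<noteq> \<zero>" "\<And>i. i \<le> n \<Longrightarrow> f i \<noteq> \<zero> \<Longrightarrow> ord (f j) \<le> ord (f i)"
  proof -
    let ?I = "{i. i \<le> n \<and> f i \<noteq> \<zero>}"
    have fin: "finite ((\<lambda>i. ord (f i)) ` ?I)" and ne: "(\<lambda>i. ord (f i)) ` ?I \<noteq> {}" using f(2) by auto
    obtain j where "j \<in> ?I" "ord (f j) = Min ((\<lambda>i. ord (f i)) ` ?I)" using Min_in[OF fin ne] by auto
    then show ?thesis using that[of j] Min_le[OF fin] by auto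
  qed
  define u where "u = inv (f j)"
  have u: "u \<in> carrier R" "u \<noteq> \<zero>" "f j \<otimes> u = \<one>" "u \<in> X.F"
    using j fc field_Units subfield_m_inv[OF X.F_subfield, of "f j"] f(1) unfolding u_def by auto
  have ou: "ord u = - ord (f j)"
    using ord_mult[of "f j" u] u j fc by (simp add: eq_neg_iff_add_eq_0 add.commute)
  define g where "g i = f i \<otimes> u" for i
  have gF: "g i \<in> X.F" if "i \<le> n" for i
    unfolding g_def using subringE(6)[OF subfieldE(1)[OF X.F_subfield]] f(1)[OF that] u(4) by auto
  have gO: "g i \<in> T.\<O>" if "i \<le> n" for i
  proof (rule T.ge_imp_O)
    show "g i \<in> carrier R" unfolding g_def using fc[OF that] u by simp
    show "ge (g i) 0" unfolding ge_def g_def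
      using ord_mult[of "f i" u] fc[OF that] u ou j(3)[OF that] by (cases "f i = \<zero>") auto
  qed
  have g0: "poly_value R n g a = \<zero>"
  proof -
    have "poly_value R n g a = (\<Oplus>i\<in>{0..n}. (f i \<otimes> a [^] i) \<otimes> u)"
      unfolding poly_value_def g_def
    proof (rule finsum_cong')
      fix i assume "i \<in> {0..n}"
      then show "f i \<otimes> u \<otimes> a [^] i = (f i \<otimes> a [^] i) \<otimes> u"
        using fc[of i] u(1) ac m_comm[of u "a [^] i"] by (simp add: m_assoc)
    qed (use fc u ac in auto)
    also have "\<dots> = poly_value R n f a \<otimes> u"
      unfolding poly_value_def using fc u ac by (intro finsum_ldistr[symmetric]) auto
    finally show ?thesis using f(3) u by simp
  qed
  have "\<forall>i\<in>{..n}. \<exists>c. c \<in> KK t \<and> g i \<ominus> c \<in> T.\<M>"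
    using fractions_approx[OF gF gO] unfolding approx_def by blast
  then obtain c where c: "\<forall>i\<in>{..n}. c i \<in> KK t \<and> g i \<ominus> c i \<in> T.\<M>" by (rule bchoice[THEN exE])
  have cK: "c i \<in> KK t" "g i \<ominus> c i \<in> T.\<M>" if "i \<le> n" for i using c that by auto
  have "c j \<noteq> \<zero>"
  proof
    assume "c j = \<zero>"
    then have "\<one> \<in> T.\<M>" using cK(2)[OF j(1)] u(3) unfolding g_def by (simp add: a_minus_def)
    then show False using T.one_not_M by simp
  qed
  have pm: "poly_value R n c a \<in> T.\<M>"
  proof -
    have pc: "poly_value R n c a \<in> carrier R" using cK Kc ac by auto
    have "poly_value R n g a \<ominus> poly_value R n c a \<in> T.\<M>"
      by (rule poly_value_congruent[OF gO KO[OF cK(1)] cK(2) a])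
    then have "\<ominus> poly_value R n c a \<in> T.\<M>" using g0 pc by (simp add: a_minus_def)
    then show ?thesis using T.M_minus[of "\<ominus> poly_value R n c a"] pc by simp
  qed
  obtain m where m: "m \<le> n" "c m \<noteq> \<zero>" "poly_value R m c a \<in> T.\<M>"
    using poly_value_trim[of n c a j] cK Kc ac j(1) \<open>c j \<noteq> \<zero>\<close> pm by auto
  obtain l d where d: "\<And>i. i \<le> l \<Longrightarrow> d i \<in> KK t" "d l \<noteq> \<zero>"
      "poly_value R l d a \<in> T.\<M>" "poly_deriv_value R l d a \<notin> T.\<M>"
    using simple_root_exists[OF nat_mult_nonzero T.K_subfield ac T.K_inter_M, of m c] cK m by auto
  obtain b where b: "b \<in> carrier R" "poly_value R l d b = \<zero>" "b \<ominus> a \<in> T.\<M>"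
    using Hensel[OF coarsening_below, of l d t a] d KO a by blast
  have "root_over (KK t) b" unfolding root_over_def using d b(2) by blast
  then have "b \<in> KK t" using T.K_algebraic_closed[OF b(1)] algebraic_iff_root[OF T.K_subfield b(1)] by simp
  moreover have "a \<ominus> b = \<ominus> (b \<ominus> a)" using ac b(1) by algebra
  then have "a \<ominus> b \<in> T.\<M>" using T.M_minus[OF b(3)] by simp
  ultimately show ?thesis by blast
qed

end

end

context ladder
begin

text \<open>The additive complement consists of sums of terms \<open>c y^(-m)\<close> with \<open>m > 0\<close>, where \<open>y\<close> is a variable with
  index \<open>t\<close> and \<open>c\<close> is algebraic over the variables dominated by \<open>t\<close>.\<close>

definition comp_index :: "('i \<times> nat) set" where "comp_index = {(t, m). m > 0}"

definition complement :: "'a set" where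
  "complement = span_of comp_index (\<lambda>(t, m). KK t) (\<lambda>(t, m). Y (multiple t (- int m)))"

lemma Y_closed: "Y a \<in> carrier R" and Y_nonzero: "Y a \<noteq> \<zero>" and ord_Y: "ord (Y a) = a"
  and Y_add: "Y (a + b) = Y a \<otimes> Y b"
  using Y unfolding cross_section_def by auto

lemma Y_zero: "Y 0 = \<one>"
  using coarse_section.Y_zero[OF section_below] .

lemma K_subfield: "subfield (KK t) R" using coarse_section.K_subfield[OF section_below] .
lemma K_closed: "c \<in> KK t \<Longrightarrow> c \<in> carrier R" using subfieldE(3)[OF K_subfield] by blast
lemma K_iota: "c \<in> carrier k \<Longrightarrow> \<iota> c \<in> KK t" using coarse_section.K_iota[OF section_below] .
lemma K_Y: "a \<in> below t \<Longrightarrow> Y a \<in> KK t" using coarse_section.K_Y[OF section_below] .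
lemma K_mono: "s \<le> t \<Longrightarrow> KK t \<subseteq> KK s" by (intro algebraic_hull_mono below_mono)

lemma K_ord: "c \<in> KK t \<Longrightarrow> c \<noteq> \<zero> \<Longrightarrow> ord c \<in> below t"
  using coarse_section.K_ord[OF section_below] below_convex by meson

lemma K_mult: "c \<in> KK t \<Longrightarrow> d \<in> KK t \<Longrightarrow> c \<otimes> d \<in> KK t"
  using subringE(6)[OF subfieldE(1)[OF K_subfield]] .

sublocale comp: graded_span R comp_index "\<lambda>(t, m). KK t" "\<lambda>(t, m). Y (multiple t (- int m))"
proof (rule graded_span.intro[OF is_cring], unfold graded_span_axioms_def, safe)
  fix t :: 'i
  show "additive_subgroup (KK t) R"
    using subring.axioms(1)[OF subfieldE(1)[OF K_subfield]] by (intro additive_subgroup.intro)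
qed (use Y_closed in auto)

lemma complement_term: "c \<in> KK t \<Longrightarrow> m > 0 \<Longrightarrow> c \<otimes> Y (multiple t (- int m)) \<in> complement"
  using comp.span_term[of "(t, m)" c] unfolding complement_def comp_index_def by simp

lemma complement_zero: "\<zero> \<in> complement" unfolding complement_def by (rule span_of.zero)

lemma complement_closed: "z \<in> complement \<Longrightarrow> z \<in> carrier R"
  unfolding complement_def by (rule comp.span_closed)

lemma complement_add: "y \<in> complement \<Longrightarrow> z \<in> complement \<Longrightarrow> y \<oplus> z \<in> complement"
  unfolding complement_def by (rule comp.span_add)

lemma complement_subgroup: "additive_subgroup complement R"
  unfolding complement_def by (rule comp.span_additive_subgroup)

text \<open>A product of two generators is a generator: the factor with the dominated index is a
  coefficient for the other one.\<close>

lemma complement_mult: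
  assumes "y \<in> complement" "z \<in> complement"
  shows "y \<otimes> z \<in> complement"
  using assms unfolding complement_def
proof (rule comp.span_mult[rotated], fold complement_def)
  have wlog: "(c \<otimes> Y (multiple t (- int m))) \<otimes> (d \<otimes> Y (multiple s (- int n))) \<in> complement"
    if "m > 0" "n > 0" "c \<in> KK t" "d \<in> KK s" "t \<le> s" for t s m n c d
  proof -
    have d: "d \<in> KK t" using K_mono that by blast
    note cl = K_closed[OF that(3)] K_closed[OF d] Y_closed
    show ?thesis
    proof (cases "t = s")
      case True
      have "(c \<otimes> Y (multiple t (- int m))) \<otimes> (d \<otimes> Y (multiple t (- int n)))
          = (c \<otimes> d) \<otimes> (Y (multiple t (- int m)) \<otimes> Y (multiple t (- int n)))"
        using cl(1,2) Y_closed[of "multiple t (- int m)"] Y_closed[of "multiple t (- int n)"]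
        by algebra
      also have "\<dots> = (c \<otimes> d) \<otimes> Y (multiple t (- int (m + n)))"
        by (simp add: Y_add[symmetric] single_add[symmetric])
      finally show ?thesis using complement_term[OF K_mult[OF that(3) d], of "m + n"] that True by simp
    next
      case False
      then have "multiple s (- int n) \<in> below t" using that by (intro single_below) simp
      then have e: "d \<otimes> Y (multiple s (- int n)) \<in> KK t" using K_mult[OF d K_Y] by blast
      have "(c \<otimes> Y (multiple t (- int m))) \<otimes> (d \<otimes> Y (multiple s (- int n)))
          = (c \<otimes> (d \<otimes> Y (multiple s (- int n)))) \<otimes> Y (multiple t (- int m))"
        using cl(1,2) Y_closed[of "multiple t (- int m)"] Y_closed[of "multiple s (- int n)"]
        by algebra
      then show ?thesis using complement_term[OF K_mult[OF that(3) e] that(1)] by simp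
    qed
  qed
  fix i j c d
  assume ij: "i \<in> comp_index" "j \<in> comp_index"
    and cd: "c \<in> (case i of (t, m) \<Rightarrow> KK t)" "d \<in> (case j of (t, m) \<Rightarrow> KK t)"
  obtain t m s n where tm: "i = (t, m)" "j = (s, n)" by (cases i; cases j)
  have mn: "m > 0" "n > 0" "c \<in> KK t" "d \<in> KK s" using ij cd tm unfolding comp_index_def by auto
  have "(c \<otimes> Y (multiple t (- int m))) \<otimes> (d \<otimes> Y (multiple s (- int n))) \<in> complement"
  proof (cases "t \<le> s")
    case True
    then show ?thesis using wlog mn by blast
  next
    case False
    then have "(d \<otimes> Y (multiple s (- int n))) \<otimes> (c \<otimes> Y (multiple t (- int m))) \<in> complement"
      using wlog mn by simp
    then show ?thesis using m_comm K_closed mn Y_closed by simp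
  qed
  then show "(c \<otimes> (case i of (t, m) \<Rightarrow> Y (multiple t (- int m)))) \<otimes>
      (d \<otimes> (case j of (t, m) \<Rightarrow> Y (multiple t (- int m)))) \<in> complement"
    using tm by simp
qed

lemma complement_scale:
  assumes c: "c \<in> carrier k" and z: "z \<in> complement"
  shows "\<iota> c \<otimes> z \<in> complement"
  using z unfolding complement_def
proof (induction rule: span_of.induct)
  case zero
  then show ?case using c span_of.zero by simp
next
  case (step i d z)
  obtain t m where i: "i = (t, m)" by (cases i)
  have d: "d \<in> KK t" using step i by simp
  have "\<iota> c \<otimes> (d \<otimes> Y (multiple t (- int m)) \<oplus> z) =
      (\<iota> c \<otimes> d) \<otimes> Y (multiple t (- int m)) \<oplus> \<iota> c \<otimes> z"
    using K_closed[OF d] comp.span_closed[OF step(3)] iota_closed[OF c] Y_closed by (simp add: m_assoc r_distr)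
  moreover have "\<iota> c \<otimes> d \<in> KK t" using K_mult K_iota c d by blast
  ultimately show ?case using span_of.step[OF step(1) _ step.IH, of "\<iota> c \<otimes> d"] i by simp
qed

text \<open>The generators have negative values, and generators with different indices have different
  values.\<close>

lemma complement_negative:
  assumes "z \<in> complement" "z \<noteq> \<zero>"
  shows "ord z < 0"
proof -
  obtain P c where P: "finite P" "P \<subseteq> comp_index"
      "\<And>i. i \<in> P \<Longrightarrow> c i \<in> (case i of (t, m) \<Rightarrow> KK t) \<and> c i \<noteq> \<zero>"
      "z = (\<Oplus>i\<in>P. c i \<otimes> (case i of (t, m) \<Rightarrow> Y (multiple t (- int m))))"
    using comp.span_representation[OF assms(1)[unfolded complement_def]] by blast
  let ?f = "\<lambda>i. c i \<otimes> (case i of (t, m) \<Rightarrow> Y (multiple t (- int m)))"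
  have data: "m > 0 \<and> c (t, m) \<in> KK t \<and> c (t, m) \<noteq> \<zero>" if "(t, m) \<in> P" for t m
    using P(2) P(3)[OF that] that unfolding comp_index_def by auto
  have fc: "?f i \<in> carrier R - {\<zero>}" if "i \<in> P" for i
    using data[of "fst i" "snd i"] that K_closed Y_closed Y_nonzero integral_iff
    by (cases i) auto
  have val: "coord (ord (?f (t, m))) t = - int m"
    "\<And>s. s < t \<Longrightarrow> coord (ord (?f (t, m))) s = 0" if "(t, m) \<in> P" for t m
  proof -
    have "ord (?f (t, m)) = ord (c (t, m)) + multiple t (- int m)"
      using ord_mult[of "c (t, m)" "Y (multiple t (- int m))"] data[OF that] K_closed Y_closed
        Y_nonzero ord_Y by auto
    moreover have "ord (c (t, m)) \<in> below t" using K_ord data[OF that] by blast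
    ultimately show "coord (ord (?f (t, m))) t = - int m"
      "\<And>s. s < t \<Longrightarrow> coord (ord (?f (t, m))) s = 0"
      by (auto simp: below_def lookup_add lookup_single when_def)
  qed
  have "inj_on (\<lambda>i. ord (?f i)) P"
  proof (rule inj_onI)
    fix i j assume ij: "i \<in> P" "j \<in> P" "ord (?f i) = ord (?f j)"
    obtain t m s n where tm: "i = (t, m)" "j = (s, n)" by (cases i; cases j)
    have eq: "coord (ord (?f (t, m))) r = coord (ord (?f (s, n))) r" for r
      using ij(3) tm by simp
    have tP: "(t, m) \<in> P" "(s, n) \<in> P" using ij tm by auto
    have pos: "m > 0" "n > 0" using data tP by auto
    have "\<not> t < s" using eq[of t] val(1)[OF tP(1)] val(2)[OF tP(2), of t] pos by auto
    moreover have "\<not> s < t" using eq[of s] val(1)[OF tP(2)] val(2)[OF tP(1), of s] pos by auto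
    ultimately have "t = s" by simp
    moreover have "m = n" using eq[of t] val(1)[OF tP(1)] val(1)[OF tP(2)] \<open>t = s\<close> by simp
    ultimately show "i = j" using tm by simp
  qed
  moreover have "P \<noteq> {}" using P(4) assms(2) by auto
  ultimately obtain i where i: "i \<in> P" "ord z = ord (?f i)"
    using ord_finsum_distinct[of P ?f] P(1) fc unfolding P(4)[symmetric] by blast
  obtain t m where tm: "i = (t, m)" by (cases i)
  have "ord (?f (t, m)) < 0"
    using val[of t m] data[of t m] i(1) unfolding tm by (intro leading_neg[of t]) auto
  then show ?thesis using i(2) tm by simp
qed

text \<open>The induction is on \<open>t\<close> along domination, then on \<open>m\<close>: if \<open>a\<close> has a pole of order \<open>m > 0\<close> at index \<open>t\<close>, then
  subtracting a suitable generator lowers the order of the pole; if \<open>m = 0\<close>, then \<open>a\<close> is congruent to an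
  element of \<open>KK t\<close>, which only has poles at dominated indices.\<close>

lemma complement_approx_aux:
  assumes "a \<in> carrier R" "a \<otimes> Y (multiple t (int m)) \<in> coarse_ring (below t)"
  shows "\<exists>r\<in>complement. ge (a \<ominus> r) 0"
  using assms
proof (induction t arbitrary: m a rule: wf_induct_rule[OF wf_index])
  case (1 t)
  have IH: "\<exists>r\<in>complement. ge (a \<ominus> r) 0" if "t < s" "a \<in> carrier R"
    "a \<otimes> Y (multiple s (int m)) \<in> coarse_ring (below s)" for s m a
    using 1(1) that by simp
  interpret T: coarse_section R ord k \<iota> mon "below t" Y by (rule section_below)
  show ?case using 1(2,3)
  proof (induction m arbitrary: a)
    case 0
    then have "a \<in> T.\<O>" using Y_zero by simp
    then obtain c where c: "c \<in> KK t" "a \<ominus> c \<in> T.\<M>" using residue_representative by blast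
    have cc: "c \<in> carrier R" using K_closed[OF c(1)] .
    have ac: "ge (a \<ominus> c) 0" using T.M_gt_zero[OF c(2)] gt_imp_ge by blast
    obtain r where r: "r \<in> complement" "ge (c \<ominus> r) 0"
    proof (cases "ge c 0")
      case True
      then show ?thesis using that[of \<zero>] complement_zero cc by (simp add: a_minus_def)
    next
      case False
      then have nz: "c \<noteq> \<zero>" and neg: "ord c < 0" by (auto simp: ge_def)
      obtain s m where s: "m > 0" "ord c + multiple s (int m) \<in> below s"
          "coord (ord c) s \<noteq> 0"
        using negative_decomposition[OF neg] by blast
      have ts: "t < s"
      proof (rule ccontr)
        assume "\<not> t < s"
        then show False using s(3) K_ord[OF c(1) nz] by (simp add: below_def)
      qed
      let ?y = "Y (multiple s (int m))"
      have "c \<otimes> ?y \<in> carrier R" "ord (c \<otimes> ?y) \<in> below s"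
        using ord_mult[of c ?y] cc nz Y_closed Y_nonzero ord_Y s(2) by auto
      then have "c \<otimes> ?y \<in> coarse_ring (below s)" by (auto simp: coarse_ring_def)
      then show ?thesis using IH[OF ts cc] that by blast
    qed
    have "ge (a \<ominus> r) 0" using ge_trans[OF 0(1) cc complement_closed[OF r(1)] ac r(2)] .
    then show ?case using r(1) by blast
  next
    case (Suc m)
    let ?y = "Y (multiple t (int (Suc m)))" and ?y' = "Y (multiple t (- int (Suc m)))"
    have yy: "?y' \<otimes> ?y = \<one>"
      using Y_add[of "multiple t (- int (Suc m))" "multiple t (int (Suc m))", symmetric]
      by (simp add: single_add[symmetric] Y_zero del: of_nat_Suc)
    obtain c where c: "c \<in> KK t" "a \<otimes> ?y \<ominus> c \<in> T.\<M>" using residue_representative Suc.prems(2) by blast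
    have cc: "c \<in> carrier R" using K_closed[OF c(1)] .
    define r where "r = c \<otimes> ?y'"
    have r: "r \<in> complement" unfolding r_def using complement_term[OF c(1), of "Suc m"] by simp
    have rc: "r \<in> carrier R" using complement_closed[OF r] .
    have "r \<otimes> ?y = c" unfolding r_def using cc yy Y_closed by (simp add: m_assoc)
    then have z: "(a \<ominus> r) \<otimes> ?y = a \<otimes> ?y \<ominus> c"
      using Suc.prems(1) rc Y_closed by (simp add: a_minus_def l_distr l_minus)
    have "(a \<ominus> r) \<otimes> Y (multiple t (int m)) \<in> T.\<O>"
    proof -
      let ?u = "(a \<ominus> r) \<otimes> Y (multiple t (int m))"
      have uc: "?u \<in> carrier R" using Suc.prems(1) rc Y_closed by simp
      have ug: "?u \<otimes> Y (gen t) = a \<otimes> ?y \<ominus> c"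
      proof -
        have "Y (multiple t (int m)) \<otimes> Y (gen t) = ?y"
          by (simp add: Y_add[symmetric] single_add[symmetric] add.commute)
        then show ?thesis using z Suc.prems(1) rc Y_closed by (simp add: m_assoc)
      qed
      show ?thesis
      proof (cases "?u = \<zero>")
        case True
        then show ?thesis using T.zero_O by simp
      next
        case False
        have nz: "a \<otimes> ?y \<ominus> c \<noteq> \<zero>" and o: "ord (a \<otimes> ?y \<ominus> c) = ord ?u + gen t"
          using ord_mult[of ?u "Y (gen t)"] False uc Y_closed Y_nonzero ord_Y unfolding ug by auto
        have above: "d < ord (a \<otimes> ?y \<ominus> c)" if "d \<in> below t" for d
          using c(2) nz that unfolding coarse_ideal_def by simp
        have "ord (a \<otimes> ?y \<ominus> c) - gen t = ord ?u" using o by simp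
        then have "\<exists>d\<in>below t. d \<le> ord ?u" using above_below_discrete[of t "ord (a \<otimes> ?y \<ominus> c)", OF above] by simp
        then show ?thesis using uc by (auto simp: coarse_ring_def)
      qed
    qed
    then obtain r' where r': "r' \<in> complement" "ge ((a \<ominus> r) \<ominus> r') 0"
      using Suc.IH[of "a \<ominus> r"] Suc.prems(1) rc by auto
    have "a \<ominus> (r \<oplus> r') = (a \<ominus> r) \<ominus> r'"
      using Suc.prems(1) rc complement_closed[OF r'(1)] by algebra
    then show ?case using r'(2) complement_add[OF r r'(1)] by (intro bexI[of _ "r \<oplus> r'"]) simp_all
  qed
qed

lemma complement_approx:
  assumes a: "a \<in> carrier R"
  shows "\<exists>r\<in>complement. ge (a \<ominus> r) 0"
proof (cases "ge a 0")
  case True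
  then show ?thesis using complement_zero a by (intro bexI[of _ \<zero>]) (auto simp: a_minus_def)
next
  case False
  then have nz: "a \<noteq> \<zero>" and neg: "ord a < 0" by (auto simp: ge_def)
  obtain s m where s: "ord a + multiple s (int m) \<in> below s"
    using negative_decomposition[OF neg] by blast
  let ?y = "Y (multiple s (int m))"
  have "a \<otimes> ?y \<in> carrier R" "ord (a \<otimes> ?y) \<in> below s"
    using ord_mult[of a ?y] a nz Y_closed Y_nonzero ord_Y s by auto
  then have "a \<otimes> ?y \<in> coarse_ring (below s)" by (auto simp: coarse_ring_def)
  then show ?thesis using complement_approx_aux[OF a] by blast
qed

text \<open>The fields \<open>KK t\<close> form a chain.\<close>

lemma union_subfield: "subfield (\<Union>t. KK t) R"
proof (rule subfieldI'[OF subringI])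
  have common: "\<exists>t. x \<in> KK t \<and> y \<in> KK t" if xy: "x \<in> (\<Union>t. KK t)" "y \<in> (\<Union>t. KK t)" for x y
  proof -
    from xy obtain s t where st: "x \<in> KK s" "y \<in> KK t" by blast
    have "x \<in> KK (min s t)" "y \<in> KK (min s t)"
      using K_mono[of "min s t" s] K_mono[of "min s t" t] st by auto
    then show ?thesis by blast
  qed
  note sr = subringE[OF subfieldE(1)[OF K_subfield]]
  show "(\<Union>t. KK t) \<subseteq> carrier R" using K_closed by blast
  show "\<one> \<in> (\<Union>t. KK t)" using sr(3) by blast
  fix x assume "x \<in> (\<Union>t. KK t)"
  then show "\<ominus> x \<in> (\<Union>t. KK t)" using sr(5) by blast
  fix y assume "y \<in> (\<Union>t. KK t)"
  then obtain t where xy: "x \<in> KK t" "y \<in> KK t" using common[OF \<open>x \<in> (\<Union>t. KK t)\<close>] by auto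
  show "x \<otimes> y \<in> (\<Union>t. KK t)" by (rule UN_I[where a = t]) (use sr(6)[OF xy] in auto)
  show "x \<oplus> y \<in> (\<Union>t. KK t)" by (rule UN_I[where a = t]) (use sr(7)[OF xy] in auto)
next
  fix x assume "x \<in> (\<Union>t. KK t) - {\<zero>}"
  then obtain t where "x \<in> KK t - {\<zero>}" by blast
  then have "inv x \<in> KK t" using subfield_m_inv(1)[OF K_subfield] by blast
  then show "inv x \<in> (\<Union>t. KK t)" by blast
qed

text \<open>An element \<open>c\<close> of \<open>KK t\<close> is the quotient of \<open>c / y\<close> and \<open>1 / y\<close> for the variable \<open>y\<close> with index \<open>t\<close>.
  Conversely, the variable with index \<open>t\<close> lies in \<open>KK s\<close> if \<open>s\<close> dominates \<open>t\<close>, and every index is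
  dominated by another one.\<close>

lemma quot_complement: "quot_field R complement = (\<Union>t. KK t)"
proof
  have "complement \<subseteq> (\<Union>t. KK t)"
  proof
    fix z assume "z \<in> complement"
    then show "z \<in> (\<Union>t. KK t)" unfolding complement_def
    proof (induction rule: span_of.induct)
      case zero
      then show ?case using subringE(2)[OF subfieldE(1)[OF union_subfield]] .
    next
      case (step i c z)
      obtain t m where i: "i = (t, m)" by (cases i)
      obtain s where s: "s < t" using unbounded by blast
      have "Y (multiple t (- int m)) \<in> KK s" using K_Y single_below[OF s] by blast
      moreover have "c \<in> KK t" using step i by simp
      ultimately have "c \<otimes> Y (multiple t (- int m)) \<in> (\<Union>t. KK t)"
        using subringE(6)[OF subfieldE(1)[OF union_subfield]] by blast
      then show ?case using subringE(7)[OF subfieldE(1)[OF union_subfield]] step.IH i by simp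
    qed
  qed
  then show "quot_field R complement \<subseteq> (\<Union>t. KK t)" using quot_field_incl[OF union_subfield] by blast
  show "(\<Union>t. KK t) \<subseteq> quot_field R complement"
  proof
    fix c assume "c \<in> (\<Union>t. KK t)"
    then obtain t where c: "c \<in> KK t" by blast
    let ?y = "Y (multiple t (- 1))"
    have 1: "c \<otimes> ?y \<in> complement" using complement_term[OF c, of 1] by simp
    have "\<one> \<in> KK t" using subringE(3)[OF subfieldE(1)[OF K_subfield]] .
    then have 2: "?y \<in> complement" using complement_term[of \<one> t 1] Y_closed by simp
    have "?y \<otimes> inv ?y = \<one>" "inv ?y \<in> carrier R" using Y_closed Y_nonzero field_Units by auto
    then have "c = (c \<otimes> ?y) \<otimes> inv ?y" using K_closed[OF c] Y_closed by (simp add: m_assoc)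
    then show "c \<in> quot_field R complement"
      unfolding quot_field_def using 1 2 Y_nonzero by blast
  qed
qed

end

section \<open>Algebraic independence by derivations\<close>

context field
begin

lemma der_finprod_zero:
  assumes D: "derivation D" and "finite S" "\<And>b. b \<in> S \<Longrightarrow> f b \<in> carrier R \<and> D (f b) = \<zero>"
  shows "D (finprod R f S) = \<zero>"
  using assms(2,3)
proof (induction S rule: finite_induct)
  case empty
  then show ?case using der_one[OF D] by simp
next
  case (insert b S)
  have fc: "f \<in> S \<rightarrow> carrier R" using insert by auto
  have "finprod R f (insert b S) = f b \<otimes> finprod R f S" using insert by (intro finprod_insert) auto
  then show ?case using der_mult[OF D, of "f b" "finprod R f S"] insert fc by simp
qed

lemma der_pow_zero:
  assumes D: "derivation D" and "x \<in> carrier R" "D x = \<zero>"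
  shows "D (x [^] (n::nat)) = \<zero>"
proof (cases n)
  case 0
  then show ?thesis using der_one[OF D] by simp
next
  case (Suc m)
  then show ?thesis using der_pow[OF D assms(2), of m] assms by simp
qed

text \<open>If derivations vanish on the coefficients and act on \<open>S\<close> like partial derivatives, then a
  polynomial relation can be differentiated; by induction on the total degree all coefficients
  of non-constant monomials vanish.\<close>

lemma partial_derivatives_independent:
  assumes char: "\<And>n x. (n::nat) > 0 \<Longrightarrow> x \<in> carrier R \<Longrightarrow> x \<noteq> \<zero> \<Longrightarrow> [n] \<cdot> x \<noteq> \<zero>"
    and K: "subfield K R" and S: "finite S" "S \<subseteq> carrier R"
    and der: "\<And>C b. finite C \<Longrightarrow> C \<subseteq> K \<Longrightarrow> b \<in> S \<Longrightarrow>
        \<exists>D. derivation D \<and> (\<forall>c\<in>C. D c = \<zero>) \<and> D b = \<one> \<and> (\<forall>b'\<in>S - {b}. D b' = \<zero>)"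
    and M: "finite M" "\<And>m b. m \<in> M \<Longrightarrow> b \<notin> S \<Longrightarrow> m b = 0" "\<And>m. m \<in> M \<Longrightarrow> c m \<in> K"
    and rel: "(\<Oplus>m\<in>M. c m \<otimes> (\<Otimes>b\<in>S. b [^] (m b :: nat))) = \<zero>"
  shows "\<forall>m\<in>M. c m = \<zero>"
  using M rel
proof (induction "\<Sum>m\<in>M. \<Sum>b\<in>S. m b" arbitrary: M c rule: less_induct)
  case less
  note fin = less(2) and out = less(3) and cK = less(4) and rel = less(5)
  define mo where "mo m = (\<Otimes>b\<in>S. b [^] (m b :: nat))" for m
  have KR: "K \<subseteq> carrier R" using subfieldE(3)[OF K] .
  have Xc: "mo m \<in> carrier R" for m unfolding mo_def using S by (intro finprod_closed) auto
  have cc: "c m \<in> carrier R" if "m \<in> M" for m using cK[OF that] KR by auto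
  have nonconst: "c m = \<zero>" if m: "m \<in> M" "b \<in> S" "m b > 0" for m b
  proof -
    have cM: "finite (c ` M)" "c ` M \<subseteq> K" using fin cK by auto
    obtain D where D0: "derivation D" "\<forall>d\<in>c ` M. D d = \<zero>" "D b = \<one>" "\<forall>b'\<in>S - {b}. D b' = \<zero>"
      using der[OF cM m(2)] by (elim exE conjE)
    have D: "derivation D" "\<And>d. d \<in> c ` M \<Longrightarrow> D d = \<zero>" "D b = \<one>" "\<And>b'. b' \<in> S - {b} \<Longrightarrow> D b' = \<zero>"
      using D0(1) bspec[OF D0(2)] D0(3) bspec[OF D0(4)] by auto
    define Q where "Q m = (\<Otimes>b'\<in>S - {b}. b' [^] (m b' :: nat))" for m
    have Qc: "Q m \<in> carrier R" for m unfolding Q_def using S by (intro finprod_closed) auto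
    have bc: "b \<in> carrier R" using S m by auto
    have XQ: "mo m = b [^] m b \<otimes> Q m" for m
    proof -
      have "S = insert b (S - {b})" using m(2) by auto
      then have "mo m = (\<Otimes>b'\<in>insert b (S - {b}). b' [^] (m b' :: nat))" unfolding mo_def by simp
      also have "\<dots> = b [^] m b \<otimes> Q m" unfolding Q_def using S bc by (intro finprod_insert) auto
      finally show ?thesis .
    qed
    have DQ: "D (Q m) = \<zero>" for m
      unfolding Q_def using S D(4) der_pow_zero[OF D(1)] by (intro der_finprod_zero[OF D(1)]) auto
    let ?h = "\<lambda>m. m(b := m b - 1)"
    have Qh: "Q (?h m) = Q m" for m unfolding Q_def using S by (intro finprod_cong') auto
    have DX: "D (mo m) = (if m b = 0 then \<zero> else [m b] \<cdot> mo (?h m))" for m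
    proof (cases "m b")
      case 0
      then have "mo m = Q m" using XQ[of m] Qc by simp
      then show ?thesis using DQ 0 by simp
    next
      case (Suc n)
      have "D (mo m) = D (b [^] Suc n) \<otimes> Q m \<oplus> b [^] Suc n \<otimes> D (Q m)"
        unfolding XQ Suc using der_mult[OF D(1), of "b [^] Suc n" "Q m"] bc Qc by simp
      also have "\<dots> = [Suc n] \<cdot> (b [^] n) \<otimes> Q m"
        using der_pow[OF D(1) bc, of n] D(3) DQ bc Qc by (simp del: add.nat_pow_Suc nat_pow_Suc)
      also have "\<dots> = [Suc n] \<cdot> (b [^] n \<otimes> Q m)" using bc Qc by (intro add_pow_ldistr) auto
      also have "b [^] n \<otimes> Q m = mo (?h m)" unfolding XQ[of "?h m"] Qh using Suc by simp
      finally show ?thesis using Suc by (simp del: add.nat_pow_Suc)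
    qed
    let ?Mb = "{m \<in> M. m b > 0}"
    let ?M' = "?h ` ?Mb" and ?c' = "\<lambda>m. [Suc (m b)] \<cdot> c (m(b := Suc (m b)))"
    have restore: "(?h m)(b := Suc ((?h m) b)) = m" "Suc ((?h m) b) = m b" if "m \<in> ?Mb" for m
      using that by auto
    have inj: "inj_on ?h ?Mb" by (rule inj_on_inverseI[of _ "\<lambda>m. m(b := Suc (m b))"]) (use restore(1) in auto)
    have Dsum: "finite N \<Longrightarrow> N \<subseteq> M \<Longrightarrow> D (\<Oplus>m\<in>N. c m \<otimes> mo m) = (\<Oplus>m\<in>N. c m \<otimes> D (mo m))" for N
    proof (induction N rule: finite_induct)
      case empty
      then show ?case using der_zero[OF D(1)] by simp
    next
      case (insert m N)
      have cm: "c m \<in> carrier R" "D (c m) = \<zero>" using insert cc D(2) by auto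
      have cl: "(\<lambda>m. c m \<otimes> mo m) \<in> N \<rightarrow> carrier R" "(\<lambda>m. c m \<otimes> D (mo m)) \<in> N \<rightarrow> carrier R"
        using insert cc Xc der_closed[OF D(1)] by auto
      have "D (\<Oplus>m\<in>insert m N. c m \<otimes> mo m) = D (c m \<otimes> mo m \<oplus> (\<Oplus>m\<in>N. c m \<otimes> mo m))"
        using insert cl cm Xc by (subst finsum_insert) auto
      also have "\<dots> = D (c m \<otimes> mo m) \<oplus> D (\<Oplus>m\<in>N. c m \<otimes> mo m)"
        using cm Xc cl by (intro der_add[OF D(1)]) (auto intro: finsum_closed)
      also have "D (c m \<otimes> mo m) = c m \<otimes> D (mo m)"
        using der_mult[OF D(1) cm(1) Xc] cm Xc der_closed[OF D(1) Xc] by simp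
      also have "c m \<otimes> D (mo m) \<oplus> D (\<Oplus>m\<in>N. c m \<otimes> mo m) = (\<Oplus>m\<in>insert m N. c m \<otimes> D (mo m))"
        using insert cl cm der_closed[OF D(1) Xc] by (subst finsum_insert) auto
      finally show ?case .
    qed
    have "(\<Oplus>m\<in>?M'. ?c' m \<otimes> mo m) = (\<Oplus>m\<in>?Mb. ?c' (?h m) \<otimes> mo (?h m))"
      by (rule add.finprod_reindex[OF _ inj]) (use restore cc Xc in \<open>auto simp del: add.nat_pow_Suc\<close>)
    also have "\<dots> = (\<Oplus>m\<in>?Mb. c m \<otimes> D (mo m))"
    proof (rule finsum_cong')
      fix n assume n: "n \<in> ?Mb"
      have "?c' (?h n) \<otimes> mo (?h n) = [n b] \<cdot> c n \<otimes> mo (?h n)" unfolding restore[OF n] by simp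
      also have "\<dots> = c n \<otimes> D (mo n)" using n cc[of n] Xc DX[of n] add_pow_ldistr add_pow_rdistr by simp
      finally show "?c' (?h n) \<otimes> mo (?h n) = c n \<otimes> D (mo n)" .
    qed (use cc Xc der_closed[OF D(1)] in auto)
    also have "\<dots> = (\<Oplus>m\<in>M. c m \<otimes> D (mo m))"
      by (rule add.finprod_mono_neutral_cong_left) (use fin cc DX Xc der_closed[OF D(1)] in auto)
    also have "\<dots> = D (\<Oplus>m\<in>M. c m \<otimes> mo m)" using Dsum[OF fin] by simp
    also have "\<dots> = \<zero>" using rel der_zero[OF D(1)] unfolding mo_def by simp
    finally have rel': "(\<Oplus>m\<in>?M'. ?c' m \<otimes> mo m) = \<zero>" .
    have deg: "(\<Sum>b'\<in>S. (?h n) b') < (\<Sum>b'\<in>S. n b')" if "n \<in> ?Mb" for n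
      by (rule sum_strict_mono_ex1) (use S m(2) that in auto)
    have "(\<Sum>m\<in>?M'. \<Sum>b\<in>S. m b) = (\<Sum>m\<in>?Mb. \<Sum>b\<in>S. (?h m) b)" using inj by (simp add: sum.reindex)
    also have "\<dots> < (\<Sum>m\<in>?Mb. \<Sum>b\<in>S. m b)"
      by (rule sum_strict_mono) (use fin m deg in auto)
    also have "\<dots> \<le> (\<Sum>m\<in>M. \<Sum>b\<in>S. m b)" by (rule sum_mono2) (use fin in auto)
    finally have smaller: "(\<Sum>m\<in>?M'. \<Sum>b\<in>S. m b) < (\<Sum>m\<in>M. \<Sum>b\<in>S. m b)" .
    have "\<forall>m\<in>?M'. ?c' m = \<zero>"
    proof (rule less(1)[OF smaller])
      show "finite ?M'" using fin by simp
      show "n b' = 0" if "n \<in> ?M'" "b' \<notin> S" for n b' using that out m(2) by auto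
      show "?c' n \<in> K" if n: "n \<in> ?M'" for n
      proof -
        obtain n' where n': "n' \<in> ?Mb" "n = ?h n'" using n by blast
        then have "c (n(b := Suc (n b))) \<in> K" using restore(1)[OF n'(1)] cK[of n'] by auto
        then show ?thesis by (rule sub_nat_mult_closed[OF K])
      qed
      show "(\<Oplus>m\<in>?M'. ?c' m \<otimes> (\<Otimes>b\<in>S. b [^] (m b :: nat))) = \<zero>" using rel' unfolding mo_def .
    qed
    moreover have mb: "m \<in> ?Mb" using m by simp
    ultimately have "?c' (?h m) = \<zero>" by blast
    then have "[m b] \<cdot> c m = \<zero>" unfolding restore[OF mb] by simp
    then show ?thesis using char[of "m b" "c m"] m cc by auto
  qed
  show ?case
  proof
    fix m assume m: "m \<in> M"
    show "c m = \<zero>"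
    proof (cases "\<exists>b\<in>S. m b > 0")
      case True
      then show ?thesis using nonconst m by blast
    next
      case False
      then have m0: "m = (\<lambda>_. 0)" using out[OF m] by (intro ext) auto
      have "mo m = \<one>" unfolding mo_def m0 by (rule finprod_one_eqI) simp
      have "(\<Oplus>m\<in>M. c m \<otimes> mo m) = (\<Oplus>n\<in>{m}. c n \<otimes> mo n)"
      proof (rule add.finprod_mono_neutral_cong_right)
        fix n assume n: "n \<in> M - {m}"
        have "\<exists>b\<in>S. n b > 0"
        proof (rule ccontr)
          assume "\<not> ?thesis"
          then have "n = (\<lambda>_. 0)" using out[of n] n by (intro ext) auto
          then show False using n m0 by simp
        qed
        then show "c n \<otimes> mo n = \<zero>" using nonconst n Xc by auto
      qed (use fin m cc Xc in auto)
      also have "\<dots> = c m" using cc[OF m] \<open>mo m = \<one>\<close> by simp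
      finally show ?thesis using rel unfolding mo_def by simp
    qed
  qed
qed

lemma algebraically_independentI:
  assumes char: "\<And>n x. (n::nat) > 0 \<Longrightarrow> x \<in> carrier R \<Longrightarrow> x \<noteq> \<zero> \<Longrightarrow> [n] \<cdot> x \<noteq> \<zero>"
    and K: "subfield K R" and B: "B \<subseteq> carrier R"
    and der: "\<And>C b. finite C \<Longrightarrow> C \<subseteq> K \<Longrightarrow> b \<in> B \<Longrightarrow>
        \<exists>D. derivation D \<and> (\<forall>c\<in>C. D c = \<zero>) \<and> D b = \<one> \<and> (\<forall>b'\<in>B - {b}. D b' = \<zero>)"
  shows "algebraically_independent R K B"
  unfolding algebraically_independent_def
proof (intro conjI B allI impI, elim conjE)
  fix S M and c :: "('a \<Rightarrow> nat) \<Rightarrow> 'a"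
  assume h: "finite S" "S \<subseteq> B" "finite M" "\<forall>m\<in>M. \<forall>b. b \<notin> S \<longrightarrow> m b = 0" "\<forall>m\<in>M. c m \<in> K"
    "(\<Oplus>m\<in>M. c m \<otimes> (\<Otimes>b\<in>S. b [^] m b)) = \<zero>"
  show "\<forall>m\<in>M. c m = \<zero>"
  proof (rule partial_derivatives_independent[OF char K h(1) _ _ h(3) _ _ h(6)])
    fix C b assume C: "finite C" "C \<subseteq> K" "b \<in> S"
    then obtain D where "derivation D" "\<forall>c\<in>C. D c = \<zero>" "D b = \<one>" "\<forall>b'\<in>B - {b}. D b' = \<zero>"
      using der[of C b] h(2) by blast
    then show "\<exists>D. derivation D \<and> (\<forall>c\<in>C. D c = \<zero>) \<and> D b = \<one> \<and> (\<forall>b'\<in>S - {b}. D b' = \<zero>)"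
      using h(2) by blast
  qed (use h B in auto)
qed

end

section \<open>Modified cross sections\<close>

context monomial_field
begin

text \<open>The value group is free on the elements \<open>gen t\<close>, so a cross section may be prescribed on them.\<close>

lemma cross_section_exists:
  assumes "\<And>t. y (t :: 'i) \<in> carrier R - {\<zero>}"
  shows "\<exists>Y. (\<forall>a. Y a \<in> carrier R - {\<zero>}) \<and> (\<forall>a b. Y (a + b) = Y a \<otimes> Y b) \<and>
    (\<forall>t::'i. Y (gen t) = y t)"
proof -
  let ?MR = "Multiplicative_Group.mult_of R"
  interpret G: comm_group ?MR
  proof (rule group.group_comm_groupI[OF field_mult_group])
    show "x \<otimes>\<^bsub>?MR\<^esub> z = z \<otimes>\<^bsub>?MR\<^esub> x" if "x \<in> carrier ?MR" "z \<in> carrier ?MR" for x z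
      using that m_comm by simp
  qed
  have y: "y t \<in> carrier ?MR" for t using assms by simp
  define Y where "Y a = finprod ?MR (\<lambda>t. y t [^]\<^bsub>?MR\<^esub> (coord a t)) (Poly_Mapping.keys a)"
    for a :: "'i \<Rightarrow>\<^sub>0 int"
  have super: "Y a = finprod ?MR (\<lambda>t. y t [^]\<^bsub>?MR\<^esub> (coord a t)) T"
    if "finite T" "Poly_Mapping.keys a \<subseteq> T" for a T
    unfolding Y_def
  proof (rule G.finprod_mono_neutral_cong_left[OF that])
    fix t assume "t \<in> T - Poly_Mapping.keys a"
    then have "coord a t = 0" by (simp add: in_keys_iff)
    then show "y t [^]\<^bsub>?MR\<^esub> (coord a t) = \<one>\<^bsub>?MR\<^esub>"
      by (simp only: int_pow_0)
  qed (use G.int_pow_closed[OF y] in auto)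
  have Yc: "Y a \<in> carrier ?MR" for a unfolding Y_def by (intro G.finprod_closed Pi_I G.int_pow_closed y)
  have "Y (a + b) = Y a \<otimes> Y b" for a b
  proof -
    let ?T = "Poly_Mapping.keys a \<union> Poly_Mapping.keys b"
    have T: "finite ?T" "Poly_Mapping.keys (a + b) \<subseteq> ?T" by (auto simp: in_keys_iff lookup_add)
    note pw = G.int_pow_closed[OF y]
    have "Y (a + b) = finprod ?MR (\<lambda>t. y t [^]\<^bsub>?MR\<^esub> (coord a t) \<otimes>\<^bsub>?MR\<^esub>
        y t [^]\<^bsub>?MR\<^esub> (coord b t)) ?T"
      unfolding super[OF T]
    proof (rule G.finprod_cong')
      fix t
      show "y t [^]\<^bsub>?MR\<^esub> (coord (a + b) t) = y t [^]\<^bsub>?MR\<^esub> (coord a t)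
          \<otimes>\<^bsub>?MR\<^esub> y t [^]\<^bsub>?MR\<^esub> (coord b t)"
        unfolding lookup_add by (rule G.int_pow_mult[OF y])
    qed (use G.m_closed[OF pw pw] in blast)+
    also have "\<dots> = finprod ?MR (\<lambda>t. y t [^]\<^bsub>?MR\<^esub> (coord a t)) ?T \<otimes>\<^bsub>?MR\<^esub>
        finprod ?MR (\<lambda>t. y t [^]\<^bsub>?MR\<^esub> (coord b t)) ?T"
      by (rule G.finprod_multf) (use pw in blast)+
    also have "\<dots> = Y a \<otimes>\<^bsub>?MR\<^esub> Y b"
      using super[OF T(1), of a] super[OF T(1), of b] by simp
    finally show ?thesis by simp
  qed
  moreover have "Y (gen t) = y t" for t
  proof -
    have "Y (gen t) = finprod ?MR (\<lambda>s. y s [^]\<^bsub>?MR\<^esub> (coord (gen t) s)) {t}"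
      by (rule super) auto
    then show ?thesis using y[of t] by (simp add: G.int_pow_1)
  qed
  moreover have "Y a \<in> carrier R - {\<zero>}" for a using Yc[of a] by simp
  ultimately show ?thesis by blast
qed

end

lemma (in ladder_field) cross_section_prescribed:
  assumes "\<And>t. y t \<in> carrier R - {\<zero>}" "\<And>t. ord (y t) = gen t"
  shows "\<exists>Y. cross_section Y \<and> (\<forall>t. Y (gen t) = y t)"
proof -
  obtain Y where Y0: "\<forall>a. Y a \<in> carrier R - {\<zero>}" "\<forall>a b. Y (a + b) = Y a \<otimes> Y b" "\<forall>t. Y (gen t) = y t"
    using cross_section_exists[of y, OF assms(1)] by (elim exE conjE)
  then have Y: "Y a \<in> carrier R - {\<zero>}" "Y (a + b) = Y a \<otimes> Y b" "Y (gen t) = y t" for a b t by simp_all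
  have oa: "ord (Y (a + b)) = ord (Y a) + ord (Y b)" for a b using ord_mult[of "Y a" "Y b"] Y(1)[of a] Y(1)[of b] Y(2) by simp
  have o0: "ord (Y 0) = 0" using oa[of 0 0] by simp
  have "ord (Y a) = a" for a
  proof (rule value_group_induct)
    show "ord (Y (gen t)) = gen t" for t using Y(3) assms(2) by simp
    show "ord (Y (a + b)) = a + b" if "ord (Y a) = a" "ord (Y b) = b" for a b using oa that by simp
    show "ord (Y (- a)) = - a" if "ord (Y a) = a" for a
      using oa[of a "- a"] o0 that by (simp add: eq_neg_iff_add_eq_0 add.commute)
  qed (rule o0)
  then show ?thesis unfolding cross_section_def using Y by (intro exI[of _ Y]) simp
qed

text \<open>The number is compared first, and an index with a larger number dominates; among indices
  with equal number a well-order of the labels decides. As exponents are compared at the least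
  index, the dominating index has to be the smaller one.\<close>

datatype 'l index = Index (stage: nat) (label: 'l)

definition label_order :: "'l rel" where "label_order = (SOME r. well_order_on UNIV r)"

lemma label_order: "well_order_on UNIV (label_order :: 'l rel)"
  unfolding label_order_def using well_order_on by (rule someI_ex)

instantiation index :: (type) linorder
begin

definition less_index :: "'a index \<Rightarrow> 'a index \<Rightarrow> bool" where
  "s < t \<longleftrightarrow> stage t < stage s \<or> stage t = stage s \<and> (label t, label s) \<in> label_order - Id"

definition less_eq_index :: "'a index \<Rightarrow> 'a index \<Rightarrow> bool" where
  "(s :: 'a index) \<le> t \<longleftrightarrow> s = t \<or> s < t"

instance
proof
  have "linear_order (label_order :: 'a rel)" using label_order unfolding well_order_on_def by blast
  then have tr: "trans (label_order :: 'a rel)" and anti: "antisym (label_order :: 'a rel)"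
    and total: "total (label_order :: 'a rel)"
    unfolding linear_order_on_def partial_order_on_def preorder_on_def by auto
  fix x y z :: "'a index"
  have trans: "x < z" if "x < y" "y < z" for x y z :: "'a index"
  proof -
    have "(label z, label x) \<in> label_order - Id"
      if "(label z, label y) \<in> label_order - Id" "(label y, label x) \<in> label_order - Id"
      using that transD[OF tr, of "label z" "label y" "label x"] antisymD[OF anti, of "label y" "label x"] by auto
    then show ?thesis using that unfolding less_index_def by auto
  qed
  have asym: "\<not> y < x" if "x < y" for x y :: "'a index"
    using that antisymD[OF anti, of "label y" "label x"] unfolding less_index_def by auto
  have neq: "x \<noteq> y \<Longrightarrow> x < y \<or> y < x"
    using total[unfolded total_on_def, rule_format, of "label x" "label y"] unfolding less_index_def
    by (cases x; cases y) auto
  show "x < y \<longleftrightarrow> x \<le> y \<and> \<not> y \<le> x"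
    using asym[of x y] asym[of x x] unfolding less_eq_index_def by auto
  show "x \<le> x" unfolding less_eq_index_def by simp
  show "x \<le> z" if "x \<le> y" "y \<le> z"
    using that trans[of x y z] unfolding less_eq_index_def by auto
  show "x = y" if "x \<le> y" "y \<le> x"
    using that asym[of x y] unfolding less_eq_index_def by auto
  show "x \<le> y \<or> y \<le> x"
    using neq unfolding less_eq_index_def by auto
qed

end

lemma wf_index: "wf {(s :: 'l index, t). t < s}"
proof -
  have "wf (less_than <*lex*> (label_order - Id :: 'l rel))"
    using label_order unfolding well_order_on_def by blast
  then have "wf (inv_image (less_than <*lex*> (label_order - Id)) (\<lambda>s :: 'l index. (stage s, label s)))"
    by (rule wf_inv_image)
  then show ?thesis by (rule wf_subset) (auto simp: inv_image_def less_index_def)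
qed

lemma next_stage_less: "Index (Suc n) i < Index n j"
  by (simp add: less_index_def)

lemma stage_antimono: "s < t \<Longrightarrow> stage t \<le> stage s"
  by (auto simp: less_index_def)

locale staged_field = henselian_monomial_field R ord k \<iota> mon
  for R :: "('a, 'r) ring_scheme" (structure) and ord :: "'a \<Rightarrow> ('l index \<Rightarrow>\<^sub>0 int)"
    and k :: "('k, 'm) ring_scheme" and \<iota> :: "'k \<Rightarrow> 'a" and mon
begin

sublocale ladder_field R ord k \<iota> mon
proof unfold_locales
  show "wf {(s :: 'l index, t). t < s}" by (rule wf_index)
  show "\<exists>s. s < t" for t :: "'l index"
    using next_stage_less[of "stage t" "label t" "label t"] by auto
qed

definition mg :: "'l index \<Rightarrow> 'a" where "mg t = mon (gen t)"

lemma mg_closed: "mg t \<in> carrier R" and mg_nonzero: "mg t \<noteq> \<zero>" and ord_mg: "ord (mg t) = gen t"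
  unfolding mg_def using mon_nonzero[of "gen t"] ord_mon by auto

text \<open>For labels in \<open>J\<close> the monomials \<open>mg (Index n j)\<close> are replaced by the differences of consecutive ones.\<close>

definition shifted :: "'l set \<Rightarrow> 'l index \<Rightarrow> 'a" where
  "shifted J t = (if label t \<in> J then mg t \<ominus> mg (Index (Suc (stage t)) (label t)) else mg t)"

text \<open>The subtracted monomial has a larger value.\<close>

lemma shifted: "shifted J t \<in> carrier R - {\<zero>} \<and> ord (shifted J t) = gen t"
proof (cases "label t \<in> J")
  case True
  let ?s = "Index (Suc (stage t)) (label t)"
  have st: "?s < t" using next_stage_less[of "stage t" "label t" "label t"] by simp
  have lt: "gen t < gen ?s" using below_less_gen[OF single_below[OF st]] .
  have "mg t \<oplus> \<ominus> mg ?s \<noteq> \<zero> \<and> ord (mg t \<oplus> \<ominus> mg ?s) = min (gen t) (gen ?s)"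
    using ord_add_distinct[of "mg t" "\<ominus> mg ?s"] mg_closed mg_nonzero ord_mg lt by auto
  then show ?thesis using True mg_closed lt unfolding shifted_def a_minus_def by (simp add: min_absorb1)
qed (use mg_closed mg_nonzero ord_mg in \<open>auto simp: shifted_def\<close>)

lemma mon_ladder: "ladder R ord k \<iota> mon mon"
proof unfold_locales
  show "cross_section mon" by (rule mon_cross_section)
  fix s t :: "'l index" assume ts: "t < s"
  interpret T: coarse_section R ord k \<iota> mon "below t" mon
    by unfold_locales (auto simp: below_zero below_diff mon_cross_section)
  have "mon (gen s) \<in> T.K" by (rule T.K_Y[OF single_below[OF ts]])
  then show "\<exists>c\<in>T.K. mon (gen s) \<ominus> c \<in> T.\<M>"
    using T.zero_M T.Y_closed by (intro bexI[of _ "mon (gen s)"]) (auto simp: a_minus_def r_neg)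
qed

text \<open>The monomial with index \<open>s\<close> is the sum of consecutive new variables and of a monomial whose index
  dominates \<open>t\<close>, which is infinitely small.\<close>

lemma shifted_ladder:
  assumes Y: "cross_section Y" "\<And>t. Y (gen t) = shifted J t"
  shows "ladder R ord k \<iota> mon Y"
proof unfold_locales
  show "cross_section Y" by (rule Y(1))
  fix s t :: "'l index" assume ts: "t < s"
  interpret T: coarse_section R ord k \<iota> mon "below t" Y
    by unfold_locales (auto simp: below_zero below_diff Y)
  have M: "mg r \<in> T.\<M>" if "r \<le> t" for r
  proof -
    have "d < gen r" if "d \<in> below t" for d
      using below_less[OF that, of r "gen r"] \<open>r \<le> t\<close> by (auto simp: lookup_single when_def)
    then show ?thesis using mg_closed ord_mg by (auto simp: coarse_ideal_def)
  qed
  have "\<exists>c\<in>T.K. mg s \<ominus> c \<in> T.\<M>" using ts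
  proof (induction "stage t - stage s" arbitrary: s rule: less_induct)
    case (less s)
    have sK: "shifted J s \<in> T.K" using T.K_Y[OF single_below[OF less(2), of 1]] Y(2) by simp
    show ?case
    proof (cases "label s \<in> J")
      case False
      then have "shifted J s = mg s" by (simp add: shifted_def)
      then show ?thesis using sK T.zero_M mg_closed by (intro bexI[of _ "mg s"]) (auto simp: a_minus_def r_neg)
    next
      case True
      let ?r = "Index (Suc (stage s)) (label s)"
      have sh: "shifted J s = mg s \<ominus> mg ?r" using True by (simp add: shifted_def)
      show ?thesis
      proof (cases "?r \<le> t")
        case le: True
        have "mg s \<ominus> shifted J s = mg ?r" unfolding sh using mg_closed[of s] mg_closed[of ?r] by algebra
        then show ?thesis using M[OF le] sK by (intro bexI[of _ "shifted J s"]) simp_all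
      next
        case False
        then have tr: "t < ?r" by simp
        then have "stage t - stage ?r < stage t - stage s" using stage_antimono[OF tr] by simp
        then obtain c where c: "c \<in> T.K" "mg ?r \<ominus> c \<in> T.\<M>" using less(1) tr by blast
        have cc: "c \<in> carrier R" using c(1) subfieldE(3)[OF T.K_subfield] by blast
        have "mg s \<ominus> (shifted J s \<oplus> c) = mg ?r \<ominus> c"
          unfolding sh using mg_closed[of s] mg_closed[of ?r] cc by algebra
        moreover have "shifted J s \<oplus> c \<in> T.K" using subringE(7)[OF subfieldE(1)[OF T.K_subfield]] sK c(1) by blast
        ultimately show ?thesis using c(2) by (intro bexI[of _ "shifted J s \<oplus> c"]) simp_all
      qed
    qed
  qed
  then show "\<exists>c\<in>T.K. mon (gen s) \<ominus> c \<in> T.\<M>" unfolding mg_def .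
qed

end

section \<open>Complements with prescribed transcendence degree\<close>

definition (in monomial_field) is_complement :: "'a set \<Rightarrow> bool" where
  "is_complement C \<longleftrightarrow> additive_subgroup C R \<and> (\<forall>y\<in>C. \<forall>z\<in>C. y \<otimes> z \<in> C) \<and>
     (\<forall>c\<in>carrier k. \<forall>z\<in>C. \<iota> c \<otimes> z \<in> C) \<and> (\<forall>z\<in>C. z \<noteq> \<zero> \<longrightarrow> ord z < 0) \<and>
     (\<forall>a\<in>carrier R. \<exists>r\<in>C. ge (a \<ominus> r) 0)"

lemma (in ladder) is_complement: "is_complement complement"
  unfolding is_complement_def
  using complement_subgroup complement_mult complement_scale complement_negative complement_approx by blast

context staged_field
begin

lemma mg_unit: "mon (- gen t) \<otimes> mg t = \<one>"
proof -
  interpret coarse_section R ord k \<iota> mon UNIV mon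
    by unfold_locales (auto simp: mon_cross_section)
  show ?thesis unfolding mg_def using Y_add[of "- gen t" "gen t"] Y_zero by simp
qed

text \<open>The partial derivative with respect to a variable \<open>x\<close> is \<open>1 / x\<close> times the derivation that multiplies
  monomials by their exponent of \<open>x\<close>. Finitely many of them suffice for finitely many elements.\<close>

lemma partial_derivative:
  "\<exists>D. derivation D \<and> (\<forall>c\<in>carrier k. D (\<iota> c) = \<zero>) \<and>
     (\<forall>t. D (mg t) = (if label t = j \<and> stage t < N then \<one> else \<zero>))"
proof (induction N)
  case 0
  show ?case by (rule exI[of _ "\<lambda>_. \<zero>"]) (auto simp: derivation_def)
next
  case (Suc N)
  then obtain D where D: "derivation D" "\<forall>c\<in>carrier k. D (\<iota> c) = \<zero>"
    "\<forall>t. D (mg t) = (if label t = j \<and> stage t < N then \<one> else \<zero>)" by (elim exE conjE)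
  let ?s = "Index N j"
  obtain E where E: "derivation E" "\<forall>c\<in>carrier k. E (\<iota> c) = \<zero>"
    "\<forall>a. E (mon a) = \<iota> ([(coord a ?s)] \<cdot>\<^bsub>k\<^esub> \<one>\<^bsub>k\<^esub>) \<otimes> mon a"
    using derivation_exists[of "\<lambda>a. coord a ?s"] by (auto simp: lookup_add)
  define u where "u = mon (- gen ?s)"
  have u: "u \<in> carrier R" "u \<otimes> mg ?s = \<one>" unfolding u_def using mon_nonzero mg_unit by auto
  note cl = der_closed[OF D(1)] der_closed[OF E(1)]
  let ?D = "\<lambda>x. D x \<oplus> u \<otimes> E x"
  have "derivation ?D" unfolding derivation_def
  proof (intro conjI ballI)
    fix x y assume xy: "x \<in> carrier R" "y \<in> carrier R"
    show "?D (x \<oplus> y) = ?D x \<oplus> ?D y"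
      unfolding der_add[OF D(1) xy] der_add[OF E(1) xy]
      using cl(1)[OF xy(1)] cl(1)[OF xy(2)] cl(2)[OF xy(1)] cl(2)[OF xy(2)] u(1) by algebra
    show "?D (x \<otimes> y) = ?D x \<otimes> y \<oplus> x \<otimes> ?D y"
      unfolding der_mult[OF D(1) xy] der_mult[OF E(1) xy]
      using cl(1)[OF xy(1)] cl(1)[OF xy(2)] cl(2)[OF xy(1)] cl(2)[OF xy(2)] u(1) xy by algebra
  qed (use cl u in auto)
  moreover have "\<forall>c\<in>carrier k. ?D (\<iota> c) = \<zero>" using D(2) E(2) u by simp
  moreover have "?D (mg t) = (if label t = j \<and> stage t < Suc N then \<one> else \<zero>)" for t
  proof (cases "t = ?s")
    case True
    have "E (mg t) = mg ?s" unfolding mg_def True using E(3) mon_nonzero[of "gen ?s"]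
      by (simp add: add_pow_int_ge)
    then show ?thesis using D(3) u(2) True by simp
  next
    case False
    have "coord (gen t) ?s = 0" using False by (simp add: lookup_single when_def)
    then have "E (mg t) = \<zero>" unfolding mg_def using E(3) mon_nonzero[of "gen t"] by (simp add: add_pow_int_ge)
    moreover have "(label t = j \<and> stage t < Suc N) = (label t = j \<and> stage t < N)"
      using False by (cases t) auto
    ultimately show ?thesis using D(3) u(1) by simp
  qed
  ultimately show ?case by (intro exI[of _ ?D] conjI allI)
qed

lemma all_monomials_in:
  assumes N: "subfield N R" and gens: "\<And>t. mg t \<in> N"
  shows "mon a \<in> N"
proof (rule value_group_induct)
  interpret coarse_section R ord k \<iota> mon UNIV mon
    by unfold_locales (auto simp: mon_cross_section)
  show "mon (gen t) \<in> N" for t using gens unfolding mg_def .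
  show "mon 0 \<in> N" using Y_zero subringE(3)[OF subfieldE(1)[OF N]] by simp
  show "mon (a + b) \<in> N" if "mon a \<in> N" "mon b \<in> N" for a b
    using Y_add subringE(6)[OF subfieldE(1)[OF N]] that by simp
  fix a assume a: "mon a \<in> N"
  have "mon a \<otimes> mon (- a) = \<one>" using Y_add[of a "- a"] Y_zero by simp
  then have "mon (- a) = inv (mon a)" using Y_closed by (intro comm_inv_char[symmetric]) auto
  then show "mon (- a) \<in> N" using subfield_m_inv(1)[OF N, of "mon a"] a Y_nonzero by simp
qed

lemma fraction_field_in:
  assumes N: "subfield N R" and coeffs: "\<iota> ` carrier k \<subseteq> N" and gens: "\<And>t. mg t \<in> N"
  shows "fraction_field mon UNIV \<subseteq> N"
proof -
  have "monomial_ring mon UNIV \<subseteq> N"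
  proof
    fix z assume "z \<in> monomial_ring mon UNIV"
    then show "z \<in> N" unfolding monomial_ring_def
    proof (induction rule: span_of.induct)
      case zero
      then show ?case using subringE(2)[OF subfieldE(1)[OF N]] .
    next
      case (step a c z)
      then have "c \<in> N" "mon a \<in> N" using coeffs all_monomials_in[OF N gens] by auto
      then show ?case using step.IH subringE(6,7)[OF subfieldE(1)[OF N]] by simp
    qed
  qed
  then show ?thesis unfolding fraction_field_def by (rule quot_field_incl[OF N])
qed

lemma exists_below: "\<exists>t. (a :: 'l index \<Rightarrow>\<^sub>0 int) \<in> below t"
proof -
  have "\<exists>t. \<forall>s\<in>S. t < s" if "finite S" for S :: "'l index set"
    using that
  proof (induction S rule: finite_induct)
    case (insert s S)
    then obtain t where t: "\<forall>s\<in>S. t < s" by blast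
    obtain r where "r < min t s" using unbounded by blast
    then have "\<forall>x\<in>insert s S. r < x" using t by (auto intro: less_trans)
    then show ?case by blast
  qed simp
  then obtain t where t: "\<forall>s\<in>Poly_Mapping.keys a. t < s" using finite_keys by blast
  have "coord a s = 0" if "s \<le> t" for s
  proof (rule ccontr)
    assume "coord a s \<noteq> 0"
    then have "t < s" using t by (simp add: in_keys_iff)
    then show False using that by simp
  qed
  then show ?thesis unfolding below_def by blast
qed

lemma monomial_ring_exhausted: "z \<in> monomial_ring mon UNIV \<Longrightarrow> \<exists>t. z \<in> monomial_ring mon (below t)"
  unfolding monomial_ring_def
proof (induction rule: span_of.induct)
  case zero
  then show ?case using span_of.zero by blast
next
  case (step a c z)
  then obtain s where s: "z \<in> monomial_ring mon (below s)" unfolding monomial_ring_def by blast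
  obtain t where t: "a \<in> below t" using exists_below by blast
  have "z \<in> monomial_ring mon (below (min s t))" "a \<in> below (min s t)"
    using s t monomial_ring_mono[OF below_mono, of "min s t" s mon] below_mono[of "min s t" t] by auto
  then show ?case using span_of.step[of a "below (min s t)" c "\<lambda>_. \<iota> ` carrier k" z mon] step(2)
    unfolding monomial_ring_def by blast
qed

lemma fraction_field_exhausted:
  assumes "x \<in> fraction_field mon UNIV" shows "\<exists>t. x \<in> fraction_field mon (below t)"
proof -
  obtain a b where ab: "a \<in> monomial_ring mon UNIV" "b \<in> monomial_ring mon UNIV" "b \<noteq> \<zero>" "x = a \<otimes> inv b"
    using assms unfolding fraction_field_def quot_field_def by blast
  obtain s t where "a \<in> monomial_ring mon (below s)" "b \<in> monomial_ring mon (below t)"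
    using monomial_ring_exhausted ab(1,2) by blast
  then have "a \<in> monomial_ring mon (below (min s t))" "b \<in> monomial_ring mon (below (min s t))"
    using monomial_ring_mono[OF below_mono, of "min s t" s mon] monomial_ring_mono[OF below_mono, of "min s t" t mon]
    by auto
  then show ?thesis unfolding fraction_field_def quot_field_def using ab(3,4) by blast
qed

lemma algebraic_hull_exhausted:
  assumes x: "x \<in> carrier R" shows "\<exists>t. x \<in> algebraic_hull mon (below t)"
proof -
  interpret U: coarse_section R ord k \<iota> mon UNIV mon
    by unfold_locales (auto simp: mon_cross_section)
  obtain n c where c: "\<And>i. i \<le> n \<Longrightarrow> c i \<in> fraction_field mon UNIV" "c n \<noteq> \<zero>" "poly_value R n c x = \<zero>"
    using algebraic_over_monomials[OF x] algebraic_iff_root[OF U.F_subfield x] unfolding root_over_def by blast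
  have "m \<le> n \<Longrightarrow> \<exists>t. \<forall>i\<le>m. c i \<in> fraction_field mon (below t)" for m
  proof (induction m)
    case 0
    then show ?case using fraction_field_exhausted[OF c(1)[of 0]] by auto
  next
    case (Suc m)
    obtain s where s: "\<forall>i\<le>m. c i \<in> fraction_field mon (below s)" using Suc by auto
    obtain t where t: "c (Suc m) \<in> fraction_field mon (below t)"
      using fraction_field_exhausted[OF c(1)[OF Suc.prems]] by blast
    have "\<forall>i\<le>Suc m. c i \<in> fraction_field mon (below (min s t))"
      using s t fraction_field_mono[OF below_mono, of "min s t" s mon]
        fraction_field_mono[OF below_mono, of "min s t" t mon] by (auto simp: le_Suc_eq)
    then show ?case by blast
  qed
  then obtain t where t: "\<forall>i\<le>n. c i \<in> fraction_field mon (below t)" by blast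
  interpret T: coarse_section R ord k \<iota> mon "below t" mon
    by unfold_locales (auto simp: below_zero below_diff mon_cross_section)
  have "root_over T.F x" unfolding root_over_def using t c(2,3) by blast
  then have "x \<in> T.K" using algebraic_iff_root[OF T.F_subfield x] x unfolding algebraic_hull_def by simp
  then show ?thesis by blast
qed

text \<open>An element algebraic over the monomials is algebraic over those involving only variables
  dominated by some \<open>t\<close>.\<close>

theorem full_complement: "\<exists>C. is_complement C \<and> quot_field R C = carrier R"
proof -
  interpret ladder R ord k \<iota> mon mon by (rule mon_ladder)
  have "(\<Union>t. KK t) = carrier R" using algebraic_hull_exhausted K_closed by blast
  then show ?thesis using is_complement quot_complement by metis
qed

text \<open>Finitely many elements of the quotient field lie in some \<open>KK t\<close>; they are annihilated by the sum of
  the partial derivatives with respect to all \<open>mg (Index n j)\<close> with \<open>n < stage t + 2\<close>, since the new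
  variables dominated by \<open>t\<close> involve only monomials with numbers up to \<open>stage t + 1\<close>.\<close>

theorem small_complement:
  "\<exists>C. is_complement C \<and> subfield (quot_field R C) R \<and>
     transcendence_basis R (quot_field R C) ((\<lambda>j. mg (Index 0 j)) ` J)"
proof -
  obtain Y where Ysh: "cross_section Y" "\<And>t. Y (gen t) = shifted J t"
    using cross_section_prescribed[of "shifted J"] shifted by blast
  interpret ladder R ord k \<iota> mon Y using shifted_ladder[OF Ysh] .
  define K where "K = (\<Union>t. KK t)"
  define B where "B = (\<lambda>j. mg (Index 0 j)) ` J"
  have K: "subfield K R" unfolding K_def by (rule union_subfield)
  have Bc: "B \<subseteq> carrier R" unfolding B_def using mg_closed by auto
  have "algebraically_independent R K B"
  proof (rule algebraically_independentI[OF nat_mult_nonzero K Bc])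
    fix C b assume C: "finite C" "C \<subseteq> K" and b: "b \<in> B"
    obtain j where j: "j \<in> J" "b = mg (Index 0 j)" using b unfolding B_def by blast
    have "\<exists>t. C \<subseteq> KK t" using C
    proof (induction C rule: finite_induct)
      case (insert c C)
      then obtain s t where st: "C \<subseteq> KK s" "c \<in> KK t" unfolding K_def by auto
      have "insert c C \<subseteq> KK (min s t)" using st K_mono[of "min s t" s] K_mono[of "min s t" t] by auto
      then show ?case by blast
    qed simp
    then obtain t where t: "C \<subseteq> KK t" by blast
    obtain D where D: "derivation D" "\<forall>c\<in>carrier k. D (\<iota> c) = \<zero>"
        "\<forall>s. D (mg s) = (if label s = j \<and> stage s < stage t + 2 then \<one> else \<zero>)"
      using partial_derivative[of j "stage t + 2"] by blast
    interpret T: coarse_section R ord k \<iota> mon "below t" Y by (rule section_below)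
    have Dgen: "D (Y (gen s)) = \<zero>" if "t < s" for s
    proof (cases "label s \<in> J")
      case False
      then have "label s \<noteq> j" using j by auto
      then show ?thesis using False D(3) Ysh(2) by (simp add: shifted_def)
    next
      case True
      let ?r = "Index (Suc (stage s)) (label s)"
      have "D (mg s \<ominus> mg ?r) = D (mg s) \<ominus> D (mg ?r)"
        unfolding a_minus_def using der_add[OF D(1)] der_minus[OF D(1)] mg_closed by simp
      moreover have "D (mg s) = D (mg ?r)" using D(3) stage_antimono[OF that] by simp
      ultimately show ?thesis
        using True Ysh(2) der_closed[OF D(1) mg_closed] by (simp add: shifted_def a_minus_def r_neg)
    qed
    have DY: "D (Y a) = \<zero>" if a: "a \<in> below t" for a
    proof (rule value_group_induct)
      fix s assume s: "s \<in> Poly_Mapping.keys a"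
      have "t < s"
      proof (rule ccontr)
        assume "\<not> t < s"
        then have "coord a s = 0" using a unfolding below_def by simp
        then show False using s by (simp add: in_keys_iff)
      qed
      then show "D (Y (gen s)) = \<zero>" by (rule Dgen)
    next
      show "D (Y 0) = \<zero>" using T.Y_zero der_one[OF D(1)] by simp
      show "D (Y (a + b)) = \<zero>" if "D (Y a) = \<zero>" "D (Y b) = \<zero>" for a b
        using der_mult[OF D(1), of "Y a" "Y b"] that T.Y_closed T.Y_add by simp
      show "D (Y (- a)) = \<zero>" if Da: "D (Y a) = \<zero>" for a
      proof -
        have "Y a \<otimes> Y (- a) = \<one>" using T.Y_add[of a "- a"] T.Y_zero by simp
        then have "D (Y a) \<otimes> Y (- a) \<oplus> Y a \<otimes> D (Y (- a)) = \<zero>"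
          using der_mult[OF D(1), of "Y a" "Y (- a)"] der_one[OF D(1)] T.Y_closed by simp
        then have "Y a \<otimes> D (Y (- a)) = \<zero>" using Da T.Y_closed der_closed[OF D(1)] by simp
        then show ?thesis using integral_iff T.Y_closed T.Y_nonzero der_closed[OF D(1)] by blast
      qed
    qed
    have DA: "D z = \<zero>" if "z \<in> T.A" for z
      using that unfolding monomial_ring_def
    proof (induction rule: span_of.induct)
      case zero
      then show ?case using der_zero[OF D(1)] .
    next
      case (step a c z)
      then have c: "c \<in> carrier R" "D c = \<zero>" using D(2) by auto
      have "D (c \<otimes> Y a) = \<zero>" using der_mult[OF D(1) c(1), of "Y a"] c DY[OF step(1)] T.Y_closed by simp
      then show ?case using der_add[OF D(1), of "c \<otimes> Y a" z] c T.Y_closed step.IH T.span_closed[OF step(3)] by simp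
    qed
    have DF: "D x = \<zero>" if "x \<in> T.F" for x
    proof -
      obtain p q where "p \<in> T.A" "q \<in> T.A" "q \<noteq> \<zero>" "x = p \<otimes> inv q"
        using \<open>x \<in> T.F\<close> unfolding fraction_field_def quot_field_def by blast
      then show ?thesis using der_quotient_zero[OF D(1)] DA T.A_closed by blast
    qed
    have DK: "D x = \<zero>" if "x \<in> KK t" for x
      using der_algebraic_zero[OF D(1) nat_mult_nonzero T.F_subfield DF, of x] that
      unfolding algebraic_hull_def by simp
    have "D b = \<one>" using D(3) j by simp
    moreover have "D b' = \<zero>" if "b' \<in> B - {b}" for b'
    proof -
      obtain i where "b' = mg (Index 0 i)" "i \<noteq> j" using \<open>b' \<in> B - {b}\<close> j unfolding B_def by auto
      then show ?thesis using D(3) by simp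
    qed
    moreover have "\<forall>c\<in>C. D c = \<zero>" using DK t by blast
    ultimately show "\<exists>D. derivation D \<and> (\<forall>c\<in>C. D c = \<zero>) \<and> D b = \<one> \<and> (\<forall>b'\<in>B - {b}. D b' = \<zero>)"
      using D(1) by blast
  qed
  moreover have "algebraic (generate_field R (K \<union> B)) x" if x: "x \<in> carrier R" for x
  proof -
    let ?N = "generate_field R (K \<union> B)"
    have KB: "K \<union> B \<subseteq> carrier R" using Bc subfieldE(3)[OF K] by auto
    have N: "subfield ?N R" by (rule generate_field_is_subfield[OF KB])
    have KN: "K \<subseteq> ?N" and BN: "B \<subseteq> ?N" using generate_field.incl[of _ "K \<union> B" R] by auto
    have yN: "shifted J t \<in> ?N" for t
    proof -
      obtain s where "s < t" using unbounded by blast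
      then have "Y (gen t) \<in> KK s" by (intro K_Y single_below)
      then show ?thesis using KN Ysh(2) unfolding K_def by auto
    qed
    have "mg (Index n i) \<in> ?N" for n i
    proof (cases "i \<in> J")
      case False
      then show ?thesis using yN[of "Index n i"] by (simp add: shifted_def)
    next
      case True
      show ?thesis
      proof (induction n)
        case 0
        then show ?case using BN True unfolding B_def by auto
      next
        case (Suc n)
        have "mg (Index (Suc n) i) = mg (Index n i) \<ominus> shifted J (Index n i)"
          using True mg_closed[of "Index (Suc n) i"] mg_closed[of "Index n i"]
          unfolding shifted_def by (simp, algebra)
        then show ?case using Suc yN[of "Index n i"] subringE(5,7)[OF subfieldE(1)[OF N]] unfolding a_minus_def by simp
      qed
    qed
    then have gens: "mg t \<in> ?N" for t by (cases t) auto
    have "\<iota> ` carrier k \<subseteq> ?N" using KN K_iota unfolding K_def by auto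
    then have "fraction_field mon UNIV \<subseteq> ?N" using fraction_field_in[OF N _ gens] by blast
    then show ?thesis using algebraic_mono algebraic_over_monomials[OF x] unfolding over_def by blast
  qed
  ultimately have "transcendence_basis R K B" unfolding transcendence_basis_def by blast
  then show ?thesis using is_complement K quot_complement unfolding K_def B_def by metis
qed

lemma mg_inj: "inj mg"
proof (rule injI)
  fix s t assume "mg s = mg t"
  then have "gen s = gen t" using ord_mg by metis
  then have "coord (gen s) t = 1" by simp
  then show "s = t" by (simp add: lookup_single when_def split: if_splits)
qed

end

section \<open>Valuations\<close>

text \<open>The value group is copied into an arbitrary type by \<open>emb\<close>, and the value \<open>\<infinity>\<close> of \<open>\<zero>\<close> is added.\<close>

locale embedded_values = monomial_field R ord k \<iota> mon
  for R :: "('a, 'r) ring_scheme" (structure) and ord :: "'a \<Rightarrow> 'g::linordered_ab_group_add"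
    and k :: "('k, 'm) ring_scheme" and \<iota> :: "'k \<Rightarrow> 'a" and mon +
  fixes emb :: "'g \<Rightarrow> 'e"
  assumes inj_emb: "inj emb"
begin

definition G :: "'e monoid" where
  "G = \<lparr>carrier = range emb, monoid.mult = (\<lambda>a b. emb (the_inv emb a + the_inv emb b)), one = emb 0\<rparr>"

definition gle :: "'e rel" where "gle = {(emb a, emb b) | a b. a \<le> b}"

definition v :: "'a \<Rightarrow> 'e option" where "v x = (if x = \<zero> then None else Some (emb (ord x)))"

lemma emb_eq [simp]: "emb a = emb b \<longleftrightarrow> a = b" using inj_emb by (auto dest: injD)

lemma the_inv_emb [simp]: "the_inv emb (emb a) = a" using the_inv_f_f[OF inj_emb] .

lemma G_simps: "carrier G = range emb" "\<one>\<^bsub>G\<^esub> = emb 0" "emb a \<otimes>\<^bsub>G\<^esub> emb b = emb (a + b)"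
  by (simp_all add: G_def)

lemma gle_emb [simp]: "(emb a, emb b) \<in> gle \<longleftrightarrow> a \<le> b"
  unfolding gle_def by auto

lemma G_ordered: "ordered_abelian_group G gle"
proof -
  have "comm_group G"
  proof (rule comm_groupI)
    fix x assume "x \<in> carrier G"
    then obtain a where a: "x = emb a" unfolding G_simps by auto
    show "\<exists>y\<in>carrier G. y \<otimes>\<^bsub>G\<^esub> x = \<one>\<^bsub>G\<^esub>"
      by (rule bexI[of _ "emb (- a)"]) (auto simp: G_simps a)
  qed (auto simp: G_simps algebra_simps)
  moreover have "linear_order_on (carrier G) gle"
    unfolding linear_order_on_def partial_order_on_def preorder_on_def refl_on_def trans_def antisym_def
      total_on_def G_simps gle_def by auto
  moreover have "(x \<otimes>\<^bsub>G\<^esub> z, y \<otimes>\<^bsub>G\<^esub> z) \<in> gle" if xy: "(x, y) \<in> gle" and z: "z \<in> carrier G" for x y z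
  proof -
    obtain a b c where "x = emb a" "y = emb b" "a \<le> b" "z = emb c"
      using xy z unfolding gle_def G_simps by auto
    then show ?thesis by (simp add: G_simps)
  qed
  ultimately show ?thesis
    unfolding ordered_abelian_group_def ordered_abelian_group_axioms_def by blast
qed

abbreviation "Ov \<equiv> val_ring R G gle v"
abbreviation "Mv \<equiv> val_ideal R G gle v"
abbreviation "res \<equiv> residue R G gle v"

lemma val_le_ge: "val_le gle (Some (emb a)) (v x) \<longleftrightarrow> ge x a"
  unfolding val_le_def v_def ge_def by auto

lemma val_le_v: "val_le gle (v x) (v y) \<longleftrightarrow> y = \<zero> \<or> x \<noteq> \<zero> \<and> ord x \<le> ord y"
  unfolding val_le_def v_def by auto

lemma valued: "valued_field R G gle v"
proof -
  have 1: "v ` (carrier R - {\<zero>}) = Some ` carrier G"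
  proof
    show "v ` (carrier R - {\<zero>}) \<subseteq> Some ` carrier G" unfolding v_def G_simps by auto
    show "Some ` carrier G \<subseteq> v ` (carrier R - {\<zero>})"
    proof
      fix y assume "y \<in> Some ` carrier G"
      then obtain a where "y = Some (emb a)" unfolding G_simps by auto
      then have "y = v (mon a)" unfolding v_def using mon_nonzero[of a] ord_mon by auto
      then show "y \<in> v ` (carrier R - {\<zero>})" using mon_nonzero[of a] by blast
    qed
  qed
  have 2: "v (x \<otimes> y) = Some (a \<otimes>\<^bsub>G\<^esub> b)"
    if "x \<in> carrier R" "y \<in> carrier R" "v x = Some a" "v y = Some b" for x y a b
    using that ord_mult[of x y] unfolding v_def by (auto simp: G_simps split: if_splits)
  have 3: "val_le gle (v x) (v (x \<oplus> y)) \<or> val_le gle (v y) (v (x \<oplus> y))"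
    if "x \<in> carrier R" "y \<in> carrier R" for x y
    unfolding val_le_v using that ord_add'[of x y]
    by (cases "x = \<zero>"; cases "y = \<zero>") (auto simp: min_le_iff_disj)
  show ?thesis
    unfolding valued_field_def valued_field_axioms_def
    using field_axioms G_ordered 1 2 3 by (auto simp: v_def)
qed

lemma val_ring_eq: "Ov = {x \<in> carrier R. ge x 0}"
  unfolding val_ring_def G_simps val_le_ge ..

lemma val_ideal_eq: "Mv = {x \<in> carrier R. gt x 0}"
  unfolding val_ideal_def val_ring_eq G_simps by (auto simp: v_def ge_def gt_def)

abbreviation "Oring \<equiv> R\<lparr>carrier := Ov\<rparr>"

lemma iota_in_ring: "c \<in> carrier k \<Longrightarrow> \<iota> c \<in> Ov"
  unfolding val_ring_eq using ord_iota[of c] by (cases "c = \<zero>\<^bsub>k\<^esub>") (auto simp: ge_def)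

lemma val_subring: "subring (Ov) R"
proof -
  have "ge \<one> 0" by (simp add: ge_def)
  then show ?thesis unfolding val_ring_eq using ge_mult[of _ _ 0 0]
    by (intro subringI) (auto simp: ge_add)
qed

lemma Oring_ring: "ring Oring" using subring_is_ring[OF val_subring] .

lemma Oring_minus: "x \<in> Ov \<Longrightarrow> y \<in> Ov \<Longrightarrow> x \<ominus>\<^bsub>Oring\<^esub> y = x \<ominus> y"
proof -
  assume xy: "x \<in> Ov" "y \<in> Ov"
  interpret O: ring Oring by (rule Oring_ring)
  have my: "\<ominus> y \<in> Ov" "y \<in> carrier R"
    using xy(2) subringE(1,5)[OF val_subring] by auto
  then have "\<ominus>\<^bsub>Oring\<^esub> y = \<ominus> y" using O.minus_equality[of "\<ominus> y" y] xy(2) by (simp add: l_neg)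
  then show ?thesis by (simp add: a_minus_def)
qed

lemma val_ideal_ideal: "ideal (Mv) Oring"
proof (rule idealI)
  interpret O: ring Oring by (rule Oring_ring)
  show "ring Oring" by (rule Oring_ring)
  have neg: "\<ominus>\<^bsub>Oring\<^esub> y = \<ominus> y" if "y \<in> Ov" for y
  proof -
    have "\<ominus> y \<in> Ov" "y \<in> carrier R" using that subringE(1,5)[OF val_subring] by auto
    then show ?thesis using O.minus_equality[of "\<ominus> y" y] that by (simp add: l_neg)
  qed
  show "subgroup (Mv) (add_monoid Oring)"
  proof (rule O.add.subgroupI)
    show "Mv \<subseteq> carrier Oring"
      unfolding val_ideal_eq val_ring_eq by (auto intro: gt_imp_ge)
    show "Mv \<noteq> {}" unfolding val_ideal_eq using gt_zero[of 0] by blast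
    show "\<ominus>\<^bsub>Oring\<^esub> a \<in> Mv" if "a \<in> Mv" for a
    proof -
      have "a \<in> Ov" using that unfolding val_ideal_eq val_ring_eq by (auto intro: gt_imp_ge)
      then show ?thesis using neg[of a] that by (simp add: val_ideal_eq)
    qed
    show "a \<oplus>\<^bsub>Oring\<^esub> b \<in> Mv"
      if "a \<in> Mv" "b \<in> Mv" for a b
      using that unfolding val_ideal_eq by (auto intro: gt_add)
  qed
  fix a x assume a: "a \<in> Mv" and x: "x \<in> carrier Oring"
  have "a \<otimes> x \<in> Mv"
    using a x gt_mult[of a x 0 0] unfolding val_ideal_eq val_ring_eq by auto
  moreover have "x \<otimes> a = a \<otimes> x"
    using a x unfolding val_ideal_eq val_ring_eq by (auto intro: m_comm)
  ultimately show "x \<otimes>\<^bsub>Oring\<^esub> a \<in> Mv" "a \<otimes>\<^bsub>Oring\<^esub> x \<in> Mv" by auto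
qed

lemma residue_eq_iff:
  assumes "x \<in> Ov" "y \<in> Ov"
  shows "res x = res y \<longleftrightarrow> gt (x \<ominus> y) 0"
proof -
  have "x \<ominus>\<^bsub>Oring\<^esub> y \<in> Mv \<longleftrightarrow> res x = res y"
    unfolding residue_def
    by (rule ring.quotient_eq_iff_same_a_r_cos[OF Oring_ring val_ideal_ideal]) (use assms in auto)
  then show ?thesis
    unfolding Oring_minus[OF assms] val_ideal_eq using assms subringE(1)[OF val_subring] by auto
qed

text \<open>The elements of \<open>k\<close> represent all residues, and differences of different ones are units.\<close>

lemma residue_field: "has_residue_field R G gle v k \<iota>"
proof -
  interpret I: ideal "Mv" Oring by (rule val_ideal_ideal)
  have hom: "\<iota> \<in> ring_hom k Oring"
    using iota_hom iota_in_ring unfolding ring_hom_def by auto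
  have res: "res \<in> ring_hom Oring (residue_field R G gle v)"
    using I.rcos_ring_hom unfolding residue_def residue_field_def by (simp add: eta_contract_eq)
  have "res \<circ> \<iota> \<in> ring_hom k (residue_field R G gle v)"
    by (rule ring_hom_trans[OF hom res])
  moreover have "bij_betw (res \<circ> \<iota>) (carrier k) (carrier (residue_field R G gle v))"
    unfolding bij_betw_def
  proof
    show "inj_on (res \<circ> \<iota>) (carrier k)"
    proof (rule inj_onI)
      fix c d assume cd: "c \<in> carrier k" "d \<in> carrier k" "(res \<circ> \<iota>) c = (res \<circ> \<iota>) d"
      then have "gt (\<iota> c \<ominus> \<iota> d) 0" using residue_eq_iff[of "\<iota> c" "\<iota> d"] iota_in_ring by simp
      moreover have "\<iota> c \<ominus> \<iota> d = \<iota> (c \<ominus>\<^bsub>k\<^esub> d)" using cd by (simp add: a_minus_def)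
      ultimately have "gt (\<iota> (c \<ominus>\<^bsub>k\<^esub> d)) 0" by simp
      then have "c \<ominus>\<^bsub>k\<^esub> d = \<zero>\<^bsub>k\<^esub>"
        using ord_iota[of "c \<ominus>\<^bsub>k\<^esub> d"] iota_eq_zero[of "c \<ominus>\<^bsub>k\<^esub> d"] cd unfolding gt_def
        by (metis coef.minus_closed less_irrefl)
      then show "c = d" using cd coef.r_right_minus_eq by simp
    qed
    show "(res \<circ> \<iota>) ` carrier k = carrier (residue_field R G gle v)"
    proof
      show "(res \<circ> \<iota>) ` carrier k \<subseteq> carrier (residue_field R G gle v)"
        using ring_hom_closed[OF \<open>res \<circ> \<iota> \<in> ring_hom k (residue_field R G gle v)\<close>]
        by (intro image_subsetI)
      show "carrier (residue_field R G gle v) \<subseteq> (res \<circ> \<iota>) ` carrier k"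
      proof
        fix z assume "z \<in> carrier (residue_field R G gle v)"
        then obtain x where x: "x \<in> Ov" "z = res x"
          unfolding residue_field_def residue_def FactRing_def A_RCOSETS_def' by auto
        obtain c where c: "c \<in> carrier k" "gt (x \<ominus> \<iota> c) 0"
          using residue_exists[of x] x(1) unfolding val_ring_eq by auto
        then have "res x = res (\<iota> c)"
          using residue_eq_iff[OF x(1) iota_in_ring] by simp
        then show "z \<in> (res \<circ> \<iota>) ` carrier k" using x(2) c(1) by auto
      qed
    qed
  qed
  ultimately show ?thesis
    unfolding has_residue_field_def ring_iso_def using iota_hom iota_in_ring by auto
qed

lemma complement_k_algebra: "is_complement C \<Longrightarrow> k_algebra R k \<iota> C"
  unfolding is_complement_def k_algebra_def by blast

lemma complement_additive:
  assumes "is_complement C" shows "additive_complement R (Ov) C"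
proof -
  have sub: "additive_subgroup C R" and neg: "\<And>z. z \<in> C \<Longrightarrow> z \<noteq> \<zero> \<Longrightarrow> ord z < 0"
    and approx: "\<And>a. a \<in> carrier R \<Longrightarrow> \<exists>r\<in>C. ge (a \<ominus> r) 0"
    using assms unfolding is_complement_def by auto
  have "C \<inter> Ov = {\<zero>}"
  proof
    show "C \<inter> Ov \<subseteq> {\<zero>}"
      using neg unfolding val_ring_eq ge_def by force
    show "{\<zero>} \<subseteq> C \<inter> Ov"
      using additive_subgroup.zero_closed[OF sub] unfolding val_ring_eq by simp
  qed
  moreover have "C <+>\<^bsub>R\<^esub> Ov = carrier R"
  proof
    show "C <+>\<^bsub>R\<^esub> Ov \<subseteq> carrier R"
      unfolding set_add_def' val_ring_eq using additive_subgroup.a_Hcarr[OF sub] by auto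
    show "carrier R \<subseteq> C <+>\<^bsub>R\<^esub> Ov"
    proof
      fix a assume a: "a \<in> carrier R"
      obtain r where r: "r \<in> C" "ge (a \<ominus> r) 0" using approx[OF a] by blast
      have rc: "r \<in> carrier R" using additive_subgroup.a_Hcarr[OF sub r(1)] .
      then have "a = r \<oplus> (a \<ominus> r)" using a by algebra
      moreover have "a \<ominus> r \<in> Ov" unfolding val_ring_eq using a rc r(2) by simp
      ultimately show "a \<in> C <+>\<^bsub>R\<^esub> Ov" unfolding set_add_def' using r(1) by blast
    qed
  qed
  ultimately show ?thesis unfolding additive_complement_def using sub by blast
qed

end

section \<open>Integer parts\<close>

context ordered_field
begin

lemma le_carrier: "(x, y) \<in> leq \<Longrightarrow> x \<in> carrier F \<and> y \<in> carrier F"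
proof -
  have "leq \<subseteq> carrier F \<times> carrier F"
    using le_linear unfolding linear_order_on_def partial_order_on_def preorder_on_def by simp
  then show "(x, y) \<in> leq \<Longrightarrow> x \<in> carrier F \<and> y \<in> carrier F" by auto
qed

lemma le_refl: "x \<in> carrier F \<Longrightarrow> (x, x) \<in> leq"
  using le_linear unfolding linear_order_on_def partial_order_on_def preorder_on_def
  by (auto dest: refl_onD)

lemma le_antisym: "(x, y) \<in> leq \<Longrightarrow> (y, x) \<in> leq \<Longrightarrow> x = y"
  using le_linear antisymD[of leq x y] unfolding linear_order_on_def partial_order_on_def by simp

lemma le_trans: "(x, y) \<in> leq \<Longrightarrow> (y, z) \<in> leq \<Longrightarrow> (x, z) \<in> leq"
  using le_linear transD[of leq x y z]
  unfolding linear_order_on_def partial_order_on_def preorder_on_def by simp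

lemma le_total: "x \<in> carrier F \<Longrightarrow> y \<in> carrier F \<Longrightarrow> (x, y) \<in> leq \<or> (y, x) \<in> leq"
  using le_linear le_refl[of x] unfolding linear_order_on_def total_on_def by (cases "x = y") simp_all

lemma le_cancel:
  assumes "x \<in> carrier F" "y \<in> carrier F" "z \<in> carrier F"
  shows "(x \<oplus> z, y \<oplus> z) \<in> leq \<longleftrightarrow> (x, y) \<in> leq"
proof
  assume "(x \<oplus> z, y \<oplus> z) \<in> leq"
  then have "(x \<oplus> z \<oplus> \<ominus> z, y \<oplus> z \<oplus> \<ominus> z) \<in> leq" by (rule le_add) (use assms in simp)
  moreover have "x \<oplus> z \<oplus> \<ominus> z = x" "y \<oplus> z \<oplus> \<ominus> z = y" using assms by algebra+
  ultimately show "(x, y) \<in> leq" by simp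
qed (use le_add assms in blast)

lemma le_add_mono:
  assumes "(x, y) \<in> leq" "(z, w) \<in> leq" shows "(x \<oplus> z, y \<oplus> w) \<in> leq"
proof -
  note c = le_carrier[OF assms(1)] le_carrier[OF assms(2)]
  have "(x \<oplus> z, y \<oplus> z) \<in> leq" using le_add assms c by blast
  moreover have "(y \<oplus> z, y \<oplus> w) \<in> leq" using le_add[OF assms(2), of y] c a_comm by simp
  ultimately show ?thesis by (rule le_trans)
qed

lemma le_diff: "x \<in> carrier F \<Longrightarrow> y \<in> carrier F \<Longrightarrow> (x, y) \<in> leq \<longleftrightarrow> (\<zero>, y \<ominus> x) \<in> leq"
  using le_cancel[of \<zero> "y \<ominus> x" x] by (simp add: a_minus_def a_assoc l_neg)

lemma le_minus: "(x, y) \<in> leq \<Longrightarrow> (\<ominus> y, \<ominus> x) \<in> leq"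
  using le_diff[of x y] le_diff[of "\<ominus> y" "\<ominus> x"] le_carrier[of x y] by (auto simp: a_minus_def a_comm)

lemma zero_le_one: "(\<zero>, \<one>) \<in> leq"
proof (rule ccontr)
  assume n: "(\<zero>, \<one>) \<notin> leq"
  then have "(\<one>, \<zero>) \<in> leq" using le_total by blast
  then have "(\<zero>, \<ominus> \<one>) \<in> leq" using le_minus[of \<one> \<zero>] by simp
  then have "(\<zero>, \<ominus> \<one> \<otimes> \<ominus> \<one>) \<in> leq" using le_mult by blast
  then show False using n by (simp add: l_minus)
qed

definition int_of :: "int \<Rightarrow> 'a" where "int_of n = [n] \<cdot> \<one>"

lemma int_of_closed [simp]: "int_of n \<in> carrier F" unfolding int_of_def by simp
lemma int_of_0: "int_of 0 = \<zero>" unfolding int_of_def by (simp add: add_pow_int_ge)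
lemma int_of_1: "int_of 1 = \<one>" unfolding int_of_def by (simp add: add_pow_int_ge)
lemma int_of_add: "int_of (m + n) = int_of m \<oplus> int_of n" unfolding int_of_def by (simp add: add.int_pow_mult)
lemma int_of_minus: "int_of (- n) = \<ominus> int_of n" unfolding int_of_def by (simp add: add.int_pow_neg)
lemma int_of_nat: "int_of (int n) = [n] \<cdot> \<one>" unfolding int_of_def by (simp add: add_pow_int_ge)

lemma int_of_mult: "int_of (m * n) = int_of m \<otimes> int_of n"
proof -
  have "int_of m \<otimes> int_of n = [m] \<cdot> ([n] \<cdot> \<one>)" unfolding int_of_def by (simp add: add_pow_ldistr_int)
  also have "\<dots> = [(n * m)] \<cdot> \<one>" by (simp add: add.int_pow_pow)
  finally show ?thesis unfolding int_of_def by (simp add: mult.commute)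
qed

lemma int_of_mono: "m \<le> n \<Longrightarrow> (int_of m, int_of n) \<in> leq"
proof (induction n rule: int_ge_induct)
  case (step n)
  have "(int_of n \<oplus> \<zero>, int_of n \<oplus> \<one>) \<in> leq" using le_add_mono[OF le_refl zero_le_one] by simp
  then have "(int_of n, int_of (n + 1)) \<in> leq" by (simp add: int_of_add int_of_1)
  then show ?case using le_trans step by blast
qed (simp add: le_refl)

lemma floor_exists:
  assumes b: "b \<in> carrier F" "(b, int_of (int m)) \<in> leq" "(int_of (- int n), b) \<in> leq"
  shows "\<exists>i. (int_of i, b) \<in> leq \<and> (int_of (i + 1), b) \<notin> leq"
proof (rule ccontr)
  assume n: "\<not> ?thesis"
  have "(int_of i, b) \<in> leq" if "- int n \<le> i" for i
    using that
  proof (induction i rule: int_ge_induct)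
    case base
    then show ?case using b by simp
  next
    case (step i)
    then show ?case using n by blast
  qed
  then have "(int_of (int m + 1), b) \<in> leq" by simp
  then have "(int_of (int m) \<oplus> \<one>, int_of (int m)) \<in> leq" using b(2) le_trans by (auto simp: int_of_add int_of_1)
  then have "(\<one> \<oplus> int_of (int m), \<zero> \<oplus> int_of (int m)) \<in> leq" by (simp add: a_comm)
  then have "(\<one>, \<zero>) \<in> leq" using le_cancel[of \<one> \<zero> "int_of (int m)"] by simp
  then show False using le_antisym zero_le_one one_not_zero by blast
qed

end

context embedded_values
begin

text \<open>Adding the integers to a complement yields an integer part: elements outside of the
  valuation ring are infinitely large, so the complement has no elements between \<open>0\<close> and \<open>1\<close>, and
  the residue field is archimedean, so elements of the valuation ring have integer floors.\<close>

lemma complement_integer_part: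
  assumes C: "is_complement C" and s: "s \<in> C" "s \<noteq> \<zero>"
    and arch: "archimedean_ordered_field k kle" and leq: "ordered_field R leq"
    and comp: "compatible R gle v leq" and ind: "induces R G gle v leq k \<iota> kle"
  shows "\<exists>I. integer_part R leq I \<and> quot_field R I = quot_field R C"
proof -
  interpret ordered_field R leq by (rule leq)
  interpret ko: archimedean_ordered_field k kle by (rule arch)
  have sub: "additive_subgroup C R" and Cmult: "\<And>y z. y \<in> C \<Longrightarrow> z \<in> C \<Longrightarrow> y \<otimes> z \<in> C"
    and scale: "\<And>c z. c \<in> carrier k \<Longrightarrow> z \<in> C \<Longrightarrow> \<iota> c \<otimes> z \<in> C"
    and neg: "\<And>z. z \<in> C \<Longrightarrow> z \<noteq> \<zero> \<Longrightarrow> ord z < 0"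
    and approx: "\<And>a. a \<in> carrier R \<Longrightarrow> \<exists>r\<in>C. ge (a \<ominus> r) 0"
    using C unfolding is_complement_def by auto
  note Cc = additive_subgroup.a_Hcarr[OF sub]
  note Cadd = additive_subgroup.a_closed[OF sub] and Czero = additive_subgroup.zero_closed[OF sub]
    and Cinv = additive_subgroup.a_inv_closed[OF sub]
  have iota_nat: "\<iota> ([n] \<cdot>\<^bsub>k\<^esub> \<one>\<^bsub>k\<^esub>) = [n] \<cdot> \<one>" for n :: nat by (induction n) auto
  have iota_int: "\<exists>c\<in>carrier k. int_of n = \<iota> c" for n
  proof (cases "n \<ge> 0")
    case True
    then have "int_of n = \<iota> ([nat n] \<cdot>\<^bsub>k\<^esub> \<one>\<^bsub>k\<^esub>)" unfolding iota_nat by (simp add: int_of_nat[symmetric])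
    then show ?thesis by (rule bexI) simp
  next
    case False
    then have "int_of n = \<ominus> int_of (int (nat (- n)))" by (simp add: int_of_minus[symmetric])
    also have "\<dots> = \<iota> (\<ominus>\<^bsub>k\<^esub> ([nat (- n)] \<cdot>\<^bsub>k\<^esub> \<one>\<^bsub>k\<^esub>))" unfolding int_of_nat by (simp add: iota_nat)
    finally show ?thesis by (rule bexI) simp
  qed
  have ge_int: "ge (int_of n) 0" for n using iota_int[of n] iota_in_ring unfolding val_ring_eq by auto
  have scale_int: "int_of n \<otimes> z \<in> C" if "z \<in> C" for n z using iota_int[of n] scale that by auto
  have large: "\<not> (y, \<one>) \<in> leq" if y: "(\<zero>, y) \<in> leq" "y \<noteq> \<zero>" "\<not> ge y 0" for y
  proof
    assume "(y, \<one>) \<in> leq"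
    then have "val_le gle (v \<one>) (v y)" using comp y(1,2) unfolding compatible_def by auto
    then show False using y(2,3) one_neq_zero unfolding val_le_v ge_def by auto
  qed
  have small: "(y, \<one>) \<in> leq" if y: "y \<in> carrier R" "gt y 0" for y
  proof (rule ccontr)
    assume n: "(y, \<one>) \<notin> leq"
    then have "(\<one>, y) \<in> leq" using le_total y by blast
    then have "val_le gle (v y) (v \<one>)" using comp zero_le_one one_neq_zero unfolding compatible_def by auto
    then have "y \<noteq> \<zero>" "ord y \<le> 0" unfolding val_le_v using one_neq_zero by auto
    then show False using y(2) by (auto simp: gt_def)
  qed
  have bounded: "\<exists>m. (b, int_of (int m)) \<in> leq" if b: "b \<in> carrier R" "ge b 0" for b
  proof -
    obtain c where c: "c \<in> carrier k" "gt (b \<ominus> \<iota> c) 0" using residue_exists b by blast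
    obtain m where m: "(c, [(m::nat)] \<cdot>\<^bsub>k\<^esub> \<one>\<^bsub>k\<^esub>) \<in> kle" using ko.archimedean[OF c(1)] by blast
    have mk: "[m] \<cdot>\<^bsub>k\<^esub> \<one>\<^bsub>k\<^esub> \<in> carrier k" by simp
    have "(res (\<iota> c), res (\<iota> ([m] \<cdot>\<^bsub>k\<^esub> \<one>\<^bsub>k\<^esub>))) \<in> residue_order R G gle v leq"
      using ind c(1) mk m unfolding induces_def by blast
    then obtain x y where xy: "res (\<iota> c) = res x"
        "res (\<iota> ([m] \<cdot>\<^bsub>k\<^esub> \<one>\<^bsub>k\<^esub>)) = res y"
        "x \<in> Ov" "y \<in> Ov" "(x, y) \<in> leq"
      unfolding residue_order_def by blast
    have e1: "gt (\<iota> c \<ominus> x) 0" using residue_eq_iff[OF iota_in_ring[OF c(1)] xy(3)] xy(1) by simp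
    have e2: "gt ([m] \<cdot> \<one> \<ominus> y) 0" using residue_eq_iff[OF iota_in_ring[OF mk] xy(4)] xy(2) iota_nat by simp
    have cl: "x \<in> carrier R" "y \<in> carrier R" "\<iota> c \<in> carrier R" "[m] \<cdot> \<one> \<in> carrier R"
      using xy(3,4) c(1) unfolding val_ring_eq by auto
    define e where "e = ((b \<ominus> \<iota> c) \<oplus> (\<iota> c \<ominus> x)) \<oplus> \<ominus> ([m] \<cdot> \<one> \<ominus> y)"
    have e: "e \<in> carrier R" "gt e 0" unfolding e_def using cl b c(2) e1 e2 by (auto intro!: gt_add)
    have "(x \<oplus> e, y \<oplus> e) \<in> leq" using le_add xy(5) e(1) by blast
    moreover have "b = (x \<oplus> e) \<oplus> ([m] \<cdot> \<one> \<ominus> y)" unfolding e_def using cl b(1) by algebra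
    moreover have "(y \<oplus> e) \<oplus> ([m] \<cdot> \<one> \<ominus> y) = [m] \<cdot> \<one> \<oplus> e" using cl e(1) by algebra
    ultimately have "(b, [m] \<cdot> \<one> \<oplus> e) \<in> leq" using le_add[of "x \<oplus> e" "y \<oplus> e" "[m] \<cdot> \<one> \<ominus> y"] cl by simp
    moreover have "([m] \<cdot> \<one> \<oplus> e, [m] \<cdot> \<one> \<oplus> \<one>) \<in> leq"
      using le_add_mono[OF le_refl[OF cl(4)] small[OF e]] .
    moreover have "[m] \<cdot> \<one> \<oplus> \<one> = int_of (int (Suc m))" unfolding int_of_nat by simp
    ultimately show ?thesis using le_trans by metis
  qed
  define I where "I = {r \<oplus> int_of n | r n. r \<in> C}"
  have II: "r \<oplus> int_of n \<in> I" if "r \<in> C" for r n unfolding I_def using that by blast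
  have IE: "\<exists>r n. r \<in> C \<and> x = r \<oplus> int_of n" if "x \<in> I" for x using that unfolding I_def by blast
  have CI: "r \<in> I" if "r \<in> C" for r using II[OF that, of 0] Cc[OF that] by (simp add: int_of_0)
  have ideal: "x \<otimes> r \<in> C" if "x \<in> I" "r \<in> C" for x r
  proof -
    obtain y n where y: "y \<in> C" "x = y \<oplus> int_of n" using IE \<open>x \<in> I\<close> by blast
    have "x \<otimes> r = y \<otimes> r \<oplus> int_of n \<otimes> r" unfolding y(2) using Cc y(1) that(2) by (simp add: l_distr)
    then show ?thesis using Cadd Cmult scale_int y(1) that(2) by simp
  qed
  have Ic: "x \<in> carrier R" if "x \<in> I" for x using IE[OF that] Cc by auto
  have subring: "subring I R"
  proof (rule subringI)
    show "I \<subseteq> carrier R" using Ic by blast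
    show "\<one> \<in> I" using II[OF Czero, of 1] by (simp add: int_of_1)
    fix x assume x: "x \<in> I"
    then obtain r n where r: "r \<in> C" "x = r \<oplus> int_of n" using IE by blast
    have "\<ominus> x = \<ominus> r \<oplus> int_of (- n)" unfolding r(2) int_of_minus using Cc[OF r(1)] by (simp add: minus_add)
    then show "\<ominus> x \<in> I" using II[OF Cinv[OF r(1)]] by simp
    fix y assume y: "y \<in> I"
    then obtain q m where q: "q \<in> C" "y = q \<oplus> int_of m" using IE by blast
    have "x \<oplus> y = (r \<oplus> q) \<oplus> int_of (n + m)" unfolding r(2) q(2) int_of_add
      using Cc[OF r(1)] Cc[OF q(1)] int_of_closed[of n] int_of_closed[of m] by algebra
    then show "x \<oplus> y \<in> I" using II[OF Cadd[OF r(1) q(1)]] by simp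
    have "x \<otimes> y = (x \<otimes> q \<oplus> int_of m \<otimes> r) \<oplus> int_of (n * m)" unfolding r(2) q(2) int_of_mult
      using Cc[OF r(1)] Cc[OF q(1)] int_of_closed[of n] int_of_closed[of m] by algebra
    then show "x \<otimes> y \<in> I" using II[OF Cadd[OF ideal[OF x q(1)] scale_int[OF r(1)]]] by simp
  qed
  have discrete: "\<not> ((\<zero>, x) \<in> strict leq \<and> (x, \<one>) \<in> strict leq)" if xI: "x \<in> I" for x
  proof
    assume x: "(\<zero>, x) \<in> strict leq \<and> (x, \<one>) \<in> strict leq"
    obtain r n where r: "r \<in> C" "x = r \<oplus> int_of n" using IE[OF xI] by blast
    show False
    proof (cases "r = \<zero>")
      case True
      then have xn: "x = int_of n" using r by simp
      show False
      proof (cases "n \<le> 0")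
        case True
        then have "(x, \<zero>) \<in> leq" using int_of_mono[of n 0] xn int_of_0 by simp
        then show False using x le_antisym by blast
      next
        case False
        then have "(\<one>, x) \<in> leq" using int_of_mono[of 1 n] xn int_of_1 by simp
        then show False using x le_antisym by blast
      qed
    next
      case False
      have "\<not> ge x 0"
      proof
        assume "ge x 0"
        then have "ge (x \<ominus> int_of n) 0" using ge_diff ge_int Ic[OF xI] by simp
        moreover have "x \<ominus> int_of n = r" unfolding r(2) using Cc[OF r(1)] int_of_closed[of n] by algebra
        ultimately show False using neg[OF r(1) False] False by (simp add: ge_def)
      qed
      then show False using large[of x] x by auto
    qed
  qed
  have floor: "\<exists>r\<in>I. (r, a) \<in> leq \<and> (a, r \<oplus> \<one>) \<in> strict leq" if a: "a \<in> carrier R" for a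
  proof -
    obtain r where r: "r \<in> C" "ge (a \<ominus> r) 0" using approx[OF a] by blast
    have rc: "r \<in> carrier R" using Cc[OF r(1)] .
    define b where "b = a \<ominus> r"
    have b: "b \<in> carrier R" "ge b 0" "\<ominus> b \<in> carrier R" "ge (\<ominus> b) 0" unfolding b_def using a rc r(2) by auto
    obtain m where m: "(b, int_of (int m)) \<in> leq" using bounded[OF b(1,2)] by blast
    obtain n where n: "(\<ominus> b, int_of (int n)) \<in> leq" using bounded[OF b(3,4)] by blast
    have n': "(int_of (- int n), b) \<in> leq" using le_minus[OF n] b by (simp add: int_of_minus)
    obtain i where i: "(int_of i, b) \<in> leq" "(int_of (i + 1), b) \<notin> leq"
      using floor_exists[OF b(1) m n'] by blast
    have ab: "a = b \<oplus> r" unfolding b_def using a rc by algebra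
    have "(r \<oplus> int_of i, a) \<in> leq" using le_add[OF i(1) rc] ab rc by (simp add: a_comm)
    moreover have "(a, r \<oplus> int_of i \<oplus> \<one>) \<in> strict leq"
    proof -
      have eq: "r \<oplus> int_of i \<oplus> \<one> = int_of (i + 1) \<oplus> r"
        unfolding int_of_add int_of_1 using rc int_of_closed[of i] one_closed by algebra
      have "(b, int_of (i + 1)) \<in> leq" using i(2) le_total b(1) int_of_closed by blast
      then have "(a, r \<oplus> int_of i \<oplus> \<one>) \<in> leq" unfolding eq ab using le_add rc by blast
      moreover have "a \<noteq> r \<oplus> int_of i \<oplus> \<one>"
      proof
        assume "a = r \<oplus> int_of i \<oplus> \<one>"
        then have "b \<oplus> r = int_of (i + 1) \<oplus> r" using ab eq by simp
        then have "b = int_of (i + 1)" using b(1) rc by simp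
        then show False using i(2) le_refl b(1) by simp
      qed
      ultimately show ?thesis by simp
    qed
    ultimately show ?thesis using II[OF r(1)] by blast
  qed
  have "quot_field R I = quot_field R C"
  proof
    show "quot_field R C \<subseteq> quot_field R I" unfolding quot_field_def using CI by blast
    show "quot_field R I \<subseteq> quot_field R C"
    proof
      fix x assume "x \<in> quot_field R I"
      then obtain a b where ab: "a \<in> I" "b \<in> I" "b \<noteq> \<zero>" "x = a \<otimes> inv b" unfolding quot_field_def by blast
      have cl: "a \<in> carrier R" "b \<in> carrier R" "s \<in> carrier R" using ab Ic Cc s by auto
      have ib: "inv b \<in> carrier R" "b \<otimes> inv b = \<one>" "inv s \<in> carrier R" "s \<otimes> inv s = \<one>"
        using cl ab(3) s(2) field_Units by auto
      have bs: "b \<otimes> s \<noteq> \<zero>" using cl ab(3) s(2) integral_iff by simp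
      have "(b \<otimes> s) \<otimes> (inv b \<otimes> inv s) = (b \<otimes> inv b) \<otimes> (s \<otimes> inv s)" using cl ib(1,3) by algebra
      then have "inv (b \<otimes> s) = inv b \<otimes> inv s" using cl ib by (intro comm_inv_char) auto
      then have "(a \<otimes> s) \<otimes> inv (b \<otimes> s) = (a \<otimes> inv b) \<otimes> (s \<otimes> inv s)"
        using cl(1,3) ib(1,3) by (simp only:) algebra
      then have "x = (a \<otimes> s) \<otimes> inv (b \<otimes> s)" using ab(4) ib cl by simp
      then show "x \<in> quot_field R C"
        unfolding quot_field_def using ideal[OF ab(1) s(1)] ideal[OF ab(2) s(1)] bs by blast
    qed
  qed
  moreover have "integer_part R leq I" unfolding integer_part_def using subring discrete floor by blast
  ultimately show ?thesis by blast
qed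

end

section \<open>Henselian fields with complements of all transcendence degrees\<close>

locale embedded_henselian = henselian_monomial_field R ord k \<iota> mon + embedded_values R ord k \<iota> mon emb
  for R :: "('a, 'r) ring_scheme" (structure) and ord :: "'a \<Rightarrow> 'g::linordered_ab_group_add"
    and k :: "('k, 'm) ring_scheme" and \<iota> :: "'k \<Rightarrow> 'a" and mon and emb :: "'g \<Rightarrow> 'e"
begin

lemma henselian: "henselian R G gle v"
  unfolding henselian_def
proof (intro conjI valued allI ballI impI)
  fix n c b
  assume b: "b \<in> Ov"
    and h: "(\<forall>i\<le>n. c i \<in> Ov) \<and> poly_value R n c b \<in> Mv \<and>
      v (poly_deriv_value R n c b) = Some \<one>\<^bsub>G\<^esub>"
  have D: "coarsening R ord {0}" by unfold_locales auto
  have ring: "coarse_ring {0} = Ov" and ideal: "coarse_ideal {0} = Mv"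
    unfolding coarse_ring_def coarse_ideal_def val_ring_eq val_ideal_eq ge_def gt_def by auto
  have "poly_deriv_value R n c b \<notin> Mv" using h unfolding val_ideal_def by simp
  then obtain a where a: "a \<in> carrier R" "poly_value R n c a = \<zero>" "a \<ominus> b \<in> Mv"
    using Hensel[OF D, of n c b] h b unfolding ring ideal by blast
  have bc: "b \<in> carrier R" "ge b 0" using b unfolding val_ring_eq by auto
  have "a = (a \<ominus> b) \<oplus> b" using a(1) bc(1) by algebra
  moreover have "ge (a \<ominus> b) 0" using a(3) gt_imp_ge unfolding val_ideal_eq by blast
  ultimately have "ge a 0" using ge_add[of "a \<ominus> b" b 0] a(1) bc by simp
  then show "\<exists>a\<in>Ov. poly_value R n c a = \<zero> \<and> a \<ominus> b \<in> Mv"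
    using a unfolding val_ring_eq by blast
qed

end

text \<open>There are elements outside of the valuation ring.\<close>

lemma (in staged_field) complement_nonzero:
  assumes "is_complement C" shows "\<exists>s\<in>C. s \<noteq> \<zero>"
proof -
  let ?t = "Index 0 undefined :: 'l index"
  have x: "mon (- gen ?t) \<in> carrier R - {\<zero>}" by (rule mon_nonzero)
  obtain r where r: "r \<in> C" "ge (mon (- gen ?t) \<ominus> r) 0"
    using assms x unfolding is_complement_def by blast
  have "r \<noteq> \<zero>"
  proof
    assume "r = \<zero>"
    then have "ge (mon (- gen ?t)) 0" using r(2) x by (simp add: a_minus_def)
    then have "0 \<le> - gen ?t" using x ord_mon by (simp add: ge_def)
    moreover have "0 < gen ?t" by (rule leading_pos[of ?t]) (auto simp: lookup_single when_def)
    ultimately show False by simp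
  qed
  then show ?thesis using r(1) by blast
qed

text \<open>The value group has integral exponents with finite support, a small part of the ambient type.\<close>

definition exponent_of :: "('l index \<Rightarrow>\<^sub>0 int) \<Rightarrow> 'l exponent" where
  "exponent_of a = (\<lambda>(n, i). of_int (coord a (Index n i)))"

lemma inj_exponent_of: "inj exponent_of"
proof (rule injI)
  fix a b :: "'l index \<Rightarrow>\<^sub>0 int" assume eq: "exponent_of a = exponent_of b"
  show "a = b"
  proof (rule poly_mapping_eqI)
    fix t :: "'l index"
    have "exponent_of a (stage t, label t) = exponent_of b (stage t, label t)" using eq by simp
    then show "coord a t = coord b t" unfolding exponent_of_def by simp
  qed
qed

theorem theorem6:
  fixes k :: "'k ring" and lam :: "'l rel"
  assumes "Card_order lam"
    and "field k"
    and "\<forall>n::nat. n > 0 \<longrightarrow> [n] \<cdot>\<^bsub>k\<^esub> \<one>\<^bsub>k\<^esub> \<noteq> \<zero>\<^bsub>k\<^esub>"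
  shows "\<exists>(L :: ('k, 'l) hahn ring) (G :: 'l exponent monoid) gle v \<iota>.
    henselian L G gle v \<and> has_residue_field L G gle v k \<iota> \<and>
    (\<exists>R. k_algebra L k \<iota> R \<and> additive_complement L (val_ring L G gle v) R \<and>
         quot_field L R = carrier L) \<and>
    (\<forall>\<kappa> :: 'l rel. Cnotzero \<kappa> \<and> \<kappa> \<le>o lam \<longrightarrow>
       (\<exists>R. k_algebra L k \<iota> R \<and> additive_complement L (val_ring L G gle v) R \<and>
            has_trdeg L (quot_field L R) \<kappa>)) \<and>
    (\<forall>kle leq. archimedean_ordered_field k kle \<and> ordered_field L leq \<and>
       compatible L gle v leq \<and> induces L G gle v leq k \<iota> kle \<longrightarrow>
       (\<exists>I. integer_part L leq I \<and> quot_field L I = carrier L) \<and>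
       (\<forall>\<kappa> :: 'l rel. Cnotzero \<kappa> \<and> \<kappa> \<le>o lam \<longrightarrow>
          (\<exists>I. integer_part L leq I \<and> has_trdeg L (quot_field L I) \<kappa>)))"
proof -
  let ?emb = "exponent_of :: ('l index \<Rightarrow>\<^sub>0 int) \<Rightarrow> 'l exponent"
  interpret field k by (rule assms(2))
  interpret S: hahn_series k ?emb by unfold_locales (rule inj_exponent_of)
  let ?\<iota> = "\<lambda>c. S.mterm c 0" and ?mon = "S.mterm \<one>\<^bsub>k\<^esub>"
  interpret E: monomial_field S.hs S.lead k ?\<iota> ?mon
    by (rule S.hs_monomial_field) (use assms(3) in blast)
  define L where "L = S.hs\<lparr>carrier := E.algebraic_hull ?mon UNIV\<rparr>"
  have "henselian_monomial_field L S.lead k ?\<iota> ?mon"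
    unfolding L_def by (rule E.henselian_hull) (rule S.hs.spherically_complete_axioms)
  then interpret H: henselian_monomial_field L S.lead k ?\<iota> ?mon .
  interpret H: staged_field L S.lead k ?\<iota> ?mon ..
  interpret H: embedded_henselian L S.lead k ?\<iota> ?mon ?emb by unfold_locales (rule inj_exponent_of)
  obtain C where C: "H.is_complement C" "quot_field L C = carrier L"
    using H.full_complement by blast
  have small: "\<exists>C. H.is_complement C \<and> has_trdeg L (quot_field L C) \<kappa>"
    if "Cnotzero \<kappa>" for \<kappa> :: "'l rel"
  proof -
    obtain D where D: "H.is_complement D" "subfield (quot_field L D) L"
      "transcendence_basis L (quot_field L D) ((\<lambda>j. H.mg (Index 0 j)) ` Field \<kappa>)"
      using H.small_complement[of "Field \<kappa>"] by blast
    have "inj_on (\<lambda>j. H.mg (Index 0 j)) (Field \<kappa>)"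
      using H.mg_inj by (auto simp: inj_on_def inj_def)
    then have "bij_betw (\<lambda>j. H.mg (Index 0 j)) (Field \<kappa>) ((\<lambda>j. H.mg (Index 0 j)) ` Field \<kappa>)"
      by (rule inj_on_imp_bij_betw)
    then have "|Field \<kappa>| =o |(\<lambda>j. H.mg (Index 0 j)) ` Field \<kappa>|" by (rule card_of_ordIsoI)
    then have "|(\<lambda>j. H.mg (Index 0 j)) ` Field \<kappa>| =o |Field \<kappa>|" by (rule ordIso_symmetric)
    moreover have "|Field \<kappa>| =o \<kappa>" using that by (intro card_of_Field_ordIso) simp
    ultimately have "|(\<lambda>j. H.mg (Index 0 j)) ` Field \<kappa>| =o \<kappa>" by (rule ordIso_transitive)
    then show ?thesis using D unfolding has_trdeg_def by blast
  qed
  have parts: "\<exists>I. integer_part L leq I \<and> quot_field L I = quot_field L D"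
    if "H.is_complement D" "archimedean_ordered_field k kle" "ordered_field L leq"
      "compatible L H.gle H.v leq" "induces L H.G H.gle H.v leq k ?\<iota> kle" for D kle leq
    using H.complement_nonzero[OF that(1)] H.complement_integer_part[OF that(1) _ _ that(2-5)] by blast
  show ?thesis
  proof (intro exI[of _ L] exI[of _ H.G] exI[of _ H.gle] exI[of _ H.v] exI[of _ ?\<iota>] conjI allI impI)
    show "henselian L H.G H.gle H.v" by (rule H.henselian)
    show "has_residue_field L H.G H.gle H.v k ?\<iota>" by (rule H.residue_field)
    show "\<exists>R. k_algebra L k ?\<iota> R \<and> additive_complement L (val_ring L H.G H.gle H.v) R \<and>
        quot_field L R = carrier L"
      using C H.complement_k_algebra H.complement_additive by blast
  next
    fix \<kappa> :: "'l rel" assume "Cnotzero \<kappa> \<and> \<kappa> \<le>o lam"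
    then obtain D where "H.is_complement D" "has_trdeg L (quot_field L D) \<kappa>" using small by blast
    then show "\<exists>R. k_algebra L k ?\<iota> R \<and> additive_complement L (val_ring L H.G H.gle H.v) R \<and>
        has_trdeg L (quot_field L R) \<kappa>"
      using H.complement_k_algebra H.complement_additive by blast
  next
    fix kle leq
    assume h: "archimedean_ordered_field k kle \<and> ordered_field L leq \<and>
      compatible L H.gle H.v leq \<and> induces L H.G H.gle H.v leq k ?\<iota> kle"
    show "\<exists>I. integer_part L leq I \<and> quot_field L I = carrier L"
      using parts[OF C(1), of kle leq] h C(2) by simp
    fix \<kappa> :: "'l rel" assume "Cnotzero \<kappa> \<and> \<kappa> \<le>o lam"
    then obtain D where D: "H.is_complement D" "has_trdeg L (quot_field L D) \<kappa>" using small by blast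
    then show "\<exists>I. integer_part L leq I \<and> has_trdeg L (quot_field L I) \<kappa>"
      using parts[OF D(1), of kle leq] h by metis
  qed
qed

end
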